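(* Let $d\ge 1$, $1<p<\infty$ and $p^*=\max\left(p,\frac{p}{p-1}\right)$. Let $\mathbf{R}^*f=(R_1^*f,\dots,R_d^*f)$, where $R_i^*=\delta_i^*(L+2)^{-1/2}$. Then for every $f\in L^p(\mathbb{R}^d)$, $$\|\mathbf{R}^*f\|_p=\left(\int_{\mathbb{R}^d}|\mathbf{R}^*f(x)|^p\,dx\right)^{1/p}\le 84\,(p^*-1)\,\|f\|_p .$$
   Context: All functions are real-valued; $|\cdot|$ is the Euclidean norm; $\|\cdot\|_p$ is the $L^p(\mathbb{R}^d)$ norm with respect to Lebesgue measure; $\langle\cdot,\cdot\rangle$ is the $L^2(\mathbb{R}^d)$ inner product; $\mathbb{N}=\{0,1,2,\dots\}$. Hermite functions: for $k\in\mathbb{N}$ and $x\in\mathbb{R}$, $h_k(x)=(2^k k!\sqrt{\pi})^{-1/2}e^{-x^2/2}H_k(x)$ with $H_k(x)=(-1)^ke^{x^2}\frac{d^k}{dx^k}e^{-x^2}$; for $n\in\mathbb{N}^d$ and $x\in\mathbb{R}^d$, $h_n(x)=h_{n_1}(x_1)\cdots h_{n_d}(x_d)$. Let $\mathcal{D}$ be the linear span of $\{h_n:n\in\mathbb{N}^d\}$; it is dense in $L^p(\mathbb{R}^d)$ for $1\le p<\infty$. Let $\delta_i^*=-\partial_{x_i}+x_i$. The harmonic oscillator $L=-\Delta+|x|^2$ satisfies $Lh_n=\lambda_nh_n$ with $\lambda_n=2|n|+d$, $|n|=n_1+\dots+n_d$. The operator $R_i^*=\delta_i^*(L+2)^{-1/2}$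 is given by $$R_i^*f=\sum_{n\in\mathbb{N}^d}(\lambda_n+2)^{-1/2}\langle f,h_n\rangle\,\delta_i^*h_n,$$ a finite sum for $f\in\mathcal{D}$. A densely defined bounded operator is identified with its unique bounded extension; thus the statement for $f\in L^p$ means that the inequality holds for $f\in\mathcal{D}$ and that $\mathbf{R}^*$ on $L^p$ is the bounded extension from $\mathcal{D}$. *)

theory Defs
  imports "HOL-Analysis.Analysis"
begin

text \<open>
  The space \<open>\<real>\<^sup>d\<close> is \<^typ>\<open>real ^ 'd\<close> with \<open>d = CARD('d) \<ge> 1\<close>, and multi-indices
  in \<open>\<nat>\<^sup>d\<close> have type \<^typ>\<open>nat ^ 'd\<close>.
  Elements of \<open>L\<^sup>p\<close> are represented by functions; identities between them are
  required almost everywhere.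
\<close>

definition Lp_space :: "real \<Rightarrow> (real ^ 'd \<Rightarrow> 'b::euclidean_space) set" where
  "Lp_space p = {f. f \<in> borel_measurable lebesgue \<and>
                    integrable lebesgue (\<lambda>x. norm (f x) powr p)}"

text \<open>Meaningful only for members of \<^const>\<open>Lp_space\<close>: the Bochner integral of a
  non-integrable function is \<open>0\<close>.\<close>

definition Lp_norm :: "real \<Rightarrow> (real ^ 'd \<Rightarrow> 'b::euclidean_space) \<Rightarrow> real" where
  "Lp_norm p f = (\<integral>x. norm (f x) powr p \<partial>lebesgue) powr (1 / p)"

definition L2_inner :: "(real ^ 'd \<Rightarrow> real) \<Rightarrow> (real ^ 'd \<Rightarrow> real) \<Rightarrow> real" where
  "L2_inner f g = (\<integral>x. f x * g x \<partial>lebesgue)"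

definition hermite_poly :: "nat \<Rightarrow> real \<Rightarrow> real" where
  "hermite_poly k x = (-1) ^ k * exp (x\<^sup>2) * (deriv ^^ k) (\<lambda>t. exp (- (t\<^sup>2))) x"

definition hermite_fun1 :: "nat \<Rightarrow> real \<Rightarrow> real" where
  "hermite_fun1 k x =
     (2 ^ k * fact k * sqrt pi) powr (- 1 / 2) * exp (- (x\<^sup>2) / 2) * hermite_poly k x"

definition hermite_fun :: "nat ^ 'd \<Rightarrow> real ^ 'd \<Rightarrow> real" where
  "hermite_fun n x = (\<Prod>i\<in>UNIV. hermite_fun1 (n $ i) (x $ i))"

text \<open>The linear span of the Hermite functions (there is no \<^class>\<open>real_vector\<close>
  instance for function types, so the library's \<open>span\<close> does not apply).\<close>

definition hermite_span :: "(real ^ 'd \<Rightarrow> real) set" where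
  "hermite_span = {f. \<exists>N c. finite N \<and> f = (\<lambda>x. \<Sum>n\<in>N. c n * hermite_fun n x)}"

definition hermite_eigenvalue :: "nat ^ 'd \<Rightarrow> real" where
  "hermite_eigenvalue n = 2 * real (\<Sum>i\<in>UNIV. n $ i) + real CARD('d)"

definition partial_deriv :: "'d \<Rightarrow> (real ^ 'd \<Rightarrow> real) \<Rightarrow> real ^ 'd \<Rightarrow> real" where
  "partial_deriv i f x = deriv (\<lambda>t. f (x + t *\<^sub>R axis i 1)) 0"

definition delta_star :: "'d \<Rightarrow> (real ^ 'd \<Rightarrow> real) \<Rightarrow> real ^ 'd \<Rightarrow> real" where
  "delta_star i f x = - partial_deriv i f x + x $ i * f x"

text \<open>The operator \<open>\<delta>\<^sub>i\<^sup>* (L + 2)\<^sup>-\<^sup>1\<^sup>/\<^sup>2\<close>, where \<open>L = - \<Delta> + |x|\<^sup>2\<close>, through the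
  spectral expansion of \<open>L\<close>. It is used only on \<^const>\<open>hermite_span\<close>, where all but
  finitely many summands vanish.\<close>

definition riesz_star_component ::
    "'d \<Rightarrow> (real ^ 'd \<Rightarrow> real) \<Rightarrow> real ^ 'd \<Rightarrow> real" where
  "riesz_star_component i f x =
     (\<Sum>\<^sub>\<infinity>n\<in>UNIV. (hermite_eigenvalue n + 2) powr (- 1 / 2)
                   * L2_inner f (hermite_fun n) * delta_star i (hermite_fun n) x)"

definition riesz_star :: "(real ^ 'd \<Rightarrow> real) \<Rightarrow> real ^ 'd \<Rightarrow> real ^ 'd" where
  "riesz_star f x = (\<chi> i. riesz_star_component i f x)"

text \<open>\<open>T\<close> is a bounded linear operator from \<open>L\<^sup>p(\<real>\<^sup>d)\<close> to \<open>L\<^sup>p(\<real>\<^sup>d; \<real>\<^sup>m)\<close> that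
  extends \<open>S\<close> from \<^const>\<open>hermite_span\<close>. Linearity and boundedness together make \<open>T\<close>
  respect equality almost everywhere.\<close>

definition bounded_Lp_extension ::
    "real \<Rightarrow> ((real ^ 'd \<Rightarrow> real) \<Rightarrow> real ^ 'd \<Rightarrow> real ^ 'm)
          \<Rightarrow> ((real ^ 'd \<Rightarrow> real) \<Rightarrow> real ^ 'd \<Rightarrow> real ^ 'm) \<Rightarrow> bool" where
  "bounded_Lp_extension p S T \<longleftrightarrow>
     (\<forall>f\<in>Lp_space p. T f \<in> Lp_space p) \<and>
     (\<forall>f\<in>Lp_space p. \<forall>g\<in>Lp_space p. \<forall>a b.
        AE x in lebesgue. T (\<lambda>y. a * f y + b * g y) x = a *\<^sub>R T f x + b *\<^sub>R T g x) \<and>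
     (\<exists>C. \<forall>f\<in>Lp_space p. Lp_norm p (T f) \<le> C * Lp_norm p f) \<and>
     (\<forall>f\<in>hermite_span. AE x in lebesgue. T f x = S f x)"

definition conj_max :: "real \<Rightarrow> real" where
  "conj_max p = max p (p / (p - 1))"

end

theory Submission
  imports Defs "HOL-Probability.Distributions"
begin

text \<open>
  The estimate is proved by duality. Let \<open>F = exp (- t (L + 2)\<^bsup>1/2\<^esup>) f\<close> and
  \<open>G\<^sub>i = exp (- t L\<^bsup>1/2\<^esup>) g\<^sub>i\<close> for finite Hermite expansions \<open>f\<close> and \<open>g\<^sub>1, \<dots>, g\<^sub>d\<close>. The pairing
  \<open>\<Psi> t = \<Sum>\<^sub>i \<langle>R\<^sub>i\<^sup>* F, G\<^sub>i\<rangle>\<close> satisfies \<open>\<Psi>'' = - 4 \<Sum>\<^sub>i \<langle>\<delta>\<^sub>i\<^sup>* F, \<partial>\<^sub>t G\<^sub>i\<rangle>\<close>. Let \<open>u\<close> be the one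
  of \<open>F\<close>, \<open>G\<close> that is measured with the exponent \<open>P \<ge> 2\<close>, let \<open>v\<close> be the other one, with the exponent
  \<open>Q\<close>, and consider the Bellman function
  \<open>B = |v|\<^sup>Q + (Q - 1) / 8 \<cdot> |u|\<^sup>2 (|u|\<^sup>P + |v|\<^sup>Q)\<^bsup>1 - 2/P\<^esup>\<close> and \<open>\<Phi> t = \<integral> B (u, v) dx\<close>. The
  convexity of \<open>B\<close> and the equations \<open>(\<partial>\<^sub>t\<^sup>2 + \<Delta>) F = (|x|\<^sup>2 + 2) F\<close>, \<open>(\<partial>\<^sub>t\<^sup>2 + \<Delta>) G = |x|\<^sup>2 G\<close>
  give \<open>|\<Psi>''| \<le> 12 / (Q - 1) \<cdot> \<Phi>''\<close>. Hence \<open>12 / (Q - 1) \<cdot> \<Phi> \<plusminus> \<Psi>\<close> are convex and vanish at infinity,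
  so they are nonnegative at \<open>t = 0\<close>, and \<open>1 / (Q - 1) = p\<^sup>* - 1\<close>. This yields the constant \<open>27\<close> in place
  of \<open>84\<close>; the passage to \<open>L\<^sup>p\<close> rests on the density of the span of the Hermite functions.
\<close>

section \<open>The Bellman function\<close>

text \<open>The second term of \<open>B\<close> is comparable to |u|^2 |v|^(2 - Q) where |v|^Q
  dominates and to |u|^P elsewhere. It is a smooth variant of the Nazarov-Treil function without its
  case distinction, so nothing needs mollifying; only the zeros of u and v stay singular, and a
  small extra component of both flows avoids them. The Hessian of \<open>B\<close> puts weights
  \<alpha> on |du|^2 and \<beta> on |dv|^2 with \<alpha>\<beta> \<ge> 1, which turns a weighted sum
  of two energies into the root of their product. The shift by 2 matches the amount by which
  delta_i^* raises an eigenvalue, so only modes with equal decay rates meet in the pairing. Treating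
  (g_1, ..., g_d) as one vector function keeps the constant free of the dimension. The constant: the
  integrand of \<Psi>'' is at most 6 times that root, the Laplacian of \<open>B\<close> at least (Q
  - 1) / 2 times it, whence 12 / (Q - 1); \<open>B\<close> is at most 9/8 (|u|^P + |v|^Q), and the
  integral of this sum is at most 2 after normalisation, so 12 times 9/8 times 2 gives 27.\<close>

locale bellman =
  fixes p q :: real
  assumes p_ge_2: "2 \<le> p" and q_eq: "q = p / (p - 1)"
begin

lemma q_gt_1: "1 < q" and q_le_2: "q \<le> 2" and pq: "(p - 1) * (q - 1) = 1"
  using p_ge_2 by (auto simp: q_eq field_simps)

lemma pq': "p * q = p + q"
  using pq by (simp add: algebra_simps)

definition pw where "pw X = X powr (p / 2)"
definition qw where "qw Y = Y powr (q / 2)"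
definition tot where "tot X Y = pw X + qw Y"
definition ww where "ww X Y = tot X Y powr (- 2 / p)"

text \<open>With \<open>X = |u|\<^sup>2\<close> and \<open>Y = |v|\<^sup>2\<close>, \<open>bell\<close> is
  \<open>|v|\<^sup>q + (q - 1) / 8 \<cdot> |u|\<^sup>2 (|u|\<^sup>p + |v|\<^sup>q)\<^bsup>1 - 2/p\<^esup>\<close>, which is smooth off the zero sets of \<open>u\<close> and \<open>v\<close>.\<close>

definition bell where "bell X Y = qw Y + (q - 1) / 8 * (X * tot X Y * ww X Y)"
text \<open>\<open>bu\<close> and \<open>bv\<close> are twice the partial derivatives of
  \<open>bell\<close> in X and Y. Along a curve with X' = 2 s and Y' = 2 r the derivative of
  \<open>bell\<close> is bu s + bv r; differentiating \<open>bu\<close> and \<open>bv\<close> then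
  adds \<open>c11\<close>, \<open>c12\<close> and minus \<open>c22\<close> as coefficients of s^2, s
  r and r^2. With this sign all three are nonnegative.\<close>

definition bu where "bu X Y = (q - 1) / 8 * (2 * tot X Y * ww X Y + (p - 2) * pw X * ww X Y)"
definition bv where "bv X Y = qw Y / Y * (q + (q - 1) / 8 * (2 - q) * X * ww X Y)"
definition c11 where
  "c11 X Y = (q - 1) / 8 * (pw X / X) * ww X Y * (p - 2) * (p + 2 - 2 * pw X / tot X Y)"
definition c12 where
  "c12 X Y = (q - 1) / 2 * (2 - q) * (qw Y / Y) * (qw Y / tot X Y) * ww X Y"
definition c22 where
  "c22 X Y = (2 - q) * (qw Y / Y\<^sup>2) *
     (q + (q - 1) / 8 * X * ww X Y * ((2 - q) + 2 * (q - 1) * qw Y / tot X Y))"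

lemma pos:
  assumes "0 < X" "0 < Y"
  shows "0 < pw X" "0 < qw Y" "0 < tot X Y" "0 < ww X Y"
proof -
  show *: "0 < pw X" "0 < qw Y" using assms by (auto simp: pw_def qw_def)
  then show "0 < tot X Y" by (simp add: tot_def)
  then show "0 < ww X Y" by (simp add: ww_def)
qed

lemma X_ww_le_1:
  assumes "0 < X" "0 < Y" shows "X * ww X Y \<le> 1"
proof -
  have "X = pw X powr (2 / p)"
    using assms p_ge_2 by (simp add: pw_def powr_powr)
  also have "\<dots> \<le> tot X Y powr (2 / p)"
    using pos[OF assms] p_ge_2 by (intro powr_mono2) (auto simp: tot_def)
  finally have "X * ww X Y \<le> tot X Y powr (2 / p) * ww X Y"
    using pos[OF assms] by simp
  also have "\<dots> = 1"
    using pos[OF assms] by (simp add: ww_def powr_add[symmetric])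
  finally show ?thesis .
qed

lemma tot_ww: "0 < X \<Longrightarrow> 0 < Y \<Longrightarrow> tot X Y * ww X Y = tot X Y powr (1 - 2 / p)"
  using pos[of X Y] powr_add[of "tot X Y" 1 "- 2 / p"] by (simp add: ww_def)

lemma q_exponent: "q / 2 * (1 - 2 / p) = 1 - q / 2"
  using pq' p_ge_2 by (simp add: field_simps)

text \<open>The exponents are conjugate, so |v|^2 is |v|^q times the power 1 - 2/p of |v|^q, and
  enlarging the latter base to \<open>tot\<close> only helps. Divided by Y this becomes
  \<alpha>\<beta> \<ge> 1 for the weights of the Hessian.\<close>

lemma Y_le_qw_tot_ww:
  assumes "0 < X" "0 < Y" shows "Y \<le> qw Y * (tot X Y * ww X Y)"
proof -
  have "Y = qw Y * qw Y powr (1 - 2 / p)"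
    unfolding qw_def powr_powr q_exponent
    using assms powr_add[of Y "q / 2" "1 - q / 2"] by simp
  also have "\<dots> \<le> qw Y * tot X Y powr (1 - 2 / p)"
    using pos[OF assms] p_ge_2 by (intro mult_left_mono powr_mono2) (auto simp: tot_def)
  finally show ?thesis using tot_ww[OF assms] by simp
qed

text \<open>The larger of the two powers carries the sum up to a factor 2. Splitting into a power of
  |u| and one of |v| lets separate Gaussian majorants of the two flows be inserted.\<close>

lemma tot_ww_le:
  assumes "0 < X" "0 < Y" shows "tot X Y * ww X Y \<le> 2 * (X powr (p / 2 - 1) + Y powr (1 - q / 2))"
proof -
  let ?a = "1 - 2 / p"
  have a: "0 \<le> ?a" "?a \<le> 1" using p_ge_2 by auto
  have two: "2 powr ?a \<le> 2" using powr_mono[of ?a 1 2] a by simp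
  have X: "pw X powr ?a = X powr (p / 2 - 1)"
    using p_ge_2 by (simp add: pw_def powr_powr algebra_simps)
  have Y: "qw Y powr ?a = Y powr (1 - q / 2)"
    unfolding qw_def powr_powr q_exponent ..
  have *: "tot X Y powr ?a \<le> 2 * m powr ?a" if "pw X \<le> m" "qw Y \<le> m" for m
  proof -
    have "tot X Y powr ?a \<le> (2 * m) powr ?a"
      using pos[OF assms] that a by (intro powr_mono2) (auto simp: tot_def)
    also have "\<dots> = 2 powr ?a * m powr ?a"
      using that pos[OF assms] by (intro powr_mult)
    also have "\<dots> \<le> 2 * m powr ?a" using two by (intro mult_right_mono) auto
    finally show ?thesis .
  qed
  have "tot X Y powr ?a \<le> 2 * (pw X powr ?a + qw Y powr ?a)"
    using *[of "pw X"] *[of "qw Y"] powr_ge_zero[of "pw X" ?a] powr_ge_zero[of "qw Y" ?a]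
    by (cases "pw X \<le> qw Y") (auto simp del: powr_ge_zero)
  then show ?thesis by (simp add: tot_ww[OF assms] X Y)
qed

lemma bell_nonneg: "0 < X \<Longrightarrow> 0 < Y \<Longrightarrow> 0 \<le> bell X Y"
  using pos[of X Y] q_gt_1 by (simp add: bell_def)

lemma bell_le:
  assumes "0 < X" "0 < Y" shows "bell X Y \<le> 9 / 8 * qw Y + 1 / 8 * pw X"
proof -
  have "X * tot X Y * ww X Y \<le> 1 * tot X Y"
    using X_ww_le_1[OF assms] pos[OF assms] mult_right_mono[of "X * ww X Y" 1 "tot X Y"]
    by (simp add: ac_simps)
  then have "(q - 1) / 8 * (X * tot X Y * ww X Y) \<le> 1 / 8 * tot X Y"
    using q_gt_1 q_le_2 pos[OF assms] assms by (intro mult_mono) auto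
  then show ?thesis by (simp add: bell_def tot_def)
qed

section \<open>Derivatives of \<open>bell\<close> along curves\<close>

lemma pw_deriv:
  assumes "(X has_real_derivative 2 * s) (at t)" "0 < X t"
  shows "((\<lambda>t. pw (X t)) has_real_derivative p * (pw (X t) / X t) * s) (at t)"
  using DERIV_fun_powr[OF assms, of "p / 2"] assms(2) by (simp add: pw_def powr_diff ac_simps)

lemma qw_deriv:
  assumes "(Y has_real_derivative 2 * r) (at t)" "0 < Y t"
  shows "((\<lambda>t. qw (Y t)) has_real_derivative q * (qw (Y t) / Y t) * r) (at t)"
  using DERIV_fun_powr[OF assms, of "q / 2"] assms(2) by (simp add: qw_def powr_diff ac_simps)

text \<open>X and Y will be |u|^2 and |v|^2. Writing their derivatives as 2 s and 2 r makes s and r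
  the inner products of u with u' and of v with v'.\<close>

context
  fixes X Y :: "real \<Rightarrow> real" and s r t :: real
  assumes X: "(X has_real_derivative 2 * s) (at t)" "0 < X t"
    and Y: "(Y has_real_derivative 2 * r) (at t)" "0 < Y t"
begin

lemma tot_deriv:
  "((\<lambda>t. tot (X t) (Y t)) has_real_derivative
    p * (pw (X t) / X t) * s + q * (qw (Y t) / Y t) * r) (at t)"
  unfolding tot_def by (intro DERIV_add pw_deriv qw_deriv X Y)

lemma ww_deriv:
  "((\<lambda>t. ww (X t) (Y t)) has_real_derivative
    - 2 / p * (ww (X t) (Y t) / tot (X t) (Y t)) *
      (p * (pw (X t) / X t) * s + q * (qw (Y t) / Y t) * r)) (at t)"
proof -
  have *: "0 < tot (X t) (Y t)" using pos X Y by blast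
  show ?thesis
    unfolding ww_def using DERIV_fun_powr[OF tot_deriv *, of "- 2 / p"] *
    by (simp add: powr_diff)
qed

lemma bell_deriv:
  "((\<lambda>t. bell (X t) (Y t)) has_real_derivative bu (X t) (Y t) * s + bv (X t) (Y t) * r) (at t)"
proof -
  note P = pos[OF X(2) Y(2)]
  define S T W w x y where d: "S = pw (X t)" "T = qw (Y t)" "W = tot (X t) (Y t)"
    "w = ww (X t) (Y t)" "x = X t" "y = Y t"
  define W' where "W' = p * (S / x) * s + q * (T / y) * r"
  have nz: "S \<noteq> 0" "T \<noteq> 0" "W \<noteq> 0" "w \<noteq> 0" "x \<noteq> 0" "y \<noteq> 0" "p \<noteq> 0" "W = S + T"
    using P X Y p_ge_2 by (auto simp: d tot_def)
  have "((\<lambda>t. bell (X t) (Y t)) has_real_derivative q * (T / y) * r +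
      (q - 1) / 8 * ((2 * s * W + W' * x) * w + - 2 / p * (w / W) * W' * (x * W))) (at t)"
    unfolding bell_def d W'_def
    by (intro DERIV_add DERIV_cmult DERIV_mult qw_deriv tot_deriv ww_deriv X Y)
  also have "(2 * s * W + W' * x) * w + - 2 / p * (w / W) * W' * (x * W)
      = 2 * s * W * w + (1 - 2 / p) * W' * x * w"
    using nz(3,7) by (simp add: field_simps)
  also have "\<dots> = (2 * W * w + (p - 2) * S * w) * s + (2 - q) * x * w * (T / y) * r"
  proof -
    have "(1 - 2 / p) * p = p - 2" "(1 - 2 / p) * q = 2 - q"
      using pq' nz(7) by (auto simp: field_simps)
    then have *: "(1 - 2 / p) * W' = (p - 2) * (S / x) * s + (2 - q) * (T / y) * r"
      unfolding W'_def by (simp add: distrib_left mult.assoc[symmetric])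
    show ?thesis unfolding * using nz(5) by (simp add: algebra_simps)
  qed
  finally show ?thesis
    by (rule DERIV_cong) (use Y in \<open>simp add: bu_def bv_def d field_simps\<close>)
qed

lemma bu_bv_deriv:
  obtains bu' bv' where
    "((\<lambda>t. bu (X t) (Y t)) has_real_derivative bu') (at t)"
    "((\<lambda>t. bv (X t) (Y t)) has_real_derivative bv') (at t)"
    "bu' * s + bv' * r =
      c11 (X t) (Y t) * s\<^sup>2 + c12 (X t) (Y t) * s * r - c22 (X t) (Y t) * r\<^sup>2"
proof -
  note P = pos[OF X(2) Y(2)]
  define S T W w x y where d: "S = pw (X t)" "T = qw (Y t)" "W = tot (X t) (Y t)"
    "w = ww (X t) (Y t)" "x = X t" "y = Y t"
  define W' where "W' = p * (S / x) * s + q * (T / y) * r"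
  define w' where "w' = - 2 / p * (w / W) * W'"
  have nz: "S \<noteq> 0" "T \<noteq> 0" "W \<noteq> 0" "w \<noteq> 0" "x \<noteq> 0" "y \<noteq> 0" "p \<noteq> 0" "W = S + T"
    using P X Y p_ge_2 by (auto simp: d tot_def)
  define bu' where "bu' = (q - 1) / 8 *
    (2 * W' * w + w' * (2 * W) + ((p - 2) * (p * (S / x) * s) * w + w' * ((p - 2) * S)))"
  define bv' where "bv' =
    (q * (T / y) * r * y - T * (2 * r)) / (y * y) * (q + (q - 1) / 8 * (2 - q) * x * w)
    + ((q - 1) / 8 * (2 - q) * (2 * s) * w + w' * ((q - 1) / 8 * (2 - q) * x)) * (T / y)"
  show ?thesis
  proof (rule that[of bu' bv'])
    show "((\<lambda>t. bu (X t) (Y t)) has_real_derivative bu') (at t)"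
      unfolding bu_def bu'_def d W'_def w'_def
      by (intro DERIV_add DERIV_cmult DERIV_mult pw_deriv tot_deriv ww_deriv X Y)
    have "((\<lambda>t. bv (X t) (Y t)) has_real_derivative
      (q * (T / y) * r * y - T * (2 * r)) / (y * y) * (q + (q - 1) / 8 * (2 - q) * x * w)
    + (0 + ((q - 1) / 8 * (2 - q) * (2 * s) * w + w' * ((q - 1) / 8 * (2 - q) * x))) * (T / y)) (at t)"
      unfolding bv_def d W'_def w'_def
      by (intro DERIV_add DERIV_cmult DERIV_mult DERIV_divide DERIV_const qw_deriv tot_deriv ww_deriv X Y)
        (use Y in auto)
    then show "((\<lambda>t. bv (X t) (Y t)) has_real_derivative bv') (at t)"
      by (simp add: bv'_def)
    have w': "w' = - 2 * (w / W) * (S / x * s + (q - 1) * (T / y) * r)"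
    proof -
      have "2 / p * W' = 2 * (S / x * s + (q / p) * (T / y) * r)"
        using nz(7) by (simp add: W'_def field_simps)
      moreover have "q / p = q - 1" using pq' nz(7) by (simp add: field_simps)
      moreover have "w' = - (w / W) * (2 / p * W')" by (simp add: w'_def ac_simps)
      ultimately show ?thesis by simp
    qed
    have 1: "bu' * s + bv' * r = 
       (q - 1) / 8 * ((S / x) * w * (p - 2) * (p + 2 - 2 * S / W)) * s\<^sup>2
       + (q - 1) / 8 * (w * (T / y)) *
           (2 * q - 4 * (q - 1) - 2 * (p - 2) * (q - 1) * (S / W) + (2 - q) * (2 - 2 * (S / W))) * (s * r)
       - (2 - q) * (T / y\<^sup>2) *
           (q + (q - 1) / 8 * x * w * ((2 - q) + 2 * (q - 1) * T / W)) * r\<^sup>2"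
      unfolding bu'_def bv'_def w' W'_def using nz(1-7)
      by (simp add: field_simps power2_eq_square)
    have "(p - 2) * (q - 1) = 2 - q" using pq' by (simp add: algebra_simps)
    then have "2 * ((p - 2) * (q - 1)) * (S / W) = 2 * (2 - q) * (S / W)" by simp
    then have *: "2 * (p - 2) * (q - 1) * (S / W) = 2 * (2 - q) * (S / W)" by (simp only: mult.assoc)
    \<comment> \<open>The mixed coefficient collects \<open>bu\<close> differentiated in Y and
      \<open>bv\<close> differentiated in X. Since (p - 2) (q - 1) = 2 - q it is a multiple of 1 - S
      / W, the share of |v|^q in \<open>tot\<close>.\<close>
    have "2 * q - 4 * (q - 1) - 2 * (p - 2) * (q - 1) * (S / W) + (2 - q) * (2 - 2 * (S / W))
       = 4 * (2 - q) * (1 - S / W)"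
      unfolding * by (simp add: algebra_simps add_divide_distrib diff_divide_distrib)
    also have "1 - S / W = T / W" using nz(3,8) by (simp add: field_simps)
    finally have 2: "2 * q - 4 * (q - 1) - 2 * (p - 2) * (q - 1) * (S / W) + (2 - q) * (2 - 2 * (S / W))
       = 4 * (2 - q) * (T / W)" .
    show "bu' * s + bv' * r =
      c11 (X t) (Y t) * s\<^sup>2 + c12 (X t) (Y t) * s * r - c22 (X t) (Y t) * r\<^sup>2"
      unfolding 1 2 unfolding c11_def c12_def c22_def d
      by (intro arg_cong2[where f = "(+)"] arg_cong2[where f = "(-)"]) (use P X Y in \<open>simp_all add: field_simps\<close>)
  qed
qed

end

text \<open>Because \<open>X * ww X Y\<close> is at most 1, the correction in \<open>bv\<close> adds
  at most 1 to q; and \<open>pw X\<close> is at most \<open>tot X Y\<close>. So both derivatives are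
  comparable to the weights of the Hessian. The lower bounds will pay for the |x|^2 terms of the
  energies, the upper ones enter the growth estimates.\<close>

lemma
  assumes X: "0 < X" and Y: "0 < Y"
  shows bu_ge: "(q - 1) / 4 * (tot X Y * ww X Y) \<le> bu X Y"
    and bu_le: "bu X Y \<le> p * (tot X Y * ww X Y)"
    and bv_ge: "qw Y / Y \<le> bv X Y"
    and bv_le: "bv X Y \<le> 3 * (qw Y / Y)"
proof -
  note P = pos[OF X Y] and q = q_gt_1 q_le_2
  have Sw: "0 \<le> pw X * ww X Y" "pw X * ww X Y \<le> tot X Y * ww X Y"
    using P by (auto simp: tot_def intro!: mult_right_mono)
  have bu: "bu X Y = (q - 1) / 4 * (tot X Y * ww X Y) + (q - 1) / 8 * ((p - 2) * (pw X * ww X Y))"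
    by (simp add: bu_def field_simps)
  show "(q - 1) / 4 * (tot X Y * ww X Y) \<le> bu X Y"
    unfolding bu using Sw p_ge_2 q by simp
  have "(p - 2) * (pw X * ww X Y) \<le> (p - 2) * (tot X Y * ww X Y)"
    using Sw p_ge_2 by (intro mult_left_mono) auto
  then have "(q - 1) / 8 * ((p - 2) * (pw X * ww X Y)) \<le> 1 * ((p - 2) * (tot X Y * ww X Y))"
    using q Sw P p_ge_2 by (intro mult_mono) (auto simp: tot_def)
  moreover have "(q - 1) / 4 * (tot X Y * ww X Y) \<le> 1 * (tot X Y * ww X Y)"
    using q Sw by (intro mult_right_mono) auto
  moreover have "(p - 2) * (tot X Y * ww X Y) = p * (tot X Y * ww X Y) - 2 * (tot X Y * ww X Y)"
    by (rule left_diff_distrib)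
  ultimately show "bu X Y \<le> p * (tot X Y * ww X Y)" unfolding bu using Sw by linarith
  have Z: "0 \<le> (q - 1) / 8 * (2 - q) * (X * ww X Y)" using q P X by simp
  have "(q - 1) / 8 * (2 - q) * (X * ww X Y) \<le> 1 * 1 * 1"
    using q P X X_ww_le_1[OF X Y] by (intro mult_mono) auto
  then have Z: "1 \<le> q + (q - 1) / 8 * (2 - q) * X * ww X Y" "q + (q - 1) / 8 * (2 - q) * X * ww X Y \<le> 3"
    using Z q unfolding mult.assoc[of _ X] by linarith+
  have "qw Y / Y * 1 \<le> bv X Y"
    unfolding bv_def using P Y Z by (intro mult_left_mono) auto
  then show "qw Y / Y \<le> bv X Y" by simp
  have "bv X Y \<le> qw Y / Y * 3"
    unfolding bv_def using P Y Z by (intro mult_left_mono) auto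
  then show "bv X Y \<le> 3 * (qw Y / Y)" by (simp add: ac_simps)
qed

text \<open>Here m, n stand for |du|^2, |dv|^2 and s, r for the inner products of u, du and of v,
  dv, so the hypotheses are Cauchy-Schwarz. For the lower bound \<open>bu\<close> contributes (q -
  1) E / 4, the terms in v contribute (q - 1) F, \<open>c11\<close> is nonnegative, and the mixed
  term costs at most half of this total.\<close>

lemma
  assumes X: "0 < X" and Y: "0 < Y" and n: "0 \<le> m" "0 \<le> n"
    and s: "s\<^sup>2 \<le> X * m" and r: "r\<^sup>2 \<le> Y * n"
  defines "H \<equiv> bu X Y * m + bv X Y * n + c11 X Y * s\<^sup>2 + c12 X Y * s * r - c22 X Y * r\<^sup>2"
  defines "E \<equiv> tot X Y * ww X Y * m" and "F \<equiv> qw Y / Y * n"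
  shows hessian_lower: "(q - 1) / 2 * (E / 4 + F) \<le> H"
    and hessian_upper: "\<bar>H\<bar> \<le> (p\<^sup>2 + p + 9) * (E + F)"
proof -
  note P = pos[OF X Y]
  define S T W w D Z where d: "S = pw X" "T = qw Y" "W = tot X Y" "w = ww X Y" "D = qw Y / Y"
    "Z = X * ww X Y"
  have pos: "0 < S" "0 < T" "0 < W" "0 < w" "0 < D" "0 < Z" "Z \<le> 1" and W: "W = S + T"
    using P X Y X_ww_le_1[OF X Y] by (auto simp: d tot_def)
  note q = q_gt_1 q_le_2
  have EF: "E = W * w * m" "F = D * n" "0 \<le> E" "0 \<le> F"
    using pos n P X Y by (auto simp: E_def F_def d)
  have TW: "0 \<le> T / W" "T / W \<le> 1" and SW: "0 \<le> S / W" "S / W \<le> 1"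
    using pos W by auto
  have SwE: "0 \<le> S * w * m" "S * w * m \<le> E"
    using pos n W by (auto simp: EF intro!: mult_right_mono)
  have bu_lo: "(q - 1) / 4 * E \<le> bu X Y * m"
    using mult_right_mono[OF bu_ge[OF X Y] n(1)] by (simp add: E_def ac_simps)
  have bu_hi: "bu X Y * m \<le> p * E"
    using mult_right_mono[OF bu_le[OF X Y] n(1)] by (simp add: E_def ac_simps)
  have c11: "c11 X Y * s\<^sup>2 = (q - 1) / 8 * (p - 2) * (p + 2 - 2 * (S / W)) * (S * w / X * s\<^sup>2)"
    by (simp add: c11_def d[symmetric])
  have k: "0 \<le> S * w / X * s\<^sup>2" "S * w / X * s\<^sup>2 \<le> E"
  proof -
    show "0 \<le> S * w / X * s\<^sup>2" using pos X by simp
    have "S * w / X * s\<^sup>2 \<le> S * w / X * (X * m)" using pos X s by (intro mult_left_mono) auto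
    also have "\<dots> = S * w * m" using X by simp
    finally show "S * w / X * s\<^sup>2 \<le> E" using SwE by simp
  qed
  have SW2: "0 \<le> p + 2 - 2 * (S / W)" using SW p_ge_2 by linarith
  have c11_lo: "0 \<le> c11 X Y * s\<^sup>2"
    unfolding c11 using q p_ge_2 SW2 pos X by (intro mult_nonneg_nonneg) auto
  have c11_hi: "c11 X Y * s\<^sup>2 \<le> p\<^sup>2 * E"
  proof -
    have "(q - 1) / 8 * (p - 2) * (p + 2 - 2 * (S / W)) \<le> 1 * (p - 2) * (p + 2)"
      using q p_ge_2 SW by (intro mult_mono) auto
    also have "\<dots> \<le> p\<^sup>2" by (simp add: power2_eq_square algebra_simps)
    finally have l: "(q - 1) / 8 * (p - 2) * (p + 2 - 2 * (S / W)) \<le> p\<^sup>2" .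
    show ?thesis unfolding c11 by (rule mult_mono[OF l k(2)]) (use k in auto)
  qed
  have c12: "\<bar>c12 X Y * s * r\<bar> \<le> (q - 1) / 2 * (E / 4 + F)"
  proof -
    have "c12 X Y * s * r = (q - 1) / 2 * ((2 - q) * (D * (T / W) * w) * (s * r))"
      by (simp add: c12_def d)
    then have "(c12 X Y * s * r)\<^sup>2 = ((q - 1) / 2)\<^sup>2 * ((2 - q)\<^sup>2 * (D * (T / W) * w)\<^sup>2 * (s\<^sup>2 * r\<^sup>2))"
      by (simp only: power_mult_distrib)
    also have "\<dots> \<le> ((q - 1) / 2)\<^sup>2 * (E / 4 + F)\<^sup>2"
    proof (rule mult_left_mono)
      have "(2 - q)\<^sup>2 * (D * (T / W) * w)\<^sup>2 * (s\<^sup>2 * r\<^sup>2) \<le> 1 * (D * (T / W) * w)\<^sup>2 * ((X * m) * (Y * n))"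
        using q s r n X by (intro mult_mono) (auto simp: power_le_one)
      \<comment> \<open>As D Y = T, all weights combine into E F; the leftover factors Z and T / W
        are at most 1.\<close>
      also have "\<dots> = E * F * (Z * (T / W) ^ 3)"
        using pos Y by (simp add: EF d power2_eq_square power3_eq_cube ac_simps)
      also have "\<dots> \<le> E * F * (1 * 1)"
        using EF pos TW by (intro mult_left_mono mult_mono power_le_one) auto
      \<comment> \<open>The weights 1/4 and 1 fit here: four times the product of E / 4 and F is
        exactly E F.\<close>
      also have "\<dots> \<le> (E / 4 + F)\<^sup>2"
        using sum_power2_ge_zero[of "E / 4 - F" 0] by (simp add: power2_eq_square algebra_simps)
      finally show "(2 - q)\<^sup>2 * (D * (T / W) * w)\<^sup>2 * (s\<^sup>2 * r\<^sup>2) \<le> (E / 4 + F)\<^sup>2" .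
    qed simp
    finally have "(c12 X Y * s * r)\<^sup>2 \<le> ((q - 1) / 2 * (E / 4 + F))\<^sup>2"
      by (simp only: power_mult_distrib)
    then show ?thesis
      using q EF by (metis abs_le_square_iff abs_of_nonneg add_nonneg_nonneg divide_nonneg_nonneg
          diff_ge_0_iff_ge less_imp_le mult_nonneg_nonneg zero_le_numeral)
  qed
  have bv: "bv X Y * n = (q + (q - 1) / 8 * (2 - q) * Z) * F"
    by (simp add: bv_def d EF ac_simps)
  have Z8: "0 \<le> (q - 1) / 8 * Z" "(q - 1) / 8 * Z \<le> q - 1"
  proof -
    show "0 \<le> (q - 1) / 8 * Z" using q pos by simp
    have "(q - 1) / 8 * Z \<le> (q - 1) * 1" using q pos by (intro mult_mono) auto
    then show "(q - 1) / 8 * Z \<le> q - 1" by simp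
  qed
  define c where "c = (2 - q) * (q + (q - 1) / 8 * Z * ((2 - q) + 2 * (q - 1) * (T / W)))"
  have c: "0 \<le> c" "c \<le> 5"
  proof -
    show "0 \<le> c" unfolding c_def using q Z8 TW pos by (intro mult_nonneg_nonneg add_nonneg_nonneg) auto
    have "2 * (q - 1) * (T / W) \<le> 2 * 1 * 1" using q TW by (intro mult_mono) auto
    then have "(q - 1) / 8 * Z * ((2 - q) + 2 * (q - 1) * (T / W)) \<le> 1 * 3"
      using q Z8 TW pos by (intro mult_mono) auto
    then have "q + (q - 1) / 8 * Z * ((2 - q) + 2 * (q - 1) * (T / W)) \<le> 5" using q by linarith
    then have "c \<le> 1 * 5" unfolding c_def using q Z8 TW pos
      by (intro mult_mono add_nonneg_nonneg mult_nonneg_nonneg) auto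
    then show "c \<le> 5" by simp
  qed
  have c22: "c22 X Y * r\<^sup>2 = c * (D / Y * r\<^sup>2)"
    by (simp add: c22_def c_def d power2_eq_square ac_simps)
  have k2: "0 \<le> D / Y * r\<^sup>2" "D / Y * r\<^sup>2 \<le> F"
  proof -
    show "0 \<le> D / Y * r\<^sup>2" using pos Y by simp
    have "D / Y * r\<^sup>2 \<le> D / Y * (Y * n)" using pos Y r by (intro mult_left_mono) auto
    then show "D / Y * r\<^sup>2 \<le> F" using Y by (simp add: EF)
  qed
  have c22_le: "0 \<le> c22 X Y * r\<^sup>2" "c22 X Y * r\<^sup>2 \<le> c * F"
    unfolding c22 by (rule mult_nonneg_nonneg[OF c(1) k2(1)], rule mult_left_mono[OF k2(2) c(1)])
  have v_lo: "(q - 1) * F \<le> bv X Y * n - c22 X Y * r\<^sup>2"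
  proof -
    \<comment> \<open>In the radial direction \<open>bv\<close> and \<open>c22\<close> nearly
      cancel. For |v|^q alone the remainder would be q (q - 1); the second term of
      \<open>bell\<close> preserves the factor q - 1 and perturbs the factor q by at most q - 1, so
      it stays at least 1.\<close>
    have "q + (q - 1) / 8 * (2 - q) * Z - c
      = (q - 1) * (q + (2 - q) * ((q - 1) / 8 * Z) * (1 - 2 * (T / W)))"
    proof -
      have "q + (2 - q) * h - (2 - q) * (q + h * ((2 - q) + 2 * (q - 1) * g))
          = (q - 1) * (q + (2 - q) * h * (1 - 2 * g))" for h g
        by algebra
      from this[of "(q - 1) / 8 * Z" "T / W"] show ?thesis by (simp add: c_def ac_simps)
    qed
    also have "\<dots> \<ge> (q - 1) * 1"
    proof (rule mult_left_mono)
      define h where "h = (2 - q) * ((q - 1) / 8 * Z)"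
      have 1: "h \<le> q - 1" unfolding h_def using mult_mono[of "2 - q" 1 "(q - 1) / 8 * Z" "q - 1"] q Z8 by auto
      have 2: "0 \<le> h" unfolding h_def using q Z8 pos by (intro mult_nonneg_nonneg) auto
      define g where "g = 1 - 2 * (T / W)"
      have "h * g \<ge> h * (-1)"
        using TW 2 unfolding g_def by (intro mult_left_mono) auto
      with 1 have "1 \<le> q + h * g" by linarith
      then show "1 \<le> q + (2 - q) * ((q - 1) / 8 * Z) * (1 - 2 * (T / W))"
        unfolding h_def g_def .
    qed (use q in auto)
    finally have "(q - 1) * F \<le> (q + (q - 1) / 8 * (2 - q) * Z - c) * F"
      using EF by (intro mult_right_mono) auto
    then show ?thesis using c22_le unfolding bv by (simp add: algebra_simps)
  qed
  have bv_hi: "0 \<le> bv X Y * n" "bv X Y * n \<le> 3 * F"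
    using mult_right_mono[OF bv_le[OF X Y] n(2)] mult_nonneg_nonneg[OF order_trans[OF _ bv_ge[OF X Y]] n(2)] pos(5)
    by (simp_all add: F_def d)
  have "(q - 1) / 4 * E + (q - 1) * F - (q - 1) / 2 * (E / 4 + F) = (q - 1) / 2 * (E / 4 + F)"
    by (simp add: field_simps)
  then show "(q - 1) / 2 * (E / 4 + F) \<le> H"
    unfolding H_def using bu_lo c11_lo c12 v_lo by linarith
  have "(q - 1) / 2 * (E / 4 + F) \<le> 1 * (E + F)"
    using q EF(3,4) by (intro mult_mono) auto
  with c12 have "\<bar>c12 X Y * s * r\<bar> \<le> E + F" by simp
  moreover have "c * F \<le> 5 * F" using c EF(3,4) by (intro mult_right_mono) auto
  moreover have "0 \<le> bu X Y * m" using bu_lo q EF(3,4) by (smt (verit) divide_nonneg_nonneg mult_nonneg_nonneg)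
  moreover have "0 \<le> p\<^sup>2 * F" "0 \<le> p * F" using EF(3,4) p_ge_2 by auto
  \<comment> \<open>9 = 3 + 5 + 1, from \<open>bv\<close>, \<open>c22\<close> and
    \<open>c12\<close>.\<close>
  ultimately have "\<bar>H\<bar> \<le> p\<^sup>2 * E + p * E + 9 * E + (p\<^sup>2 * F + p * F + 9 * F)"
    unfolding H_def using bu_hi c11_lo c11_hi bv_hi c22_le EF(3,4) by linarith
  then show "\<bar>H\<bar> \<le> (p\<^sup>2 + p + 9) * (E + F)"
    by (simp add: distrib_right distrib_left)
qed

section \<open>The Bellman function of two vectors and the growth of its derivatives\<close>

definition B :: "'a::real_inner \<Rightarrow> 'b::real_inner \<Rightarrow> real" where
  "B u v = bell (u \<bullet> u) (v \<bullet> v)"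

definition B1 :: "'a::real_inner \<Rightarrow> 'b::real_inner \<Rightarrow> 'a \<Rightarrow> 'b \<Rightarrow> real" where
  "B1 u v u1 v1 = bu (u \<bullet> u) (v \<bullet> v) * (u \<bullet> u1) + bv (u \<bullet> u) (v \<bullet> v) * (v \<bullet> v1)"

text \<open>Velocities and accelerations are separate arguments, so that one formula covers the time
  direction and every coordinate direction.\<close>

definition B2 :: "'a::real_inner \<Rightarrow> 'b::real_inner \<Rightarrow> 'a \<Rightarrow> 'b \<Rightarrow> 'a \<Rightarrow> 'b \<Rightarrow> real" where
  "B2 u v u1 v1 u2 v2 =
     bu (u \<bullet> u) (v \<bullet> v) * (u1 \<bullet> u1 + u \<bullet> u2) + bv (u \<bullet> u) (v \<bullet> v) * (v1 \<bullet> v1 + v \<bullet> v2)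
     + c11 (u \<bullet> u) (v \<bullet> v) * (u \<bullet> u1)\<^sup>2 + c12 (u \<bullet> u) (v \<bullet> v) * (u \<bullet> u1) * (v \<bullet> v1)
     - c22 (u \<bullet> u) (v \<bullet> v) * (v \<bullet> v1)\<^sup>2"

lemma inner_deriv:
  fixes u w :: "real \<Rightarrow> 'a::real_inner"
  assumes "(u has_vector_derivative u1) (at t)" "(w has_vector_derivative w1) (at t)"
  shows "((\<lambda>t. u t \<bullet> w t) has_real_derivative u1 \<bullet> w t + u t \<bullet> w1) (at t)"
  using has_derivative_inner[OF assms[unfolded has_vector_derivative_def]]
  unfolding has_field_derivative_def
  by (rule has_derivative_eq_rhs) (auto simp: fun_eq_iff algebra_simps)

lemma inner_self_deriv:
  fixes u :: "real \<Rightarrow> 'a::real_inner"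
  assumes "(u has_vector_derivative u1) (at t)"
  shows "((\<lambda>t. u t \<bullet> u t) has_real_derivative 2 * (u t \<bullet> u1)) (at t)"
  using inner_deriv[OF assms assms] by (simp add: inner_commute)

context
  fixes u :: "real \<Rightarrow> 'a::real_inner" and v :: "real \<Rightarrow> 'b::real_inner" and u1 v1 t
  assumes u: "(u has_vector_derivative u1 t) (at t)" "u t \<noteq> 0"
    and v: "(v has_vector_derivative v1 t) (at t)" "v t \<noteq> 0"
begin

lemma B_deriv: "((\<lambda>t. B (u t) (v t)) has_real_derivative B1 (u t) (v t) (u1 t) (v1 t)) (at t)"
  unfolding B_def B1_def using u v by (intro bell_deriv inner_self_deriv) auto

lemma B1_deriv:
  assumes u1: "(u1 has_vector_derivative u2) (at t)" and v1: "(v1 has_vector_derivative v2) (at t)"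
  shows "((\<lambda>t. B1 (u t) (v t) (u1 t) (v1 t)) has_real_derivative
    B2 (u t) (v t) (u1 t) (v1 t) u2 v2) (at t)"
proof -
  have nz: "0 < u t \<bullet> u t" "0 < v t \<bullet> v t" using u v by auto
  obtain bu' bv' where d:
    "((\<lambda>t. bu (u t \<bullet> u t) (v t \<bullet> v t)) has_real_derivative bu') (at t)"
    "((\<lambda>t. bv (u t \<bullet> u t) (v t \<bullet> v t)) has_real_derivative bv') (at t)"
    "bu' * (u t \<bullet> u1 t) + bv' * (v t \<bullet> v1 t) =
      c11 (u t \<bullet> u t) (v t \<bullet> v t) * (u t \<bullet> u1 t)\<^sup>2
      + c12 (u t \<bullet> u t) (v t \<bullet> v t) * (u t \<bullet> u1 t) * (v t \<bullet> v1 t)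
      - c22 (u t \<bullet> u t) (v t \<bullet> v t) * (v t \<bullet> v1 t)\<^sup>2"
    using bu_bv_deriv[OF inner_self_deriv[OF u(1)] nz(1) inner_self_deriv[OF v(1)] nz(2)] by blast
  have "((\<lambda>t. B1 (u t) (v t) (u1 t) (v1 t)) has_real_derivative
    (bu' * (u t \<bullet> u1 t) + (u1 t \<bullet> u1 t + u t \<bullet> u2) * bu (u t \<bullet> u t) (v t \<bullet> v t)) +
    (bv' * (v t \<bullet> v1 t) + (v1 t \<bullet> v1 t + v t \<bullet> v2) * bv (u t \<bullet> u t) (v t \<bullet> v t))) (at t)"
    unfolding B1_def by (intro DERIV_add DERIV_mult d inner_deriv u v u1 v1)
  then show ?thesis
    by (rule DERIV_cong) (use d(3) in \<open>simp add: B2_def algebra_simps\<close>)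
qed

end

lemma inner_le: 
  fixes a b :: "'c::real_inner"
  assumes "norm a \<le> K" "norm b \<le> K" shows "\<bar>a \<bullet> b\<bar> \<le> K\<^sup>2"
  using order_trans[OF Cauchy_Schwarz_ineq2 mult_mono[OF assms]] order_trans[OF norm_ge_zero assms(1)]
  by (auto simp: power2_eq_square)

text \<open>M bounds u and its derivatives, N bounds v and its derivatives, and n bounds |v| from
  below: the weight \<beta> is |v|^(q - 2) with a nonpositive exponent, so upper bounds alone cannot
  control it.\<close>

definition growth where
  "growth M N n = 4 * (p\<^sup>2 + p + 9) *
    ((M powr (p - 2) + N powr (2 - q)) * M\<^sup>2 + n powr (q - 2) * N\<^sup>2)"

text \<open>\<open>\<alpha>\<close> and \<open>\<beta>\<close> are the weights that the Hessian of
  \<open>B\<close> puts on |du|^2 and |dv|^2. In terms of norms they are (|u|^p + |v|^q)^(1 - 2/p)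
  and |v|^(q - 2).\<close>

definition \<alpha> :: "'a::real_inner \<Rightarrow> 'b::real_inner \<Rightarrow> real" where
  "\<alpha> u v = tot (u \<bullet> u) (v \<bullet> v) * ww (u \<bullet> u) (v \<bullet> v)"

definition \<beta> :: "'b::real_inner \<Rightarrow> real" where
  "\<beta> v = qw (v \<bullet> v) / (v \<bullet> v)"

context
  fixes u :: "'a::real_inner" and v :: "'b::real_inner"
  assumes u: "u \<noteq> 0" and v: "v \<noteq> 0"
begin

lemma uv_pos: "0 < u \<bullet> u" "0 < v \<bullet> v" "0 < \<alpha> u v" "0 < \<beta> v" "1 \<le> \<alpha> u v * \<beta> v"
proof -
  show *: "0 < u \<bullet> u" "0 < v \<bullet> v" using u v by auto
  note P = pos[OF *]
  show "0 < \<alpha> u v" "0 < \<beta> v" using P * by (auto simp: \<alpha>_def \<beta>_def)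
  show "1 \<le> \<alpha> u v * \<beta> v" using Y_le_qw_tot_ww[OF *] * by (simp add: \<alpha>_def \<beta>_def field_simps)
qed

text \<open>The accelerations stay outside the estimate: a single direction says nothing about them,
  only their sum over all directions is given by the differential equation.\<close>

lemma B2_lower:
  "(q - 1) / 2 * (\<alpha> u v / 4 * (u1 \<bullet> u1) + \<beta> v * (v1 \<bullet> v1))
    + bu (u \<bullet> u) (v \<bullet> v) * (u \<bullet> u2) + bv (u \<bullet> u) (v \<bullet> v) * (v \<bullet> v2) \<le> B2 u v u1 v1 u2 v2"
  using hessian_lower[OF uv_pos(1,2) inner_ge_zero[of u1] inner_ge_zero[of v1]
      Cauchy_Schwarz_ineq[of u u1] Cauchy_Schwarz_ineq[of v v1]]
  by (simp add: B2_def \<alpha>_def \<beta>_def distrib_left)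

lemma \<alpha>_le: "\<alpha> u v \<le> 2 * (norm u powr (p - 2) + norm v powr (2 - q))"
proof -
  have "(u \<bullet> u) powr (p / 2 - 1) = norm u powr (p - 2)" "(v \<bullet> v) powr (1 - q / 2) = norm v powr (2 - q)"
    using powr_powr[of "norm u" 2 "p / 2 - 1"] powr_powr[of "norm v" 2 "1 - q / 2"] u v
    by (auto simp: power2_norm_eq_inner algebra_simps)
  with tot_ww_le[OF uv_pos(1,2)] show ?thesis by (simp add: \<alpha>_def)
qed

lemma \<beta>_eq: "\<beta> v = norm v powr (q - 2)"
  using powr_powr[of "norm v" 2 "q / 2"] v uv_pos(2)
  by (simp add: \<beta>_def qw_def power2_norm_eq_inner powr_diff)

context
  fixes M N n :: real and u1 u2 :: 'a and v1 v2 :: 'b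
  assumes M: "norm u \<le> M" "norm u1 \<le> M" "norm u2 \<le> M"
    and N: "norm v \<le> N" "norm v1 \<le> N" "norm v2 \<le> N"
    and n: "0 < n" "n \<le> norm v"
begin

lemma growth_aux: "2 * (p\<^sup>2 + p + 9) * (\<alpha> u v * M\<^sup>2 + \<beta> v * N\<^sup>2) \<le> growth M N n"
proof -
  have "norm u powr (p - 2) \<le> M powr (p - 2)" "norm v powr (2 - q) \<le> N powr (2 - q)"
    using M N p_ge_2 q_le_2 by (auto intro!: powr_mono2)
  from order_trans[OF \<alpha>_le mult_left_mono[OF add_mono[OF this]]] have "\<alpha> u v \<le> 2 * (M powr (p - 2) + N powr (2 - q))" by simp
  moreover have "\<beta> v \<le> 2 * n powr (q - 2)"
    using powr_mono2'[of "q - 2" n "norm v"] n q_le_2 powr_ge_zero[of n "q - 2"]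
    unfolding \<beta>_eq by linarith
  ultimately have "\<alpha> u v * M\<^sup>2 + \<beta> v * N\<^sup>2 \<le>
    (2 * (M powr (p - 2) + N powr (2 - q))) * M\<^sup>2 + (2 * n powr (q - 2)) * N\<^sup>2"
    by (intro add_mono mult_right_mono) auto
  then have "2 * (p\<^sup>2 + p + 9) * (\<alpha> u v * M\<^sup>2 + \<beta> v * N\<^sup>2) \<le> 2 * (p\<^sup>2 + p + 9) *
    ((2 * (M powr (p - 2) + N powr (2 - q))) * M\<^sup>2 + (2 * n powr (q - 2)) * N\<^sup>2)"
    using p_ge_2 by (intro mult_left_mono) auto
  then show ?thesis by (simp add: growth_def algebra_simps)
qed

lemma bu_bv_abs: "\<bar>bu (u \<bullet> u) (v \<bullet> v)\<bar> \<le> p * \<alpha> u v" "\<bar>bv (u \<bullet> u) (v \<bullet> v)\<bar> \<le> 3 * \<beta> v"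
proof -
  have "0 \<le> (q - 1) / 4 * \<alpha> u v" using uv_pos q_gt_1 by simp
  then show "\<bar>bu (u \<bullet> u) (v \<bullet> v)\<bar> \<le> p * \<alpha> u v" "\<bar>bv (u \<bullet> u) (v \<bullet> v)\<bar> \<le> 3 * \<beta> v"
    using bu_ge[OF uv_pos(1,2)] bu_le[OF uv_pos(1,2)] bv_ge[OF uv_pos(1,2)] bv_le[OF uv_pos(1,2)] uv_pos
    unfolding \<alpha>_def \<beta>_def by linarith+
qed

lemma bu_bv_inner:
  assumes "norm u' \<le> M" "norm v' \<le> N"
  shows "\<bar>bu (u \<bullet> u) (v \<bullet> v) * (u \<bullet> u') + bv (u \<bullet> u) (v \<bullet> v) * (v \<bullet> v')\<bar>
    \<le> (p\<^sup>2 + p + 9) * (\<alpha> u v * M\<^sup>2 + \<beta> v * N\<^sup>2)"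
proof -
  have "\<bar>bu (u \<bullet> u) (v \<bullet> v) * (u \<bullet> u')\<bar> \<le> (p * \<alpha> u v) * M\<^sup>2"
    "\<bar>bv (u \<bullet> u) (v \<bullet> v) * (v \<bullet> v')\<bar> \<le> (3 * \<beta> v) * N\<^sup>2"
    unfolding abs_mult using bu_bv_abs uv_pos p_ge_2 M N assms
    by (auto intro!: mult_mono inner_le)
  moreover have "p * (\<alpha> u v * M\<^sup>2) \<le> (p\<^sup>2 + p + 9) * (\<alpha> u v * M\<^sup>2)" "3 * (\<beta> v * N\<^sup>2) \<le> (p\<^sup>2 + p + 9) * (\<beta> v * N\<^sup>2)"
    using uv_pos p_ge_2 by (auto intro!: mult_right_mono)
  ultimately show ?thesis by (simp add: distrib_left)
qed

lemma B1_growth: "\<bar>B1 u v u1 v1\<bar> \<le> growth M N n"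
proof -
  have "0 \<le> (p\<^sup>2 + p + 9) * (\<alpha> u v * M\<^sup>2 + \<beta> v * N\<^sup>2)" using uv_pos p_ge_2 by simp
  then show ?thesis using bu_bv_inner[OF M(2) N(2)] growth_aux
    unfolding B1_def mult.assoc by linarith
qed

lemma B2_growth: "\<bar>B2 u v u1 v1 u2 v2\<bar> \<le> growth M N n"
proof -
  let ?H = "bu (u \<bullet> u) (v \<bullet> v) * (u1 \<bullet> u1) + bv (u \<bullet> u) (v \<bullet> v) * (v1 \<bullet> v1)
     + c11 (u \<bullet> u) (v \<bullet> v) * (u \<bullet> u1)\<^sup>2 + c12 (u \<bullet> u) (v \<bullet> v) * (u \<bullet> u1) * (v \<bullet> v1)
     - c22 (u \<bullet> u) (v \<bullet> v) * (v \<bullet> v1)\<^sup>2"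
  have "\<bar>?H\<bar> \<le> (p\<^sup>2 + p + 9) * (\<alpha> u v * (u1 \<bullet> u1) + \<beta> v * (v1 \<bullet> v1))"
    using hessian_upper[OF uv_pos(1,2) inner_ge_zero[of u1] inner_ge_zero[of v1]
      Cauchy_Schwarz_ineq[of u u1] Cauchy_Schwarz_ineq[of v v1]]
    by (simp add: \<alpha>_def \<beta>_def)
  also have "\<dots> \<le> (p\<^sup>2 + p + 9) * (\<alpha> u v * M\<^sup>2 + \<beta> v * N\<^sup>2)"
    using inner_le[OF M(2,2)] inner_le[OF N(2,2)] uv_pos p_ge_2
    by (intro mult_left_mono add_mono) auto
  finally have "\<bar>?H\<bar> \<le> (p\<^sup>2 + p + 9) * (\<alpha> u v * M\<^sup>2 + \<beta> v * N\<^sup>2)" .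
  moreover have "B2 u v u1 v1 u2 v2 =
      ?H + (bu (u \<bullet> u) (v \<bullet> v) * (u \<bullet> u2) + bv (u \<bullet> u) (v \<bullet> v) * (v \<bullet> v2))"
    by (simp add: B2_def distrib_left)
  moreover have "2 * (p\<^sup>2 + p + 9) * (\<alpha> u v * M\<^sup>2 + \<beta> v * N\<^sup>2) = 2 * ((p\<^sup>2 + p + 9) * (\<alpha> u v * M\<^sup>2 + \<beta> v * N\<^sup>2))"
    by simp
  ultimately show ?thesis
    using bu_bv_inner[OF M(3) N(3)] growth_aux by linarith
qed

end

end

end

section \<open>Hermite functions\<close>

lemma leibniz_rule_lebesgue:
  fixes f f' :: "real \<Rightarrow> 'a \<Rightarrow> real"
  assumes d: "0 < d"
    and int: "\<And>t. \<bar>t - t0\<bar> < d \<Longrightarrow> integrable M (f t)"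
    and deriv: "\<And>x t. \<bar>t - t0\<bar> < d \<Longrightarrow> ((\<lambda>t. f t x) has_real_derivative f' t x) (at t)"
    and meas [measurable]: "f' t0 \<in> borel_measurable M"
    and g: "integrable M g" "\<And>x t. \<bar>t - t0\<bar> < d \<Longrightarrow> \<bar>f' t x\<bar> \<le> g x"
  shows "((\<lambda>t. \<integral>x. f t x \<partial>M) has_real_derivative (\<integral>x. f' t0 x \<partial>M)) (at t0)"
  unfolding DERIV_def tendsto_at_iff_sequentially
proof (intro allI impI)
  fix h :: "nat \<Rightarrow> real" assume h: "\<forall>i. h i \<in> UNIV - {0}" "h \<longlonglongrightarrow> 0"
  then obtain N where N: "\<And>n. N \<le> n \<Longrightarrow> \<bar>h n\<bar> < d"
    using LIMSEQ_D[OF h(2) d] by auto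
  \<comment> \<open>Only a tail of the sequence stays within the radius d, where the derivatives are
    known.\<close>
  define k where "k n = h (n + N)" for n
  have k: "k \<longlonglongrightarrow> 0" "k n \<noteq> 0" "\<bar>k n\<bar> < d" for n
    using LIMSEQ_ignore_initial_segment[OF h(2), of N] h(1) N[of "n + N"] by (auto simp: k_def[abs_def])
  have "(\<lambda>n. \<integral>x. (f (t0 + k n) x - f t0 x) / k n \<partial>M) \<longlonglongrightarrow> (\<integral>x. f' t0 x \<partial>M)"
  proof (rule integral_dominated_convergence[OF meas _ g(1)])
    fix n
    have "integrable M (f (t0 + k n))" "integrable M (f t0)" using k(3)[of n] d by (auto intro: int)
    then show "(\<lambda>x. (f (t0 + k n) x - f t0 x) / k n) \<in> borel_measurable M" by measurable
    show "AE x in M. norm ((f (t0 + k n) x - f t0 x) / k n) \<le> g x"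
    proof (rule AE_I2)
      fix x
      \<comment> \<open>The mean value theorem turns the bound on the derivatives into one on the
        difference quotients, as dominated convergence requires.\<close>
      obtain z where z: "\<bar>z - t0\<bar> < d" "f (t0 + k n) x - f t0 x = k n * f' z x"
      proof (cases "0 < k n")
        case True
        from MVT2[of t0 "t0 + k n" "\<lambda>t. f t x" "\<lambda>t. f' t x"] True k(3)[of n] deriv[of _ x]
        obtain z where "t0 < z" "z < t0 + k n" "f (t0 + k n) x - f t0 x = k n * f' z x" by auto
        then show thesis using k(3)[of n] by (intro that[of z]) auto
      next
        case False
        then have "k n < 0" using k(2)[of n] by linarith
        with MVT2[of "t0 + k n" t0 "\<lambda>t. f t x" "\<lambda>t. f' t x"] k(3)[of n] deriv[of _ x]
        obtain z where "t0 + k n < z" "z < t0" "f t0 x - f (t0 + k n) x = - k n * f' z x" by auto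
        then show thesis using k(3)[of n] by (intro that[of z]) auto
      qed
      then show "norm ((f (t0 + k n) x - f t0 x) / k n) \<le> g x"
        using g(2)[of z x] k(2)[of n] by simp
    qed
  next
    show "AE x in M. (\<lambda>n. (f (t0 + k n) x - f t0 x) / k n) \<longlonglongrightarrow> f' t0 x"
    proof (rule AE_I2)
      fix x
      have "((\<lambda>t. f t x) has_real_derivative f' t0 x) (at t0)" using d by (intro deriv) simp
      then have "((\<lambda>h. (f (t0 + h) x - f t0 x) / h) \<longlongrightarrow> f' t0 x) (at 0)" by (simp add: DERIV_def)
      then show "(\<lambda>n. (f (t0 + k n) x - f t0 x) / k n) \<longlonglongrightarrow> f' t0 x"
        unfolding tendsto_at_iff_sequentially comp_def using k by auto
    qed
  qed
  moreover have "(\<integral>x. (f (t0 + k n) x - f t0 x) / k n \<partial>M) =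
      ((\<integral>x. f (t0 + k n) x \<partial>M) - (\<integral>x. f t0 x \<partial>M)) / k n" for n
  proof -
    have "integrable M (f (t0 + k n))" "integrable M (f t0)" using k(3)[of n] d by (auto intro: int)
    then show ?thesis by simp
  qed
  ultimately have "(\<lambda>n. ((\<integral>x. f (t0 + k n) x \<partial>M) - (\<integral>x. f t0 x \<partial>M)) / k n) \<longlonglongrightarrow> (\<integral>x. f' t0 x \<partial>M)"
    by (simp only:)
  then show "((\<lambda>h. ((\<integral>x. f (t0 + h) x \<partial>M) - (\<integral>x. f t0 x \<partial>M)) / h) \<circ> h) \<longlonglongrightarrow> (\<integral>x. f' t0 x \<partial>M)"
    unfolding comp_def k_def by (rule LIMSEQ_offset)
qed

lemma
  fixes f :: "'a::euclidean_space \<Rightarrow> real \<Rightarrow> real"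
  assumes "\<And>b. b \<in> Basis \<Longrightarrow> integrable lborel (f b)"
  shows integrable_prod_Basis: "integrable lborel (\<lambda>x. \<Prod>b\<in>Basis. f b (x \<bullet> b))"
    and integral_prod_Basis: "(LBINT x. (\<Prod>b\<in>Basis. f b (x \<bullet> b))) = (\<Prod>b\<in>Basis. \<integral>x. f b x \<partial>lborel)"
proof -
  interpret product_sigma_finite "\<lambda>_::'a. lborel :: real measure" by standard
  have [measurable]: "f b \<in> borel_measurable borel" if "b \<in> Basis" for b
    using assms[OF that] by simp
  have m [measurable]: "(\<lambda>x. \<Prod>b\<in>Basis. f b (x \<bullet> b)) \<in> borel_measurable borel"
    by measurable
  have *: "(\<Prod>b\<in>Basis. f b ((\<Sum>b\<in>Basis. g b *\<^sub>R b) \<bullet> b)) = (\<Prod>b\<in>Basis. f b (g b))" for g :: "'a \<Rightarrow> real"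
    by (intro prod.cong) auto
  have s [measurable]: "(\<lambda>g. \<Sum>b\<in>Basis. g b *\<^sub>R b) \<in> (\<Pi>\<^sub>M b\<in>(Basis::'a set). lborel) \<rightarrow>\<^sub>M borel"
    by measurable
  show "integrable lborel (\<lambda>x. \<Prod>b\<in>Basis. f b (x \<bullet> b))"
    unfolding lborel_eq[where 'a='a] using product_integrable_prod[of Basis f] assms
    by (subst integrable_distr_eq) (auto simp: *)
  show "(LBINT x. (\<Prod>b\<in>Basis. f b (x \<bullet> b))) = (\<Prod>b\<in>Basis. \<integral>x. f b x \<partial>lborel)"
    unfolding lborel_eq[where 'a='a] using product_integral_prod[of Basis f] assms
    by (subst integral_distr) (auto simp: * lborel_eq[where 'a='a, symmetric])
qed

lemma integral_prod_vec:
  fixes f :: "'d::finite \<Rightarrow> real \<Rightarrow> real"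
  assumes "\<And>i. integrable lborel (f i)"
  shows "(\<integral>x. (\<Prod>i\<in>UNIV. f i (x $ i)) \<partial>(lborel :: (real^'d) measure)) = (\<Prod>i\<in>UNIV. \<integral>x. f i x \<partial>lborel)"
proof -
  \<comment> \<open>The index is recovered from the basis vector, because \<open>axis\<close> is
    injective in it.\<close>
  define g where "g b = f (THE i. b = axis i (1::real))" for b :: "real^'d"
  have inj: "inj (\<lambda>i::'d. axis i (1::real))" by (auto simp: inj_on_def axis_eq_axis)
  have g: "g (axis i 1) = f i" for i
    unfolding g_def by (rule arg_cong[where f=f]) (auto simp: axis_eq_axis)
  have B: "Basis = range (\<lambda>i::'d. axis i (1::real))"
    by (auto simp: Basis_vec_def)
  have *: "(\<Prod>b\<in>Basis. g b (x \<bullet> b)) = (\<Prod>i\<in>UNIV. f i (x $ i))" for x :: "real^'d"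
    unfolding B by (subst prod.reindex[OF inj]) (simp add: g inner_axis)
  have **: "(\<Prod>b\<in>Basis. \<integral>x. g b x \<partial>lborel) = (\<Prod>i\<in>UNIV. \<integral>x. f i x \<partial>lborel)"
    unfolding B by (subst prod.reindex[OF inj]) (simp add: g)
  have "integrable lborel (g b)" for b by (simp add: g_def assms)
  from integral_prod_Basis[of g, OF this]
  show "(\<integral>x. (\<Prod>i\<in>UNIV. f i (x $ i)) \<partial>(lborel :: (real^'d) measure)) = (\<Prod>i\<in>UNIV. \<integral>x. f i x \<partial>lborel)"
    by (simp add: * **)
qed

lemma has_bochner_integral_gaussian1:
  "has_bochner_integral lborel (\<lambda>x::real. exp (- x\<^sup>2)) (sqrt pi)"
  using has_bochner_integral_even_function[OF gaussian_moment_0] by simp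

lemma integrable_gaussian1: "0 < c \<Longrightarrow> integrable lborel (\<lambda>x::real. exp (- c * x\<^sup>2))"
  using lborel_integrable_real_affine[OF has_bochner_integral_gaussian1[THEN integrable.intros], of "sqrt c" 0]
  by (simp add: power_mult_distrib)

lemma integrable_gaussian:
  assumes "0 < c" shows "integrable lborel (\<lambda>x::'a::euclidean_space. exp (- c * (norm x)\<^sup>2))"
proof -
  have "(norm x)\<^sup>2 = (\<Sum>b\<in>Basis. (x \<bullet> b)\<^sup>2)" for x :: 'a
    unfolding power2_norm_eq_inner by (subst euclidean_inner) (simp add: power2_eq_square)
  then have "exp (- c * (norm x)\<^sup>2) = (\<Prod>b\<in>Basis. exp (- c * (x \<bullet> b)\<^sup>2))" for x :: 'a
    by (simp add: exp_sum[symmetric] sum_distrib_left sum_negf)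
  then show ?thesis
    using integrable_prod_Basis[of "\<lambda>(_::'a) x. exp (- c * x\<^sup>2)"] integrable_gaussian1[OF assms] by simp
qed

text \<open>As |x|^2 \<le> 2 |x + t e|^2 + 2, half of the rate survives a shift of length at most 1.
  One Gaussian therefore dominates all translates with |t| < 1.\<close>

lemma gaussian_shift:
  fixes x e :: "'a::real_normed_vector"
  assumes "norm e \<le> 1" "\<bar>t\<bar> < 1" "0 \<le> c"
  shows "exp (- c * (norm (x + t *\<^sub>R e))\<^sup>2) \<le> exp c * exp (- (c / 2) * (norm x)\<^sup>2)"
proof -
  have "norm x \<le> norm (x + t *\<^sub>R e) + norm (- t *\<^sub>R e)"
    using norm_triangle_ineq[of "x + t *\<^sub>R e" "- t *\<^sub>R e"] by simp
  also have "norm (- t *\<^sub>R e) \<le> 1" using assms mult_mono[of "\<bar>t\<bar>" 1 "norm e" 1] by simp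
  finally have "(norm x)\<^sup>2 \<le> (norm (x + t *\<^sub>R e) + 1)\<^sup>2" by (intro power_mono) auto
  also have "\<dots> \<le> 2 * (norm (x + t *\<^sub>R e))\<^sup>2 + 2"
    using zero_le_power2[of "norm (x + t *\<^sub>R e) - 1"] by (simp add: power2_eq_square algebra_simps)
  finally have "c * (norm x)\<^sup>2 \<le> c * (2 * (norm (x + t *\<^sub>R e))\<^sup>2 + 2)" using assms by (intro mult_left_mono)
  then show ?thesis by (simp add: exp_add[symmetric] algebra_simps)
qed

lemma integrable_gaussian_bound:
  fixes f :: "'a::euclidean_space \<Rightarrow> real"
  assumes "f \<in> borel_measurable borel" "0 < c" "\<And>x. \<bar>f x\<bar> \<le> C * exp (- c * (norm x)\<^sup>2)"
  shows "integrable lborel f"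
  by (rule Bochner_Integration.integrable_bound[OF integrable_mult_right[OF integrable_gaussian[OF assms(2)]], of _ C])
     (use assms in \<open>auto intro!: order_trans[OF _ abs_ge_self]\<close>)

text \<open>Translation invariance takes the place of an integration by parts: the derivative at \<open>t = 0\<close> of the
  constant function \<open>t \<mapsto> \<integral> w (x + t e) dx\<close> is computed under the integral.\<close>

lemma integral_directional_derivative:
  fixes w w' :: "'a::euclidean_space \<Rightarrow> real"
  assumes [measurable]: "w \<in> borel_measurable borel" "w' \<in> borel_measurable borel"
    and e: "norm e \<le> 1" and c: "0 < c"
    and deriv: "\<And>x. ((\<lambda>t. w (x + t *\<^sub>R e)) has_real_derivative w' x) (at 0)"
    and w: "\<And>x. \<bar>w x\<bar> \<le> C * exp (- c * (norm x)\<^sup>2)"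
    and w': "\<And>x. \<bar>w' x\<bar> \<le> C * exp (- c * (norm x)\<^sup>2)"
  shows "(LBINT x. w' x) = 0"
proof -
  have C: "0 \<le> C" using order_trans[OF abs_ge_zero w[of 0]] by simp
  have shift: "integrable lborel (\<lambda>x. w (x + a)) \<and> (LBINT x. w (x + a)) = (LBINT x. w x)" for a
  proof -
    have i: "integrable lborel w" using w c by (intro integrable_gaussian_bound) auto
    have "(\<integral>x. w x \<partial>distr lborel borel ((+) a)) = (LBINT x. w (a + x))"
      by (rule integral_distr) auto
    moreover have "integrable (distr lborel borel ((+) a)) w = integrable lborel (\<lambda>x. w (a + x))"
      by (rule integrable_distr_eq) auto
    ultimately show ?thesis using i by (simp add: lborel_distr_plus add.commute)
  qed
  have "((\<lambda>t. \<integral>x. w (x + t *\<^sub>R e) \<partial>lborel) has_real_derivative (LBINT x. w' (x + 0 *\<^sub>R e))) (at 0)"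
  proof (rule leibniz_rule_lebesgue[where d = 1 and g = "\<lambda>x. C * (exp c * exp (- (c / 2) * (norm x)\<^sup>2))"])
    fix x t assume t: "\<bar>t - 0\<bar> < (1::real)"
    have "((\<lambda>s. w (x + t *\<^sub>R e + (s - t) *\<^sub>R e)) has_real_derivative w' (x + t *\<^sub>R e) * 1) (at t)"
      by (rule DERIV_chain2[where g = "\<lambda>s. s - t"]) (auto intro!: deriv derivative_eq_intros)
    then show "((\<lambda>t. w (x + t *\<^sub>R e)) has_real_derivative w' (x + t *\<^sub>R e)) (at t)"
      by (simp add: algebra_simps)
    show "\<bar>w' (x + t *\<^sub>R e)\<bar> \<le> C * (exp c * exp (- (c / 2) * (norm x)\<^sup>2))"
      using C t e c by (intro order_trans[OF w'] mult_left_mono gaussian_shift) auto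
  next
    show "integrable lborel (\<lambda>x::'a. C * (exp c * exp (- (c / 2) * (norm x)\<^sup>2)))"
      using integrable_gaussian[of "c / 2", where 'a='a] c by simp
  qed (use shift in auto)
  then have "((\<lambda>t. \<integral>x. w x \<partial>lborel) has_real_derivative (LBINT x. w' x)) (at (0::real))"
    using shift by simp
  from DERIV_unique[OF this DERIV_const] show ?thesis .
qed


section \<open>Hermite polynomials and Hermite functions of one variable\<close>

primrec hermite :: "nat \<Rightarrow> real poly" where
  "hermite 0 = 1"
| "hermite (Suc k) = [:0, 2:] * hermite k - pderiv (hermite k)"

lemma pderiv_hermite: "pderiv (hermite (Suc k)) = smult (2 * real (Suc k)) (hermite k)"
proof (induction k)
  case 0
  show ?case by (simp add: pderiv_pCons)
next
  case (Suc k)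
  have "pderiv (hermite (Suc (Suc k))) = [:0, 2:] * pderiv (hermite (Suc k)) + smult 2 (hermite (Suc k))
      - pderiv (pderiv (hermite (Suc k)))"
    by (subst hermite.simps) (simp add: pderiv_diff pderiv_mult pderiv_pCons pderiv_smult mult.commute del: hermite.simps)
  also have "\<dots> = smult (2 * real (Suc k)) ([:0, 2:] * hermite k - pderiv (hermite k)) + smult 2 (hermite (Suc k))"
    by (simp add: Suc pderiv_smult smult_diff_right del: hermite.simps)
  also have "\<dots> = smult (2 * real (Suc (Suc k))) (hermite (Suc k))"
    unfolding hermite.simps(2)[symmetric] smult_add_left[symmetric] by simp
  finally show ?case .
qed

lemma poly_pderiv_hermite: "poly (pderiv (hermite k)) x = 2 * real k * poly (hermite (k - 1)) x"
  by (cases k) (simp_all add: pderiv_hermite pderiv_1 del: hermite.simps(2))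

lemma deriv_iterate_gaussian:
  "(deriv ^^ k) (\<lambda>t::real. exp (- t\<^sup>2)) = (\<lambda>x. (- 1) ^ k * poly (hermite k) x * exp (- x\<^sup>2))"
proof (induction k)
  case (Suc k)
  have "deriv (\<lambda>x. (- 1) ^ k * poly (hermite k) x * exp (- x\<^sup>2)) x
      = (- 1) ^ Suc k * poly (hermite (Suc k)) x * exp (- x\<^sup>2)" for x
    by (rule DERIV_imp_deriv) (auto intro!: derivative_eq_intros simp: algebra_simps)
  then show ?case by (simp add: Suc del: hermite.simps)
qed simp

lemma hermite_poly_eq: "hermite_poly k x = poly (hermite k) x"
proof -
  have "(- 1) ^ k * (- 1) ^ k = (1::real)" "exp (x\<^sup>2) * exp (- x\<^sup>2) = 1"
    by (simp_all flip: power_mult_distrib exp_add)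
  then have "((- 1) ^ k * (- 1) ^ k) * (exp (x\<^sup>2) * exp (- x\<^sup>2)) * poly (hermite k) x = poly (hermite k) x"
    by (simp only: mult_1_left)
  then show ?thesis unfolding hermite_poly_def deriv_iterate_gaussian by (simp only: ac_simps)
qed

lemma poly_hermite_Suc: "poly (hermite (Suc k)) x = 2 * x * poly (hermite k) x - 2 * real k * poly (hermite (k - 1)) x"
  by (simp add: poly_pderiv_hermite)

definition hnorm :: "nat \<Rightarrow> real" where
  "hnorm k = (2 ^ k * fact k * sqrt pi) powr (- 1 / 2)"

lemma hnorm_pos: "0 < hnorm k" by (simp add: hnorm_def)

lemma hnorm_eq: "hnorm k = sqrt (2 * real (Suc k)) * hnorm (Suc k)"
proof -
  have "hnorm (Suc k) = (2 * real (Suc k) * (2 ^ k * fact k * sqrt pi)) powr (- 1 / 2)"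
    by (simp add: hnorm_def algebra_simps)
  also have "\<dots> = (2 * real (Suc k)) powr (- 1 / 2) * hnorm k"
    unfolding hnorm_def by (rule powr_mult)
  also have "(2 * real (Suc k)) powr (- 1 / 2) = 1 / sqrt (2 * real (Suc k))"
    using powr_minus_divide[of "2 * real (Suc k)" "1 / 2"] by (simp add: powr_half_sqrt)
  finally show ?thesis by simp
qed

lemma hermite_fun1_eq: "hermite_fun1 k x = hnorm k * exp (- x\<^sup>2 / 2) * poly (hermite k) x"
  by (simp add: hermite_fun1_def hnorm_def hermite_poly_eq)

text \<open>The ladder coefficients: x h_k and h_k' are the sum and the difference of
  \<open>ha k\<close> h_(k-1) and \<open>ha (Suc k)\<close> h_(k+1). Since \<open>ha 0\<close> is 0,
  the truncated predecessor of index 0 does no harm.\<close>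

definition ha :: "nat \<Rightarrow> real" where "ha k = sqrt (real k / 2)"

lemma ha_0 [simp]: "ha 0 = 0" by (simp add: ha_def)

lemma ha_square: "ha k * ha k = real k / 2" by (simp add: ha_def)

lemma ha_Suc: "ha (Suc k) * hnorm (Suc k) = hnorm k / 2"
proof -
  have "sqrt (2 * real (Suc k)) = 2 * sqrt (real (Suc k) / 2)"
  proof -
    have "sqrt (2 * real (Suc k)) = sqrt (4 * (real (Suc k) / 2))" by (rule arg_cong[where f = sqrt]) simp
    then show ?thesis by (simp only: real_sqrt_mult[of 4] real_sqrt_four)
  qed
  then show ?thesis using hnorm_eq[of k] by (simp add: ha_def)
qed

lemma ha_pred: "ha k * hnorm (k - 1) = k * hnorm k"
proof (cases k)
  case (Suc m)
  have "2 * (ha k * ha k * hnorm k) = ha k * hnorm m"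
    using ha_Suc[of m] by (simp add: Suc)
  then show ?thesis by (simp add: Suc ha_square)
qed simp

lemma hermite_fun1_mult:
  "x * hermite_fun1 k x = ha k * hermite_fun1 (k - 1) x + ha (Suc k) * hermite_fun1 (Suc k) x"
proof -
  have "ha k * hermite_fun1 (k - 1) x + ha (Suc k) * hermite_fun1 (Suc k) x
    = exp (- x\<^sup>2 / 2) * ((ha k * hnorm (k - 1)) * poly (hermite (k - 1)) x
        + (ha (Suc k) * hnorm (Suc k)) * poly (hermite (Suc k)) x)"
    by (simp add: hermite_fun1_eq algebra_simps del: hermite.simps)
  then show ?thesis unfolding ha_pred ha_Suc poly_hermite_Suc
    by (simp add: hermite_fun1_eq algebra_simps)
qed

lemma hermite_fun1_deriv:
  "(hermite_fun1 k has_real_derivative ha k * hermite_fun1 (k - 1) x - ha (Suc k) * hermite_fun1 (Suc k) x) (at x)"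
proof -
  have e: "hermite_fun1 k = (\<lambda>x. hnorm k * exp (- x\<^sup>2 / 2) * poly (hermite k) x)"
    by (simp add: fun_eq_iff hermite_fun1_eq)
  have "(hermite_fun1 k has_real_derivative
      hnorm k * exp (- x\<^sup>2 / 2) * poly (pderiv (hermite k)) x - x * hermite_fun1 k x) (at x)"
    unfolding e by (auto intro!: derivative_eq_intros)
  moreover have "hnorm k * exp (- x\<^sup>2 / 2) * poly (pderiv (hermite k)) x = 2 * (ha k * hermite_fun1 (k - 1) x)"
    using ha_pred[of k] by (simp add: poly_pderiv_hermite hermite_fun1_eq mult.assoc[symmetric])
  ultimately show ?thesis by (simp add: hermite_fun1_mult)
qed

lemma hermite_fun1_cont: "continuous_on S (hermite_fun1 k)"
  by (meson DERIV_isCont continuous_at_imp_continuous_on hermite_fun1_deriv)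

lemma hermite_fun1_meas [measurable]: "hermite_fun1 k \<in> borel_measurable borel"
  by (intro borel_measurable_continuous_onI hermite_fun1_cont)

lemma power_le_fact_exp:
  assumes "0 \<le> (x::real)" shows "x ^ n \<le> fact n * exp x"
proof -
  have "(\<Sum>i\<in>{n}. x ^ i /\<^sub>R fact i) \<le> (\<Sum>i. x ^ i /\<^sub>R fact i)"
    using assms by (intro sum_le_suminf summable_exp_generic) auto
  also have "\<dots> = exp x" using exp_converges[of x] by (rule sums_unique[symmetric])
  finally have "x ^ n / fact n \<le> exp x" by (simp add: divide_inverse mult.commute)
  then show ?thesis by (simp add: pos_divide_le_eq mult.commute)
qed

lemma hermite_fun1_bound: "\<exists>C>0. \<forall>x. \<bar>hermite_fun1 k x\<bar> \<le> C * exp (- (3 / 8) * x\<^sup>2)"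
proof -
  define A where "A = (\<Sum>i\<le>degree (hermite k). \<bar>coeff (hermite k) i\<bar> * fact i)"
  have A: "0 \<le> A" by (auto simp: A_def intro!: sum_nonneg)
  have p: "\<bar>poly (hermite k) x\<bar> \<le> A * exp \<bar>x\<bar>" for x
  proof -
    have "\<bar>poly (hermite k) x\<bar> \<le> (\<Sum>i\<le>degree (hermite k). \<bar>coeff (hermite k) i\<bar> * \<bar>x\<bar> ^ i)"
      unfolding poly_altdef by (rule order_trans[OF sum_abs]) (simp add: abs_mult power_abs)
    also have "\<dots> \<le> (\<Sum>i\<le>degree (hermite k). \<bar>coeff (hermite k) i\<bar> * (fact i * exp \<bar>x\<bar>))"
      by (intro sum_mono mult_left_mono power_le_fact_exp) auto
    finally show ?thesis by (simp add: A_def sum_distrib_right mult.assoc)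
  qed
  have e: "exp (- x\<^sup>2 / 2) * exp \<bar>x\<bar> \<le> exp 2 * exp (- (3 / 8) * x\<^sup>2)" for x :: real
  proof -
    \<comment> \<open>An eighth of the Gaussian rate 1/2 pays for the exponential that dominates the
      polynomial; this leaves 3/8.\<close>
    have "\<bar>x\<bar> \<le> 2 + x\<^sup>2 / 8"
      using zero_le_power2[of "\<bar>x\<bar> - 4"] by (simp add: power2_eq_square algebra_simps abs_mult_self_eq)
    then show ?thesis by (simp flip: exp_add)
  qed
  have "\<bar>hermite_fun1 k x\<bar> \<le> (hnorm k * A * exp 2 + 1) * exp (- (3 / 8) * x\<^sup>2)" for x
  proof -
    have "\<bar>hermite_fun1 k x\<bar> = hnorm k * exp (- x\<^sup>2 / 2) * \<bar>poly (hermite k) x\<bar>"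
      using hnorm_pos[of k] by (simp add: hermite_fun1_eq abs_mult)
    also have "\<dots> \<le> hnorm k * exp (- x\<^sup>2 / 2) * (A * exp \<bar>x\<bar>)"
      using hnorm_pos[of k] by (intro mult_left_mono p) auto
    also have "\<dots> = (hnorm k * A) * (exp (- x\<^sup>2 / 2) * exp \<bar>x\<bar>)" by simp
    also have "\<dots> \<le> (hnorm k * A) * (exp 2 * exp (- (3 / 8) * x\<^sup>2))"
      using hnorm_pos[of k] A by (intro mult_left_mono e) auto
    also have "\<dots> \<le> (hnorm k * A * exp 2 + 1) * exp (- (3 / 8) * x\<^sup>2)"
      by (simp add: algebra_simps)
    finally show ?thesis .
  qed
  moreover have "0 < hnorm k * A * exp 2 + 1" using hnorm_pos[of k] A by (simp add: add_nonneg_pos)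
  ultimately show ?thesis by blast
qed

lemma hermite_fun1_mult_bound:
  "\<exists>C>0. \<forall>x. \<bar>hermite_fun1 k x * hermite_fun1 l x\<bar> \<le> C * exp (- (3 / 4) * x\<^sup>2)"
proof -
  obtain C where C: "0 < C" "\<And>x. \<bar>hermite_fun1 k x\<bar> \<le> C * exp (- (3 / 8) * x\<^sup>2)"
    using hermite_fun1_bound by blast
  obtain D where D: "0 < D" "\<And>x. \<bar>hermite_fun1 l x\<bar> \<le> D * exp (- (3 / 8) * x\<^sup>2)"
    using hermite_fun1_bound by blast
  from C D have "\<bar>hermite_fun1 k x * hermite_fun1 l x\<bar> \<le> (C * exp (- (3 / 8) * x\<^sup>2)) * (D * exp (- (3 / 8) * x\<^sup>2))" for x
    unfolding abs_mult by (intro mult_mono) auto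
  also have "(C * exp (- (3 / 8) * x\<^sup>2)) * (D * exp (- (3 / 8) * x\<^sup>2)) = C * D * exp (- (3 / 4) * x\<^sup>2)" for x :: real
    by (simp flip: exp_add)
  finally show ?thesis using \<open>0 < C\<close> \<open>0 < D\<close> by (intro exI[of _ "C * D"]) simp
qed

lemma hermite_fun1_integrable: "integrable lborel (\<lambda>x. hermite_fun1 k x * hermite_fun1 l x)"
proof -
  obtain C where "\<And>x. \<bar>hermite_fun1 k x * hermite_fun1 l x\<bar> \<le> C * exp (- (3 / 4) * x\<^sup>2)"
    using hermite_fun1_mult_bound[of k l] by blast
  then show ?thesis by (intro integrable_gaussian_bound[where c = "3 / 4"]) auto
qed

text \<open>The integral of (h_k h_l)' vanishes. The ladder writes this derivative with four
  products; expanding x h_k h_l once through h_k and once through h_l trades two of them for the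
  other two.\<close>

lemma hermite_fun1_ladder:
  "ha k * (LBINT x. hermite_fun1 (k - 1) x * hermite_fun1 l x)
    = ha (Suc l) * (LBINT x. hermite_fun1 k x * hermite_fun1 (Suc l) x)"
proof -
  let ?h = hermite_fun1
  let ?w' = "\<lambda>x. (ha k * ?h (k - 1) x - ha (Suc k) * ?h (Suc k) x) * ?h l x
      + (ha l * ?h (l - 1) x - ha (Suc l) * ?h (Suc l) x) * ?h k x"
  have alt: "?w' x = 2 * (ha k * (?h (k - 1) x * ?h l x)) - 2 * (ha (Suc l) * (?h k x * ?h (Suc l) x))" for x
  proof -
    have "(ha k * ?h (k - 1) x + ha (Suc k) * ?h (Suc k) x) * ?h l x
        = (ha l * ?h (l - 1) x + ha (Suc l) * ?h (Suc l) x) * ?h k x"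
    proof -
      have "(x * ?h k x) * ?h l x = (x * ?h l x) * ?h k x" by simp
      then show ?thesis by (simp only: hermite_fun1_mult)
    qed
    then show ?thesis by (simp add: algebra_simps)
  qed
  obtain C1 where C1: "0 < C1" "\<And>x. \<bar>?h k x * ?h l x\<bar> \<le> C1 * exp (- (3 / 4) * x\<^sup>2)"
    using hermite_fun1_mult_bound[of k l] by blast
  obtain C2 where C2: "0 < C2" "\<And>x. \<bar>?h (k - 1) x * ?h l x\<bar> \<le> C2 * exp (- (3 / 4) * x\<^sup>2)"
    using hermite_fun1_mult_bound[of "k - 1" l] by blast
  obtain C3 where C3: "0 < C3" "\<And>x. \<bar>?h k x * ?h (Suc l) x\<bar> \<le> C3 * exp (- (3 / 4) * x\<^sup>2)"
    using hermite_fun1_mult_bound[of k "Suc l"] by blast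
  note C = C1 C2 C3
  have ha: "0 \<le> ha i" for i by (simp add: ha_def)
  define C where "C = C1 + 2 * ha k * C2 + 2 * ha (Suc l) * C3"
  have "(LBINT x. ?w' x) = 0"
  proof (rule integral_directional_derivative[where w = "\<lambda>x. ?h k x * ?h l x" and e = 1 and C = C and c = "3 / 4"])
    fix x :: real
    have "((\<lambda>y. ?h k y * ?h l y) has_real_derivative ?w' x) (at (x + 0 *\<^sub>R 1))"
      using DERIV_mult[OF hermite_fun1_deriv[of k x] hermite_fun1_deriv[of l x]] by simp
    moreover have "((\<lambda>t. x + t *\<^sub>R 1) has_real_derivative 1) (at 0)"
      by (auto intro!: derivative_eq_intros)
    ultimately have "((\<lambda>t. ?h k (x + t *\<^sub>R 1) * ?h l (x + t *\<^sub>R 1)) has_real_derivative ?w' x * 1) (at 0)"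
      by (rule DERIV_chain2[where f = "\<lambda>y. ?h k y * ?h l y" and g = "\<lambda>t. x + t *\<^sub>R 1"])
    then
    show "((\<lambda>t. ?h k (x + t *\<^sub>R 1) * ?h l (x + t *\<^sub>R 1)) has_real_derivative ?w' x) (at 0)"
      by simp
    have "\<bar>?h k x * ?h l x\<bar> \<le> C1 * exp (- (3 / 4) * x\<^sup>2)" by (rule C)
    also have "\<dots> \<le> C * exp (- (3 / 4) * x\<^sup>2)"
      using C(1,3,5) ha by (intro mult_right_mono) (auto simp: C_def)
    finally show "\<bar>?h k x * ?h l x\<bar> \<le> C * exp (- (3 / 4) * (norm x)\<^sup>2)" by simp
    have "\<bar>?w' x\<bar> \<le> 2 * ha k * \<bar>?h (k - 1) x * ?h l x\<bar> + 2 * ha (Suc l) * \<bar>?h k x * ?h (Suc l) x\<bar>"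
      unfolding alt using ha by (intro order_trans[OF abs_triangle_ineq4]) (simp add: abs_mult)
    also have "\<dots> \<le> 2 * ha k * (C2 * exp (- (3 / 4) * x\<^sup>2)) + 2 * ha (Suc l) * (C3 * exp (- (3 / 4) * x\<^sup>2))"
      using ha by (intro add_mono mult_left_mono C) auto
    also have "\<dots> \<le> C * exp (- (3 / 4) * x\<^sup>2)" using C(1) by (simp add: C_def algebra_simps)
    finally show "\<bar>?w' x\<bar> \<le> C * exp (- (3 / 4) * (norm x)\<^sup>2)" by simp
  qed auto
  then show ?thesis
    unfolding alt using hermite_fun1_integrable by (simp add: hermite_fun1_integrable)
qed

text \<open>The ladder identity lowers both indices at once. When exactly one index reaches 0, the
  coefficient \<open>ha 0\<close> makes the integral vanish; when both do, it is the Gaussian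
  integral.\<close>

lemma hermite_fun1_orthonormal:
  "(LBINT x. hermite_fun1 k x * hermite_fun1 l x) = (if k = l then 1 else 0)"
proof (induction k arbitrary: l)
  case 0
  have h0: "hermite_fun1 0 x * hermite_fun1 0 x = exp (- x\<^sup>2) / sqrt pi" for x
  proof -
    have "hnorm 0 * hnorm 0 = 1 / sqrt pi"
      by (simp add: hnorm_def powr_add[symmetric] powr_minus_divide)
    then have "hnorm 0 * hnorm 0 * (exp (- x\<^sup>2 / 2) * exp (- x\<^sup>2 / 2)) = exp (- x\<^sup>2) / sqrt pi"
      by (simp flip: exp_add)
    then show ?thesis by (simp add: hermite_fun1_eq ac_simps)
  qed
  show ?case
  proof (cases l)
    case 0
    have "(LBINT x. exp (- x\<^sup>2) / sqrt pi) = 1"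
      by (simp only: integral_divide_zero has_bochner_integral_integral_eq[OF has_bochner_integral_gaussian1]) simp
    then show ?thesis unfolding 0 h0 by (simp only: simp_thms if_True)
  next
    case (Suc m)
    have "ha (Suc m) \<noteq> 0" by (simp add: ha_def)
    with Suc show ?thesis using hermite_fun1_ladder[of 0 m] by simp
  qed
next
  case (Suc k)
  have nz: "ha (Suc m) \<noteq> 0" for m by (simp add: ha_def)
  show ?case
  proof (cases l)
    case 0
    have "ha (Suc k) * (LBINT x. hermite_fun1 0 x * hermite_fun1 (Suc k) x) = 0"
      using hermite_fun1_ladder[of 0 k] by simp
    with 0 nz show ?thesis by (simp add: mult.commute)
  next
    case (Suc m)
    with hermite_fun1_ladder[of "Suc k" m] Suc.IH[of m] nz show ?thesis by (auto split: if_splits)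
  qed
qed


section \<open>Hermite functions of several variables\<close>

definition hset :: "nat ^ 'd \<Rightarrow> 'd \<Rightarrow> nat \<Rightarrow> nat ^ 'd" where
  "hset n i k = (\<chi> j. if j = i then k else n $ j)"

lemma hset_nth [simp]: "hset n i k $ j = (if j = i then k else n $ j)"
  by (simp add: hset_def)

lemma hset_self [simp]: "hset n i (n $ i) = n" and hset_hset [simp]: "hset (hset n i k) i l = hset n i l"
  by (auto simp: vec_eq_iff)

lemma hermite_fun_split:
  "hermite_fun (hset n i k) x = hermite_fun1 k (x $ i) * (\<Prod>j\<in>UNIV - {i}. hermite_fun1 (n $ j) (x $ j))"
proof -
  have "hermite_fun (hset n i k) x = hermite_fun1 k (x $ i) *
      (\<Prod>j\<in>UNIV - {i}. hermite_fun1 (hset n i k $ j) (x $ j))"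
    unfolding hermite_fun_def by (subst prod.remove[of UNIV i]) auto
  then show ?thesis by simp
qed

lemma hermite_fun_split_self:
  "hermite_fun n x = hermite_fun1 (n $ i) (x $ i) * (\<Prod>j\<in>UNIV - {i}. hermite_fun1 (n $ j) (x $ j))"
  using hermite_fun_split[of n i "n $ i" x] by simp

text \<open>Ladder form of the i-th partial derivative; \<open>hermite_dd\<close> is the second one.
  Derivatives thus remain finite combinations of Hermite functions and inherit their bounds. At
  \<open>n $ i = 0\<close> the lowered term has coefficient 0.\<close>

definition hermite_d :: "'d \<Rightarrow> nat ^ 'd \<Rightarrow> real ^ 'd \<Rightarrow> real" where
  "hermite_d i n x = ha (n $ i) * hermite_fun (hset n i (n $ i - 1)) x
    - ha (Suc (n $ i)) * hermite_fun (hset n i (Suc (n $ i))) x"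

definition hermite_dd :: "'d \<Rightarrow> nat ^ 'd \<Rightarrow> real ^ 'd \<Rightarrow> real" where
  "hermite_dd i n x = ha (n $ i) * hermite_d i (hset n i (n $ i - 1)) x
    - ha (Suc (n $ i)) * hermite_d i (hset n i (Suc (n $ i))) x"

lemma hermite_fun_mult:
  "x $ i * hermite_fun n x = ha (n $ i) * hermite_fun (hset n i (n $ i - 1)) x
    + ha (Suc (n $ i)) * hermite_fun (hset n i (Suc (n $ i))) x"
proof -
  let ?R = "\<Prod>j\<in>UNIV - {i}. hermite_fun1 (n $ j) (x $ j)"
  have "x $ i * hermite_fun n x = (x $ i * hermite_fun1 (n $ i) (x $ i)) * ?R"
    by (subst hermite_fun_split_self[of n x i]) simp
  then show ?thesis unfolding hermite_fun1_mult hermite_fun_split by (simp add: algebra_simps)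
qed

lemma hermite_fun_deriv_axis:
  "((\<lambda>t. hermite_fun n (x + t *\<^sub>R axis i 1)) has_real_derivative hermite_d i n (x + t *\<^sub>R axis i 1)) (at t)"
proof -
  let ?R = "\<Prod>j\<in>UNIV - {i}. hermite_fun1 (n $ j) (x $ j)"
  have R: "(\<Prod>j\<in>UNIV - {i}. hermite_fun1 (n $ j) ((x + t *\<^sub>R axis i 1) $ j)) = ?R" for t
    by (intro prod.cong) (auto simp: axis_def)
  have e: "(\<lambda>t. hermite_fun n (x + t *\<^sub>R axis i 1)) = (\<lambda>t. hermite_fun1 (n $ i) (x $ i + t) * ?R)"
    by (rule ext, subst hermite_fun_split_self[of _ _ i], subst R) (simp add: axis_def)
  have "((\<lambda>t. hermite_fun1 (n $ i) (x $ i + t)) has_real_derivative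
      (ha (n $ i) * hermite_fun1 (n $ i - 1) (x $ i + t)
       - ha (Suc (n $ i)) * hermite_fun1 (Suc (n $ i)) (x $ i + t)) * 1) (at t)"
    by (rule DERIV_chain2[OF hermite_fun1_deriv]) (auto intro!: derivative_eq_intros)
  then have "((\<lambda>t. hermite_fun1 (n $ i) (x $ i + t) * ?R) has_real_derivative
      (ha (n $ i) * hermite_fun1 (n $ i - 1) (x $ i + t)
       - ha (Suc (n $ i)) * hermite_fun1 (Suc (n $ i)) (x $ i + t)) * 1 * ?R) (at t)"
    by (rule DERIV_cmult_right)
  then show ?thesis
    unfolding e by (rule DERIV_cong)
      (simp only: hermite_d_def hermite_fun_split R, simp add: axis_def algebra_simps)
qed

lemma hermite_d_deriv_axis:
  "((\<lambda>t. hermite_d i n (x + t *\<^sub>R axis i 1)) has_real_derivative hermite_dd i n (x + t *\<^sub>R axis i 1)) (at t)"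
  unfolding hermite_d_def[of i n] hermite_dd_def
  by (intro DERIV_diff DERIV_cmult hermite_fun_deriv_axis)

text \<open>Multiplication by x_i and the derivative both act through the ladder, so the oscillator
  equation in direction i comes down to ha(k)^2 + ha(k + 1)^2 = k + 1/2.\<close>

lemma hermite_dd_eq: "hermite_dd i n x = ((x $ i)\<^sup>2 - (2 * real (n $ i) + 1)) * hermite_fun n x"
proof -
  let ?k = "n $ i"
  let ?h = "\<lambda>k. hermite_fun (hset n i k) x"
  have m: "x $ i * ?h k = ha k * ?h (k - 1) + ha (Suc k) * ?h (Suc k)" for k
    using hermite_fun_mult[of x i "hset n i k"] by simp
  have d: "hermite_d i (hset n i k) x = ha k * ?h (k - 1) - ha (Suc k) * ?h (Suc k)" for k
    by (simp add: hermite_d_def)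
  have "hermite_dd i n x = ha ?k * (x $ i * ?h (?k - 1) - 2 * ha (Suc (?k - 1)) * ?h (Suc (?k - 1)))
      + ha (Suc ?k) * (x $ i * ?h (Suc ?k) - 2 * ha (Suc ?k) * ?h ?k)"
    unfolding hermite_dd_def d m by (simp add: algebra_simps)
  \<comment> \<open>For \<open>?k = 0\<close> the index \<open>Suc (?k - 1)\<close> differs from
    \<open>?k\<close>, but then the factor \<open>ha ?k\<close> is 0.\<close>
  also have "ha ?k * (x $ i * ?h (?k - 1) - 2 * ha (Suc (?k - 1)) * ?h (Suc (?k - 1)))
    = ha ?k * (x $ i * ?h (?k - 1)) - 2 * (ha ?k * ha ?k) * ?h ?k"
    by (cases ?k) (auto simp: algebra_simps)
  also have "ha ?k * (x $ i * ?h (?k - 1)) - 2 * (ha ?k * ha ?k) * ?h ?k +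
      ha (Suc ?k) * (x $ i * ?h (Suc ?k) - 2 * ha (Suc ?k) * ?h ?k)
    = x $ i * (ha ?k * ?h (?k - 1) + ha (Suc ?k) * ?h (Suc ?k))
      - 2 * (ha ?k * ha ?k + ha (Suc ?k) * ha (Suc ?k)) * ?h ?k"
    by (simp add: algebra_simps)
  also have "\<dots> = ((x $ i)\<^sup>2 - (2 * real ?k + 1)) * ?h ?k"
    unfolding m[symmetric] ha_square by (simp add: algebra_simps power2_eq_square)
  finally show ?thesis by simp
qed

lemma sum_hermite_dd:
  "(\<Sum>i\<in>UNIV. hermite_dd i n x) = ((norm x)\<^sup>2 - hermite_eigenvalue n) * hermite_fun n x"
proof -
  have "(norm x)\<^sup>2 = (\<Sum>i\<in>UNIV. (x $ i)\<^sup>2)"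
    unfolding power2_norm_eq_inner inner_vec_def by (simp add: power2_eq_square)
  then show ?thesis
    unfolding hermite_dd_eq sum_distrib_right[symmetric] hermite_eigenvalue_def
    by (simp add: sum_subtractf sum.distrib sum_distrib_left)
qed

lemma hermite_fun_cont: "continuous_on S (hermite_fun n)"
  unfolding hermite_fun_def
  by (intro continuous_intros continuous_on_compose2[OF hermite_fun1_cont[of UNIV]]) auto

lemma hermite_fun_meas [measurable]: "hermite_fun n \<in> borel_measurable borel"
  by (intro borel_measurable_continuous_onI hermite_fun_cont)

lemma hermite_d_meas [measurable]: "hermite_d i n \<in> borel_measurable borel"
  unfolding hermite_d_def[abs_def] by measurable

lemma hermite_dd_meas [measurable]: "hermite_dd i n \<in> borel_measurable borel"
  unfolding hermite_dd_def[abs_def] by measurable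

lemma partial_deriv_hermite: "partial_deriv i (hermite_fun n) x = hermite_d i n x"
  unfolding partial_deriv_def
  using hermite_fun_deriv_axis[of n x i 0] by (intro DERIV_imp_deriv) simp

text \<open>The lowering parts of x_i and of the derivative agree and cancel, so that only the
  raising of the i-th index is left.\<close>

lemma delta_star_hermite:
  "delta_star i (hermite_fun n) x = 2 * ha (Suc (n $ i)) * hermite_fun (hset n i (Suc (n $ i))) x"
  unfolding delta_star_def partial_deriv_hermite hermite_d_def hermite_fun_mult by simp

lemma norm_vec_square: "(norm x)\<^sup>2 = (\<Sum>i\<in>UNIV. (x $ i)\<^sup>2)" for x :: "real ^ 'd"
  unfolding power2_norm_eq_inner inner_vec_def by (simp add: power2_eq_square)

text \<open>Any rate below the \<open>1 / 2\<close> of the Gaussian factor absorbs the Hermite polynomial; the later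
  estimates need a rate above \<open>1 / 4\<close>.\<close>

definition gbounded :: "(real ^ 'd \<Rightarrow> real) \<Rightarrow> bool" where
  "gbounded f \<longleftrightarrow> (\<exists>C>0. \<forall>x. \<bar>f x\<bar> \<le> C * exp (- (3 / 8) * (norm x)\<^sup>2))"

lemma gboundedE:
  assumes "gbounded f"
  obtains C where "0 < C" "\<And>x. \<bar>f x\<bar> \<le> C * exp (- (3 / 8) * (norm x)\<^sup>2)"
  using assms by (auto simp: gbounded_def)

lemma gbounded_add: "gbounded f \<Longrightarrow> gbounded g \<Longrightarrow> gbounded (\<lambda>x. f x + g x)"
proof (elim gboundedE)
  fix C D assume C: "0 < C" "\<And>x. \<bar>f x\<bar> \<le> C * exp (- (3 / 8) * (norm x)\<^sup>2)"
    and D: "0 < D" "\<And>x. \<bar>g x\<bar> \<le> D * exp (- (3 / 8) * (norm x)\<^sup>2)"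
  have "\<bar>f x + g x\<bar> \<le> (C + D) * exp (- (3 / 8) * (norm x)\<^sup>2)" for x
    using abs_triangle_ineq[of "f x" "g x"] C(2)[of x] D(2)[of x] unfolding distrib_right by linarith
  then show ?thesis unfolding gbounded_def using C D by (intro exI[of _ "C + D"]) auto
qed

lemma gbounded_cmult: "gbounded f \<Longrightarrow> gbounded (\<lambda>x. c * f x)"
proof (elim gboundedE)
  fix C assume C: "0 < C" "\<And>x. \<bar>f x\<bar> \<le> C * exp (- (3 / 8) * (norm x)\<^sup>2)"
  have "\<bar>c * f x\<bar> \<le> ((\<bar>c\<bar> + 1) * C) * exp (- (3 / 8) * (norm x)\<^sup>2)" for x
    unfolding abs_mult mult.assoc using C by (intro mult_mono) auto
  then show ?thesis unfolding gbounded_def using C by (intro exI[of _ "(\<bar>c\<bar> + 1) * C"]) auto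
qed

lemma gbounded_zero: "gbounded (\<lambda>x. 0)"
  unfolding gbounded_def by (intro exI[of _ 1]) auto

lemma gbounded_sum: "finite A \<Longrightarrow> (\<And>n. n \<in> A \<Longrightarrow> gbounded (f n)) \<Longrightarrow> gbounded (\<lambda>x. \<Sum>n\<in>A. f n x)"
  by (induction A rule: finite_induct) (auto intro: gbounded_zero gbounded_add)

lemma gbounded_hermite: "gbounded (hermite_fun n :: real ^ 'd \<Rightarrow> real)"
proof -
  obtain C where C: "\<And>i. 0 < C i" "\<And>i x. \<bar>hermite_fun1 (n $ i) x\<bar> \<le> C i * exp (- (3 / 8) * x\<^sup>2)"
    using hermite_fun1_bound[of "n $ _"] by metis
  have "\<bar>hermite_fun n x\<bar> \<le> (\<Prod>i\<in>UNIV. C i) * exp (- (3 / 8) * (norm x)\<^sup>2)" for x :: "real ^ 'd"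
  proof -
    have "\<bar>hermite_fun n x\<bar> \<le> (\<Prod>i\<in>UNIV. C i * exp (- (3 / 8) * (x $ i)\<^sup>2))"
      unfolding hermite_fun_def abs_prod by (intro prod_mono conjI abs_ge_zero C)
    also have "\<dots> = (\<Prod>i\<in>UNIV. C i) * exp (- (3 / 8) * (norm x)\<^sup>2)"
      by (simp add: prod.distrib exp_sum[symmetric] norm_vec_square sum_distrib_left sum_negf)
    finally show ?thesis .
  qed
  moreover have "0 < (\<Prod>i\<in>UNIV. C i)" by (intro prod_pos) (auto intro: C)
  ultimately show ?thesis unfolding gbounded_def by blast
qed

lemma gbounded_diff: "gbounded f \<Longrightarrow> gbounded g \<Longrightarrow> gbounded (\<lambda>x. f x - g x)"
  using gbounded_add[of f "\<lambda>x. - 1 * g x"] gbounded_cmult[of g "- 1"] by simp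

lemma gbounded_hermite_d: "gbounded (hermite_d i n)"
  unfolding hermite_d_def[abs_def] by (intro gbounded_diff gbounded_cmult gbounded_hermite)

lemma gbounded_hermite_dd: "gbounded (hermite_dd i n)"
  unfolding hermite_dd_def[abs_def] by (intro gbounded_diff gbounded_cmult gbounded_hermite_d)

lemma gbounded_mult_integrable:
  assumes "gbounded f" "gbounded g" and [measurable]: "f \<in> borel_measurable borel" "g \<in> borel_measurable borel"
  shows "integrable lborel (\<lambda>x. f x * g x)"
proof -
  obtain C where C: "0 < C" "\<And>x. \<bar>f x\<bar> \<le> C * exp (- (3 / 8) * (norm x)\<^sup>2)" using gboundedE[OF assms(1)] by blast
  obtain D where D: "0 < D" "\<And>x. \<bar>g x\<bar> \<le> D * exp (- (3 / 8) * (norm x)\<^sup>2)" using gboundedE[OF assms(2)] by blast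
  have "\<bar>f x * g x\<bar> \<le> (C * D) * exp (- (3 / 4) * (norm x)\<^sup>2)" for x
  proof -
    have "\<bar>f x * g x\<bar> \<le> (C * exp (- (3 / 8) * (norm x)\<^sup>2)) * (D * exp (- (3 / 8) * (norm x)\<^sup>2))"
      unfolding abs_mult using C D by (intro mult_mono) auto
    also have "\<dots> = (C * D) * exp (- (3 / 4) * (norm x)\<^sup>2)" by (simp flip: exp_add)
    finally show ?thesis .
  qed
  then show ?thesis by (intro integrable_gaussian_bound[where c = "3 / 4"]) auto
qed

lemma gbounded_powr_integrable:
  fixes f :: "real ^ 'd \<Rightarrow> 'b::real_normed_vector"
  assumes "gbounded (\<lambda>x. norm (f x))" and [measurable]: "f \<in> borel_measurable borel" and r: "0 < r"
  shows "integrable lborel (\<lambda>x. norm (f x) powr r)"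
proof -
  obtain C where C: "0 < C" "\<And>x. \<bar>norm (f x)\<bar> \<le> C * exp (- (3 / 8) * (norm x)\<^sup>2)" using gboundedE[OF assms(1)] by blast
  have "\<bar>norm (f x) powr r\<bar> \<le> C powr r * exp (- (3 / 8 * r) * (norm x)\<^sup>2)" for x
  proof -
    have "norm (f x) powr r \<le> (C * exp (- (3 / 8) * (norm x)\<^sup>2)) powr r"
      using C r by (intro powr_mono2) auto
    also have "\<dots> = C powr r * exp (- (3 / 8 * r) * (norm x)\<^sup>2)"
      using C by (simp add: powr_mult exp_powr_real)
    finally show ?thesis by simp
  qed
  then show ?thesis using r by (intro integrable_gaussian_bound[where c = "3 / 8 * r"]) auto
qed

lemma hermite_orthonormal:
  "(LBINT x. hermite_fun m x * hermite_fun n x) = (if m = n then 1 else 0)"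
proof -
  have "(LBINT x. hermite_fun m x * hermite_fun n x)
      = (\<Prod>i\<in>UNIV. \<integral>x. hermite_fun1 (m $ i) x * hermite_fun1 (n $ i) x \<partial>lborel)"
    unfolding hermite_fun_def prod.distrib[symmetric]
    by (rule integral_prod_vec) (rule hermite_fun1_integrable)
  then show ?thesis by (auto simp: hermite_fun1_orthonormal vec_eq_iff prod_zero_iff)
qed

lemma L2_inner_lborel:
  assumes [measurable]: "f \<in> borel_measurable borel" "g \<in> borel_measurable borel"
  shows "L2_inner f g = (LBINT x. f x * g x)"
  unfolding L2_inner_def by (rule integral_completion) measurable

section \<open>Density of the span of the Hermite functions\<close>

lemma hermite_spanI: "finite N \<Longrightarrow> (\<lambda>x. \<Sum>n\<in>N. c n * hermite_fun n x) \<in> hermite_span"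
  unfolding hermite_span_def by blast

lemma hermite_spanE:
  assumes "f \<in> hermite_span"
  obtains N c where "finite N" "f = (\<lambda>x. \<Sum>n\<in>N. c n * hermite_fun n x)"
  using assms unfolding hermite_span_def by blast

lemma hermite_span_zero: "(\<lambda>x. 0) \<in> hermite_span"
  using hermite_spanI[of "{}"] by simp

lemma hermite_span_hermite: "hermite_fun n \<in> hermite_span"
  using hermite_spanI[of "{n}" "\<lambda>_. 1"] by simp

lemma sum_extend: 
  fixes g :: "'a \<Rightarrow> 'b::comm_ring_1"
  assumes "finite M" "N \<subseteq> M"
  shows "(\<Sum>n\<in>M. (if n \<in> N then c n else 0) * g n) = (\<Sum>n\<in>N. c n * g n)"
  using assms by (intro sum.mono_neutral_cong_right) auto

lemma hermite_span_add:
  assumes "f \<in> hermite_span" "g \<in> hermite_span" shows "(\<lambda>x. f x + g x) \<in> hermite_span"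
proof -
  obtain N c where N: "finite N" "f = (\<lambda>x. \<Sum>n\<in>N. c n * hermite_fun n x)"
    using assms(1) by (rule hermite_spanE)
  obtain M d where M: "finite M" "g = (\<lambda>x. \<Sum>n\<in>M. d n * hermite_fun n x)"
    using assms(2) by (rule hermite_spanE)
  have "(\<lambda>x. f x + g x) = (\<lambda>x. \<Sum>n\<in>N \<union> M. ((if n \<in> N then c n else 0) + (if n \<in> M then d n else 0)) * hermite_fun n x)"
    unfolding distrib_right sum.distrib using N(1) M(1) by (subst (1 2) sum_extend) (auto simp: N(2) M(2))
  then show ?thesis using hermite_spanI[of "N \<union> M"] N(1) M(1) by simp
qed

lemma hermite_span_cmult:
  assumes "f \<in> hermite_span" shows "(\<lambda>x. a * f x) \<in> hermite_span"
proof -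
  obtain N c where N: "finite N" "f = (\<lambda>x. \<Sum>n\<in>N. c n * hermite_fun n x)"
    using assms by (rule hermite_spanE)
  have "(\<lambda>x. a * f x) = (\<lambda>x. \<Sum>n\<in>N. (a * c n) * hermite_fun n x)"
    by (simp add: N(2) sum_distrib_left mult.assoc)
  then show ?thesis using hermite_spanI[OF N(1)] by simp
qed

lemma hermite_span_sum:
  "finite A \<Longrightarrow> (\<And>k. k \<in> A \<Longrightarrow> f k \<in> hermite_span) \<Longrightarrow> (\<lambda>x. \<Sum>k\<in>A. f k x) \<in> hermite_span"
  by (induction A rule: finite_induct) (auto intro: hermite_span_zero hermite_span_add)

lemma hermite_span_mult_coord:
  assumes "f \<in> hermite_span" shows "(\<lambda>x. x $ i * f x) \<in> hermite_span"
proof -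
  obtain N c where N: "finite N" "f = (\<lambda>x. \<Sum>n\<in>N. c n * hermite_fun n x)"
    using assms by (rule hermite_spanE)
  have "(\<lambda>x. x $ i * hermite_fun n x) \<in> hermite_span" for n
    unfolding hermite_fun_mult by (intro hermite_span_add hermite_span_cmult hermite_span_hermite)
  then have "(\<lambda>x. \<Sum>n\<in>N. c n * (x $ i * hermite_fun n x)) \<in> hermite_span"
    by (intro hermite_span_sum hermite_span_cmult N)
  then show ?thesis by (simp add: N(2) sum_distrib_left mult.left_commute)
qed

lemma hermite_span_gbounded: "f \<in> hermite_span \<Longrightarrow> gbounded f"
  by (auto elim!: hermite_spanE intro!: gbounded_sum gbounded_cmult gbounded_hermite)

lemma hermite_span_meas: "f \<in> hermite_span \<Longrightarrow> f \<in> borel_measurable borel"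
  by (auto elim!: hermite_spanE)

section \<open>Closure of the span in the distance given by p-th powers\<close>

lemma norm_add_powr_le:
  fixes a b :: "'a::real_normed_vector"
  assumes "0 \<le> p"
  shows "norm (a + b) powr p \<le> 2 powr p * (norm a powr p + norm b powr p)"
proof -
  have "norm (a + b) powr p \<le> (2 * max (norm a) (norm b)) powr p"
    using norm_triangle_ineq[of a b] assms by (intro powr_mono2) auto
  also have "\<dots> = 2 powr p * max (norm a) (norm b) powr p" by (rule powr_mult)
  also have "\<dots> \<le> 2 powr p * (norm a powr p + norm b powr p)"
    by (intro mult_left_mono) (auto simp: max_def)
  finally show ?thesis .
qed

text \<open>The distance is the integral of the p-th power, without the root. Its triangle
  inequality has a factor 2^p, which is harmless for closures, and all of this works for every p > 0
  before any norm inequality is available.\<close>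

definition hclosure :: "real \<Rightarrow> (real ^ 'd \<Rightarrow> real) set" where
  "hclosure p = {f. f \<in> borel_measurable borel \<and> integrable lborel (\<lambda>x. \<bar>f x\<bar> powr p) \<and>
     (\<forall>e>0. \<exists>g\<in>hermite_span. (LBINT x. \<bar>f x - g x\<bar> powr p) < e)}"

context
  fixes p :: real assumes p: "0 < p"
begin

lemma integrable_powr_add:
  fixes f g :: "'a \<Rightarrow> 'b::euclidean_space"
  assumes [measurable]: "f \<in> borel_measurable M" "g \<in> borel_measurable M"
    and "integrable M (\<lambda>x. norm (f x) powr p)" "integrable M (\<lambda>x. norm (g x) powr p)"
  shows "integrable M (\<lambda>x. norm (f x + g x) powr p)"
    "(\<integral>x. norm (f x + g x) powr p \<partial>M) \<le> 2 powr p * ((\<integral>x. norm (f x) powr p \<partial>M) + (\<integral>x. norm (g x) powr p \<partial>M))"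
proof -
  have b: "norm (f x + g x) powr p \<le> 2 powr p * (norm (f x) powr p + norm (g x) powr p)" for x
    using p by (intro norm_add_powr_le) simp
  have i: "integrable M (\<lambda>x. 2 powr p * (norm (f x) powr p + norm (g x) powr p))"
    using assms by auto
  show j: "integrable M (\<lambda>x. norm (f x + g x) powr p)"
    by (rule Bochner_Integration.integrable_bound[OF i]) (use b in \<open>auto intro!: order_trans[OF _ abs_ge_self]\<close>)
  have "(\<integral>x. norm (f x + g x) powr p \<partial>M) \<le> (\<integral>x. 2 powr p * (norm (f x) powr p + norm (g x) powr p) \<partial>M)"
    by (rule integral_mono[OF j i b])
  also have "\<dots> = 2 powr p * ((\<integral>x. norm (f x) powr p \<partial>M) + (\<integral>x. norm (g x) powr p \<partial>M))"
    using assms by simp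
  finally show "(\<integral>x. norm (f x + g x) powr p \<partial>M) \<le> 2 powr p * ((\<integral>x. norm (f x) powr p \<partial>M) + (\<integral>x. norm (g x) powr p \<partial>M))" .
qed

lemma hermite_span_integrable:
  assumes "g \<in> hermite_span" shows "integrable lborel (\<lambda>x. \<bar>g x\<bar> powr p)"
proof -
  have "gbounded (\<lambda>x. norm (g x))"
    using hermite_span_gbounded[OF assms] by (auto simp: gbounded_def)
  from gbounded_powr_integrable[OF this hermite_span_meas[OF assms] p] show ?thesis by simp
qed

lemma hermite_span_hclosure: "g \<in> hermite_span \<Longrightarrow> g \<in> hclosure p"
  using hermite_span_integrable hermite_span_meas by (auto simp: hclosure_def intro!: bexI[of _ g])

lemma hclosure_meas: "f \<in> hclosure p \<Longrightarrow> f \<in> borel_measurable borel"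
  and hclosure_integrable: "f \<in> hclosure p \<Longrightarrow> integrable lborel (\<lambda>x. \<bar>f x\<bar> powr p)"
  by (auto simp: hclosure_def)

lemma hclosure_approx:
  assumes [measurable]: "f \<in> borel_measurable borel" and f: "integrable lborel (\<lambda>x. \<bar>f x\<bar> powr p)"
    and approx: "\<And>e. 0 < e \<Longrightarrow> \<exists>g\<in>hclosure p. (LBINT x. \<bar>f x - g x\<bar> powr p) < e"
  shows "f \<in> hclosure p"
  unfolding hclosure_def
proof (intro CollectI conjI allI impI f)
  fix e :: real assume e: "0 < e"
  \<comment> \<open>Two errors below d, each enlarged by the factor 2^p, add up to less than
    e.\<close>
  define d where "d = e / (2 * 2 powr p)"
  have d: "0 < d" using e by (simp add: d_def)
  obtain g where g: "g \<in> hclosure p" "(LBINT x. \<bar>f x - g x\<bar> powr p) < d" using approx[OF d] by blast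
  then obtain h where h: "h \<in> hermite_span" "(LBINT x. \<bar>g x - h x\<bar> powr p) < d"
    using d by (auto simp: hclosure_def)
  note [measurable] = hclosure_meas[OF g(1)] hermite_span_meas[OF h(1)]
  have "integrable lborel (\<lambda>x. norm (f x + (- g x)) powr p)"
    by (rule integrable_powr_add) (use f hclosure_integrable[OF g(1)] in auto)
  moreover have "integrable lborel (\<lambda>x. norm (g x + (- h x)) powr p)"
    by (rule integrable_powr_add) (use hclosure_integrable[OF g(1)] hermite_span_integrable[OF h(1)] in auto)
  ultimately have "(LBINT x. norm ((f x - g x) + (g x - h x)) powr p)
      \<le> 2 powr p * ((LBINT x. norm (f x - g x) powr p) + (LBINT x. norm (g x - h x) powr p))"
    by (intro integrable_powr_add) auto
  also have "\<dots> < 2 powr p * (d + d)" using g h by (intro mult_strict_left_mono add_strict_mono) auto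
  also have "\<dots> = e" by (simp add: d_def)
  finally show "\<exists>g\<in>hermite_span. (LBINT x. \<bar>f x - g x\<bar> powr p) < e" using h(1) by (auto intro!: bexI[of _ h])
qed simp

lemma hclosure_dominated:
  fixes f :: "real ^ 'd \<Rightarrow> real"
  assumes F: "\<And>k::nat. F k \<in> hclosure p" and [measurable]: "f \<in> borel_measurable borel"
    and w: "integrable lborel (\<lambda>x. w x powr p)" "\<And>k x. \<bar>F k x\<bar> \<le> w x"
    and lim: "\<And>x. (\<lambda>k. F k x) \<longlonglongrightarrow> f x"
  shows "f \<in> hclosure p"
proof (rule hclosure_approx)
  have fw: "\<bar>f x\<bar> \<le> w x" for x
    by (rule LIMSEQ_le_const2[OF tendsto_rabs[OF lim]]) (use w in auto)
  have w0: "0 \<le> w x" for x using order_trans[OF abs_ge_zero fw] .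
  note [measurable] = hclosure_meas[OF F]
  show "integrable lborel (\<lambda>x. \<bar>f x\<bar> powr p)"
    by (rule Bochner_Integration.integrable_bound[OF w(1)]) (use fw p in \<open>auto intro!: powr_mono2\<close>)
  have "(\<lambda>k. \<integral>x. \<bar>f x - F k x\<bar> powr p \<partial>lborel) \<longlonglongrightarrow> (\<integral>x. 0 \<partial>(lborel :: (real^'d) measure))"
  proof (rule integral_dominated_convergence[where w = "\<lambda>x. 2 powr p * w x powr p"])
    show "AE x in lborel. (\<lambda>k. \<bar>f x - F k x\<bar> powr p) \<longlonglongrightarrow> 0"
    proof (rule AE_I2)
      fix x
      have "(\<lambda>k. \<bar>f x - F k x\<bar>) \<longlonglongrightarrow> \<bar>f x - f x\<bar>" by (intro tendsto_intros lim)
      then have "(\<lambda>k. \<bar>f x - F k x\<bar>) \<longlonglongrightarrow> 0" by simp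
      then show "(\<lambda>k. \<bar>f x - F k x\<bar> powr p) \<longlonglongrightarrow> 0"
        using tendsto_zero_powrI[of "\<lambda>k. \<bar>f x - F k x\<bar>" sequentially "\<lambda>_. p" p] p by auto
    qed
    show "AE x in lborel. norm (\<bar>f x - F k x\<bar> powr p) \<le> 2 powr p * w x powr p" for k
    proof (rule AE_I2)
      fix x
      have "\<bar>f x - F k x\<bar> \<le> 2 * w x" using fw[of x] w(2)[of k x] by linarith
      then have "\<bar>f x - F k x\<bar> powr p \<le> (2 * w x) powr p" using p by (intro powr_mono2) auto
      also have "\<dots> = 2 powr p * w x powr p" by (rule powr_mult)
      finally show "norm (\<bar>f x - F k x\<bar> powr p) \<le> 2 powr p * w x powr p" by simp
    qed
  qed (use w in auto)
  then have l: "(\<lambda>k. \<integral>x. \<bar>f x - F k x\<bar> powr p \<partial>lborel) \<longlonglongrightarrow> 0" by simp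
  show "\<exists>g\<in>hclosure p. (LBINT x. \<bar>f x - g x\<bar> powr p) < e" if "0 < e" for e
    using order_tendstoD(2)[OF l that] F by (auto dest!: eventually_happens)
qed simp

lemma hclosure_add:
  assumes f: "f \<in> hclosure p" and g: "g \<in> hclosure p" shows "(\<lambda>x. f x + g x) \<in> hclosure p"
proof (rule hclosure_approx)
  note [measurable] = hclosure_meas[OF f] hclosure_meas[OF g]
  show "integrable lborel (\<lambda>x. \<bar>f x + g x\<bar> powr p)"
    using integrable_powr_add[of f lborel g] f g by (auto simp: hclosure_def)
  fix e :: real assume e: "0 < e"
  define d where "d = e / (2 * 2 powr p)"
  have d: "0 < d" using e by (simp add: d_def)
  obtain f' g' where f': "f' \<in> hermite_span" "(LBINT x. \<bar>f x - f' x\<bar> powr p) < d"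
    and g': "g' \<in> hermite_span" "(LBINT x. \<bar>g x - g' x\<bar> powr p) < d"
    using f g d unfolding hclosure_def by blast
  note [measurable] = hermite_span_meas[OF f'(1)] hermite_span_meas[OF g'(1)]
  have "integrable lborel (\<lambda>x. norm (f x + (- f' x)) powr p)"
    by (rule integrable_powr_add) (use hclosure_integrable[OF f] hermite_span_integrable[OF f'(1)] in auto)
  moreover have "integrable lborel (\<lambda>x. norm (g x + (- g' x)) powr p)"
    by (rule integrable_powr_add) (use hclosure_integrable[OF g] hermite_span_integrable[OF g'(1)] in auto)
  ultimately have "(LBINT x. norm ((f x - f' x) + (g x - g' x)) powr p)
      \<le> 2 powr p * ((LBINT x. norm (f x - f' x) powr p) + (LBINT x. norm (g x - g' x) powr p))"
    by (intro integrable_powr_add) auto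
  also have "\<dots> < 2 powr p * (d + d)" using f' g' by (intro mult_strict_left_mono add_strict_mono) auto
  also have "\<dots> = e" by (simp add: d_def)
  finally show "\<exists>h\<in>hclosure p. (LBINT x. \<bar>f x + g x - h x\<bar> powr p) < e"
    by (intro bexI[of _ "\<lambda>x. f' x + g' x"] hermite_span_hclosure hermite_span_add f'(1) g'(1))
       (simp add: algebra_simps)
qed (use hclosure_meas f g in measurable)

text \<open>Multiplication by a bounded function is continuous in this distance, so its effect on
  the closure is decided on the span.\<close>

lemma hclosure_mult_bounded:
  assumes f: "f \<in> hclosure p" and [measurable]: "w \<in> borel_measurable borel" and K: "\<And>x. \<bar>w x\<bar> \<le> K"
    and w: "\<And>g. g \<in> hermite_span \<Longrightarrow> (\<lambda>x. w x * g x) \<in> hclosure p"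
  shows "(\<lambda>x. w x * f x) \<in> hclosure p"
proof (rule hclosure_approx)
  have K0: "0 \<le> K" using order_trans[OF abs_ge_zero K[of 0]] .
  have b: "\<bar>w x * u\<bar> powr p \<le> K powr p * \<bar>u\<bar> powr p" for x u
    unfolding abs_mult powr_mult using K p by (intro mult_right_mono powr_mono2) auto
  note [measurable] = hclosure_meas[OF f]
  show m: "(\<lambda>x. w x * f x) \<in> borel_measurable borel" by measurable
  have bi: "integrable lborel (\<lambda>x. \<bar>w x * u x\<bar> powr p) \<and>
     (LBINT x. \<bar>w x * u x\<bar> powr p) \<le> K powr p * (LBINT x. \<bar>u x\<bar> powr p)"
    if u: "integrable lborel (\<lambda>x. \<bar>u x\<bar> powr p)" and [measurable]: "u \<in> borel_measurable borel" for u
  proof -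
    have i: "integrable lborel (\<lambda>x. K powr p * \<bar>u x\<bar> powr p)" using u by simp
    have j: "integrable lborel (\<lambda>x. \<bar>w x * u x\<bar> powr p)"
      by (rule Bochner_Integration.integrable_bound[OF i]) (use b in \<open>auto intro!: order_trans[OF _ abs_ge_self]\<close>)
    then show ?thesis using integral_mono[OF j i b] by simp
  qed
  then show "integrable lborel (\<lambda>x. \<bar>w x * f x\<bar> powr p)" using hclosure_integrable[OF f] by simp
  fix e :: real assume e: "0 < e"
  \<comment> \<open>The summand 1 keeps the denominator positive when K = 0 and makes the final
    comparison with e strict.\<close>
  define d where "d = e / (K powr p + 1)"
  have d: "0 < d" using e by (simp add: d_def add_nonneg_pos)
  obtain g where g: "g \<in> hermite_span" "(LBINT x. \<bar>f x - g x\<bar> powr p) < d"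
    using f d unfolding hclosure_def by blast
  note [measurable] = hermite_span_meas[OF g(1)]
  have "integrable lborel (\<lambda>x. norm (f x + (- g x)) powr p)"
    by (rule integrable_powr_add) (use hclosure_integrable[OF f] hermite_span_integrable[OF g(1)] in auto)
  then have "(LBINT x. \<bar>w x * (f x - g x)\<bar> powr p) \<le> K powr p * (LBINT x. \<bar>f x - g x\<bar> powr p)"
    using bi[of "\<lambda>x. f x - g x"] by simp
  also have "\<dots> \<le> K powr p * d" using g by (intro mult_left_mono) auto
  also have "\<dots> < (K powr p + 1) * d" using d by (simp add: distrib_right)
  also have "\<dots> = e"
  proof -
    have "K powr p + 1 \<noteq> 0" using powr_ge_zero[of K p] by linarith
    then show ?thesis by (simp add: d_def)
  qed
  finally show "\<exists>g\<in>hclosure p. (LBINT x. \<bar>w x * f x - g x\<bar> powr p) < e"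
    by (intro bexI[of _ "\<lambda>x. w x * g x"] w g) (simp add: algebra_simps)
qed

lemma hclosure_cmult:
  assumes "f \<in> hclosure p" shows "(\<lambda>x. a * f x) \<in> hclosure p"
  by (rule hclosure_mult_bounded[OF assms, of _ "\<bar>a\<bar>"]) (auto intro!: hermite_span_hclosure hermite_span_cmult)

lemma hclosure_sum:
  "finite A \<Longrightarrow> (\<And>k. k \<in> A \<Longrightarrow> f k \<in> hclosure p) \<Longrightarrow> (\<lambda>x. \<Sum>k\<in>A. f k x) \<in> hclosure p"
  by (induction A rule: finite_induct) (auto intro: hermite_span_hclosure[OF hermite_span_zero] hclosure_add)

text \<open>Multipliers are closed under products and bounded pointwise limits, so a monotone class
  argument will reach the indicators of all Borel sets.\<close>

definition multipliers :: "(real ^ 'd \<Rightarrow> real) set" where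
  "multipliers = {w. w \<in> borel_measurable borel \<and> (\<exists>K. \<forall>x. \<bar>w x\<bar> \<le> K) \<and>
     (\<forall>g\<in>hermite_span. (\<lambda>x. w x * g x) \<in> hclosure p)}"

lemma multipliers_const: "(\<lambda>x. c) \<in> multipliers"
  by (auto simp: multipliers_def intro!: hermite_span_hclosure hermite_span_cmult)

lemma multipliers_add:
  assumes "v \<in> multipliers" "w \<in> multipliers" shows "(\<lambda>x. v x + w x) \<in> multipliers"
proof -
  obtain K L where K: "\<And>x. \<bar>v x\<bar> \<le> K" and L: "\<And>x. \<bar>w x\<bar> \<le> L"
    using assms by (auto simp: multipliers_def)
  have "\<bar>v x + w x\<bar> \<le> K + L" for x
    by (rule order_trans[OF abs_triangle_ineq add_mono[OF K L]])
  with assms show ?thesis by (auto simp: multipliers_def distrib_right intro!: hclosure_add)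
qed

lemma multipliers_mult:
  assumes v: "v \<in> multipliers" and w: "w \<in> multipliers" shows "(\<lambda>x. v x * w x) \<in> multipliers"
proof -
  obtain K L where K: "\<And>x. \<bar>v x\<bar> \<le> K" and L: "\<And>x. \<bar>w x\<bar> \<le> L" using assms by (auto simp: multipliers_def)
  have "\<bar>v x * w x\<bar> \<le> K * L" for x
    unfolding abs_mult using K L order_trans[OF abs_ge_zero K] by (intro mult_mono) auto
  moreover have "(\<lambda>x. v x * (w x * g x)) \<in> hclosure p" if "g \<in> hermite_span" for g
    by (rule hclosure_mult_bounded[OF _ _ K]) (use v w that in \<open>auto simp: multipliers_def\<close>)
  ultimately show ?thesis using v w by (auto simp: multipliers_def mult.assoc)
qed

lemma multipliers_cmult: "w \<in> multipliers \<Longrightarrow> (\<lambda>x. c * w x) \<in> multipliers"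
  by (rule multipliers_mult[OF multipliers_const])

lemma multipliers_power: "w \<in> multipliers \<Longrightarrow> (\<lambda>x. w x ^ k) \<in> multipliers"
  by (induction k) (auto intro: multipliers_const multipliers_mult)

lemma multipliers_sum:
  "finite A \<Longrightarrow> (\<And>k. k \<in> A \<Longrightarrow> f k \<in> multipliers) \<Longrightarrow> (\<lambda>x. \<Sum>k\<in>A. f k x) \<in> multipliers"
  by (induction A rule: finite_induct) (auto intro: multipliers_const multipliers_add)

lemma multipliers_prod:
  "finite A \<Longrightarrow> (\<And>k. k \<in> A \<Longrightarrow> f k \<in> multipliers) \<Longrightarrow> (\<lambda>x. \<Prod>k\<in>A. f k x) \<in> multipliers"
  by (induction A rule: finite_induct) (auto intro: multipliers_const multipliers_mult)

lemma multipliers_limit: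
  assumes F: "\<And>k::nat. F k \<in> multipliers" and K: "\<And>k x. \<bar>F k x\<bar> \<le> K"
    and lim: "\<And>x. (\<lambda>k. F k x) \<longlonglongrightarrow> f x"
  shows "f \<in> multipliers"
proof -
  have m [measurable]: "f \<in> borel_measurable borel"
    by (rule borel_measurable_LIMSEQ_real[OF lim]) (use F in \<open>auto simp: multipliers_def\<close>)
  have "\<bar>f x\<bar> \<le> K" for x by (rule LIMSEQ_le_const2[OF tendsto_rabs[OF lim]]) (use K in auto)
  moreover have "(\<lambda>x. f x * g x) \<in> hclosure p" if g: "g \<in> hermite_span" for g
  proof (rule hclosure_dominated)
    note [measurable] = hermite_span_meas[OF g]
    show "(\<lambda>x. F k x * g x) \<in> hclosure p" for k using F g by (auto simp: multipliers_def)
    show "(\<lambda>x. f x * g x) \<in> borel_measurable borel" by measurable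
    show "(\<lambda>k. F k x * g x) \<longlonglongrightarrow> f x * g x" for x by (intro tendsto_intros lim)
    show "\<bar>F k x * g x\<bar> \<le> \<bar>K * g x\<bar>" for k x
      unfolding abs_mult using order_trans[OF K abs_ge_self] by (intro mult_right_mono) auto
    show "integrable lborel (\<lambda>x. \<bar>K * g x\<bar> powr p)"
      by (intro hermite_span_integrable hermite_span_cmult g)
  qed
  ultimately show ?thesis by (auto simp: multipliers_def m)
qed

lemma abs_power_series_le_exp:
  fixes c :: "nat \<Rightarrow> real"
  assumes "\<And>n. \<bar>c n\<bar> \<le> inverse (fact n)"
  shows "\<bar>\<Sum>n<k. c n * y ^ n\<bar> \<le> exp \<bar>y\<bar>"
proof -
  have "\<bar>\<Sum>n<k. c n * y ^ n\<bar> \<le> (\<Sum>n<k. \<bar>y\<bar> ^ n /\<^sub>R fact n)"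
    using assms by (intro order_trans[OF sum_abs] sum_mono) (auto simp: abs_mult power_abs intro!: mult_right_mono)
  also have "\<dots> \<le> (\<Sum>n. \<bar>y\<bar> ^ n /\<^sub>R fact n)"
    by (intro sum_le_suminf summable_exp_generic) auto
  also have "\<dots> = exp \<bar>y\<bar>" using exp_converges[of "\<bar>y\<bar>"] by (rule sums_unique[symmetric])
  finally show ?thesis .
qed

text \<open>A multiplier is bounded, so the partial sums of the exponential series stay uniformly
  below exp K and bounded pointwise limits apply.\<close>

lemma multipliers_exp:
  assumes w: "w \<in> multipliers" shows "(\<lambda>x. exp (w x)) \<in> multipliers"
proof -
  obtain K where K: "\<And>x. \<bar>w x\<bar> \<le> K" using w by (auto simp: multipliers_def)
  show ?thesis
  proof (rule multipliers_limit[where F = "\<lambda>k x. \<Sum>n<k. inverse (fact n) * w x ^ n" and K = "exp K"])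
    show "(\<lambda>x. \<Sum>n<k. inverse (fact n) * w x ^ n) \<in> multipliers" for k
      by (rule multipliers_sum, simp, rule multipliers_cmult, rule multipliers_power, rule w)
    show "\<bar>\<Sum>n<k. inverse (fact n) * w x ^ n\<bar> \<le> exp K" for k x
      by (rule order_trans[OF abs_power_series_le_exp]) (simp_all add: K)
    show "(\<lambda>k. \<Sum>n<k. inverse (fact n) * w x ^ n) \<longlonglongrightarrow> exp (w x)" for x
      using exp_converges[of "w x"] by (simp add: sums_def)
  qed
qed

text \<open>A coordinate is unbounded and hence no multiplier, but polynomials in it map the span to
  itself. The partial sums are dominated by exp |s x_i|, which costs a rate 1/8 and leaves 3/8 - 1/8
  = 1/4 of the Gaussian, so dominated convergence reaches the whole series.\<close>

lemma multipliers_power_series: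
  assumes c: "\<And>n. \<bar>c n\<bar> \<le> inverse (fact n)" and f: "\<And>y. (\<lambda>n. c n * y ^ n) sums f y"
    and K: "\<And>y. \<bar>f y\<bar> \<le> K"
    and [measurable]: "f \<in> borel_measurable borel"
  shows "(\<lambda>x :: real ^ 'd. f (s * x $ i)) \<in> multipliers"
proof -
  have "(\<lambda>x :: real ^ 'd. f (s * x $ i) * g x) \<in> hclosure p" if g: "g \<in> hermite_span" for g
  proof -
    note [measurable] = hermite_span_meas[OF g]
    obtain C where C: "0 < C" "\<And>x. \<bar>g x\<bar> \<le> C * exp (- (3 / 8) * (norm x)\<^sup>2)"
      using gboundedE[OF hermite_span_gbounded[OF g]] by blast
    define w where "w x = (C * exp (2 * s\<^sup>2)) * exp (- (1 / 4) * (norm x)\<^sup>2)" for x :: "real ^ 'd"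
    show ?thesis
    proof (rule hclosure_dominated)
    show "(\<lambda>x. f (s * x $ i) * g x) \<in> borel_measurable borel" by measurable
    show "(\<lambda>x. (\<Sum>n<k. c n * (s * x $ i) ^ n) * g x) \<in> hclosure p" for k
    proof -
      have "(\<lambda>x. (s * x $ i) ^ n * g x) \<in> hermite_span" for n
      proof (induction n)
        case (Suc n)
        have "(\<lambda>x. s * (x $ i * ((s * x $ i) ^ n * g x))) \<in> hermite_span"
          by (intro hermite_span_cmult hermite_span_mult_coord Suc)
        then show ?case by (simp add: ac_simps)
      qed (simp add: g)
      then have "(\<lambda>x. \<Sum>n<k. c n * ((s * x $ i) ^ n * g x)) \<in> hermite_span"
        by (intro hermite_span_sum hermite_span_cmult) auto
      then show ?thesis by (intro hermite_span_hclosure) (simp add: sum_distrib_right mult.assoc)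
    qed
    show "\<bar>(\<Sum>n<k. c n * (s * x $ i) ^ n) * g x\<bar> \<le> w x" for k x
    proof -
      have "\<bar>(\<Sum>n<k. c n * (s * x $ i) ^ n) * g x\<bar> \<le> exp \<bar>s * x $ i\<bar> * (C * exp (- (3 / 8) * (norm x)\<^sup>2))"
        unfolding abs_mult[of "sum _ _"] by (intro mult_mono abs_power_series_le_exp c C) auto
      also have "\<bar>s * x $ i\<bar> \<le> 2 * s\<^sup>2 + (norm x)\<^sup>2 / 8"
      proof -
        have "\<bar>s * x $ i\<bar> \<le> \<bar>s\<bar> * norm x"
          unfolding abs_mult by (intro mult_left_mono component_le_norm_cart) auto
        also have "\<dots> \<le> 2 * s\<^sup>2 + (norm x)\<^sup>2 / 8"
          using zero_le_power2[of "norm x - 4 * \<bar>s\<bar>"] by (simp add: power2_eq_square algebra_simps)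
        finally show ?thesis .
      qed
      then have "exp \<bar>s * x $ i\<bar> * (C * exp (- (3 / 8) * (norm x)\<^sup>2))
         \<le> exp (2 * s\<^sup>2 + (norm x)\<^sup>2 / 8) * (C * exp (- (3 / 8) * (norm x)\<^sup>2))"
        using C by (intro mult_right_mono) auto
      also have "\<dots> = w x" unfolding w_def by (simp add: mult.left_commute flip: exp_add)
      finally show ?thesis .
    qed
    show "(\<lambda>k. (\<Sum>n<k. c n * (s * x $ i) ^ n) * g x) \<longlonglongrightarrow> f (s * x $ i) * g x" for x
      using f[of "s * x $ i"] by (intro tendsto_intros) (simp add: sums_def)
    have "w x powr p = (C * exp (2 * s\<^sup>2)) powr p * exp (- (1 / 4 * p) * (norm x)\<^sup>2)" for x
      unfolding w_def powr_mult[of "C * exp (2 * s\<^sup>2)"] by (simp add: exp_powr_real)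
    then show "integrable lborel (\<lambda>x. w x powr p)"
      using integrable_gaussian[of "1 / 4 * p", where 'a = "real ^ 'd"] p by simp
    qed
  qed
  then show ?thesis using K by (auto simp: multipliers_def)
qed

lemma multipliers_sin: "(\<lambda>x :: real ^ 'd. sin (s * (x $ i - a))) \<in> multipliers"
proof -
  have "(\<lambda>x :: real ^ 'd. sin (s * x $ i)) \<in> multipliers"
  proof (rule multipliers_power_series[where c = sin_coeff and K = 1])
    show "(\<lambda>n. sin_coeff n * y ^ n) sums sin y" for y :: real using sin_converges[of y] by simp
    show "\<bar>sin_coeff n\<bar> \<le> inverse (fact n)" for n
      by (simp add: sin_coeff_def abs_mult power_abs inverse_eq_divide)
  qed auto
  moreover have "(\<lambda>x :: real ^ 'd. cos (s * x $ i)) \<in> multipliers"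
  proof (rule multipliers_power_series[where c = cos_coeff and K = 1])
    show "(\<lambda>n. cos_coeff n * y ^ n) sums cos y" for y :: real using cos_converges[of y] by simp
    show "\<bar>cos_coeff n\<bar> \<le> inverse (fact n)" for n
      by (simp add: cos_coeff_def abs_mult power_abs inverse_eq_divide)
  qed auto
  ultimately have "(\<lambda>x. cos (s * a) * sin (s * x $ i) + (- sin (s * a)) * cos (s * x $ i)) \<in> multipliers"
    by (intro multipliers_add multipliers_cmult)
  then show ?thesis by (simp add: right_diff_distrib sin_diff mult.commute)
qed

text \<open>The limit of \<open>exp (- exp (k u))\<close>: an indicator of \<open>u < 0\<close> that is reached by analytic functions of \<open>u\<close>.\<close>

definition negpart :: "real \<Rightarrow> real" where
  "negpart u = (if u < 0 then 1 else if u = 0 then exp (- 1) else 0)"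

lemma multipliers_negpart:
  assumes "w \<in> multipliers" shows "(\<lambda>x. negpart (w x)) \<in> multipliers"
proof (rule multipliers_limit[where F = "\<lambda>k x. exp (- 1 * exp (real k * w x))" and K = 1])
  show "(\<lambda>x. exp (- 1 * exp (real k * w x))) \<in> multipliers" for k
    by (intro multipliers_exp multipliers_cmult assms)
  show "(\<lambda>k. exp (- 1 * exp (real k * w x))) \<longlonglongrightarrow> negpart (w x)" for x
  proof -
    consider "w x < 0" | "w x = 0" | "0 < w x" by linarith
    then show ?thesis
    proof cases
      case 1
      then have "(\<lambda>k. exp (- 1 * exp (real k * w x))) \<longlonglongrightarrow> 1" by real_asymp
      then show ?thesis using 1 by (simp add: negpart_def)
    next
      case 2 then show ?thesis by (simp add: negpart_def)
    next
      case 3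
      then have "(\<lambda>k. exp (- 1 * exp (real k * w x))) \<longlonglongrightarrow> 0" by real_asymp
      then show ?thesis using 3 by (simp add: negpart_def)
    qed
  qed
qed simp

lemma negpart_bound: "\<bar>negpart u\<bar> \<le> 1"
  by (simp add: negpart_def)

text \<open>The sine of (x_i - a) / (k + 1) is a bounded substitute for x_i - a: as soon as its
  argument lies within (-pi, pi) the two have the same sign.\<close>

lemma multipliers_halfspace: "(\<lambda>x :: real ^ 'd. negpart (x $ i - a)) \<in> multipliers"
proof (rule multipliers_limit[where F = "\<lambda>k x. negpart (sin (1 / real (Suc k) * (x $ i - a)))" and K = 1])
  show "(\<lambda>x. negpart (sin (1 / real (Suc k) * (x $ i - a)))) \<in> multipliers" for k
    by (intro multipliers_negpart multipliers_sin)
  show "(\<lambda>k. negpart (sin (1 / real (Suc k) * (x $ i - a)))) \<longlonglongrightarrow> negpart (x $ i - a)" for x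
  proof (rule tendsto_eventually)
    define u where "u = x $ i - a"
    have "(\<lambda>k. \<bar>1 / real (Suc k) * u\<bar>) \<longlonglongrightarrow> \<bar>0 * u\<bar>"
      by (intro tendsto_intros) (use LIMSEQ_inverse_real_of_nat in \<open>simp add: inverse_eq_divide\<close>)
    then have "eventually (\<lambda>k. \<bar>1 / real (Suc k) * u\<bar> < pi) sequentially"
      using pi_gt_zero by (intro order_tendstoD) auto
    then show "eventually (\<lambda>k. negpart (sin (1 / real (Suc k) * (x $ i - a))) = negpart (x $ i - a)) sequentially"
    proof eventually_elim
      case (elim k)
      define v where "v = 1 / real (Suc k) * u"
      have "(u < 0) = (v < 0)" "(u = 0) = (v = 0)"
        by (auto simp: v_def mult_less_0_iff divide_less_0_iff)
      moreover have "(sin v < 0) = (v < 0)" "(sin v = 0) = (v = 0)"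
        using elim sin_gt_zero[of v] sin_gt_zero[of "- v"] unfolding v_def[symmetric]
        by (cases v "0::real" rule: linorder_cases; simp)+
      ultimately show ?case unfolding u_def[symmetric] v_def[symmetric] by (simp add: negpart_def)
    qed
  qed
qed (rule negpart_bound)

text \<open>The thresholds approach a_i strictly from above. Then x_i \<le> a_i gives a negative
  argument for every k and x_i > a_i eventually a positive one, so the stray value of
  \<open>negpart\<close> at 0 does not reach the limit.\<close>

lemma multipliers_atMost: "(\<lambda>x. indicat_real {..a} x) \<in> multipliers" for a :: "real ^ 'd"
proof (rule multipliers_limit[where F = "\<lambda>k x. \<Prod>i\<in>UNIV. negpart (x $ i - (a $ i + 1 / real (Suc k)))" and K = 1])
  show "(\<lambda>x. \<Prod>i\<in>UNIV. negpart (x $ i - (a $ i + 1 / real (Suc k)))) \<in> multipliers" for k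
    by (intro multipliers_prod multipliers_halfspace) auto
  show "\<bar>\<Prod>i\<in>UNIV. negpart (x $ i - (a $ i + 1 / real (Suc k)))\<bar> \<le> 1" for k x
    unfolding abs_prod by (intro prod_le_1) (auto simp: negpart_bound)
  show "(\<lambda>k. \<Prod>i\<in>UNIV. negpart (x $ i - (a $ i + 1 / real (Suc k)))) \<longlonglongrightarrow> indicat_real {..a} x" for x
  proof -
    have "(\<lambda>k. negpart (x $ i - (a $ i + 1 / real (Suc k)))) \<longlonglongrightarrow> (if x $ i \<le> a $ i then 1 else 0)" for i
    proof (cases "x $ i \<le> a $ i")
      case True
      have "negpart (x $ i - (a $ i + 1 / real (Suc k))) = 1" for k
      proof -
        have "0 < 1 / real (Suc k)" by simp
        with True have "x $ i - (a $ i + 1 / real (Suc k)) < 0" by linarith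
        then show ?thesis unfolding negpart_def by (simp only: if_True)
      qed
      then show ?thesis using True by simp
    next
      case False
      have "(\<lambda>k. 1 / real (Suc k)) \<longlonglongrightarrow> 0"
        using LIMSEQ_inverse_real_of_nat by (simp add: inverse_eq_divide)
      then have "eventually (\<lambda>k. 1 / real (Suc k) < x $ i - a $ i) sequentially"
        by (rule order_tendstoD(2)) (use False in simp)
      then have "eventually (\<lambda>k. negpart (x $ i - (a $ i + 1 / real (Suc k))) = 0) sequentially"
      proof eventually_elim
        case (elim k)
        then have "\<not> x $ i - (a $ i + 1 / real (Suc k)) < 0" "x $ i - (a $ i + 1 / real (Suc k)) \<noteq> 0" by linarith+
        then show ?case unfolding negpart_def by (simp only: if_False)
      qed
      then show ?thesis using False by (simp add: tendsto_eventually)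
    qed
    then have "(\<lambda>k. \<Prod>i\<in>UNIV. negpart (x $ i - (a $ i + 1 / real (Suc k)))) \<longlonglongrightarrow> (\<Prod>i\<in>UNIV. if x $ i \<le> a $ i then 1 else 0)"
      by (intro tendsto_prod)
    also have "(\<Prod>i\<in>UNIV. if x $ i \<le> a $ i then 1 else 0) = indicat_real {..a} x"
      by (auto simp: indicator_def less_eq_vec_def prod_zero_iff)
    finally show ?thesis .
  qed
qed

lemma multipliers_indicator:
  assumes A: "A \<in> sets (borel :: (real ^ 'd) measure)" shows "(\<lambda>x. indicat_real A x) \<in> multipliers"
proof -
  have borel: "sets (borel :: (real ^ 'd) measure) = sigma_sets UNIV (range (\<lambda>a. {..a}))"
    by (simp add: borel_eq_atMost)
  show ?thesis
  proof (rule sigma_sets_induct_disjoint[OF _ _ A[unfolded borel], where P = "\<lambda>A. (\<lambda>x. indicat_real A x) \<in> multipliers"])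
    show "Int_stable (range (\<lambda>a :: real ^ 'd. {..a}))"
    proof (rule Int_stableI)
      fix A B assume "A \<in> range (\<lambda>a :: real ^ 'd. {..a})" "B \<in> range (\<lambda>a :: real ^ 'd. {..a})"
      then obtain a b :: "real ^ 'd" where "A \<inter> B = {..a} \<inter> {..b}" by blast
      also have "{..a} \<inter> {..b} = {..inf a b}" by auto
      finally show "A \<inter> B \<in> range (\<lambda>a. {..a})" by blast
    qed
    show "range (\<lambda>a :: real ^ 'd. {..a}) \<subseteq> Pow UNIV" by simp
    show "(\<lambda>x. indicat_real A x) \<in> multipliers" if "A \<in> range (\<lambda>a. {..a})" for A :: "(real ^ 'd) set"
      using that multipliers_atMost by auto
    show "(\<lambda>x. indicat_real {} x) \<in> multipliers" using multipliers_const[of 0] by simp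
  next
    fix A :: "(real ^ 'd) set"
    assume "(\<lambda>x. indicat_real A x) \<in> multipliers"
    then have "(\<lambda>x. 1 + (- 1) * indicat_real A x) \<in> multipliers"
      by (intro multipliers_add multipliers_cmult multipliers_const)
    also have "(\<lambda>x. 1 + (- 1) * indicat_real A x) = (\<lambda>x. indicat_real (UNIV - A) x)"
      by (auto simp: indicator_def)
    finally show "(\<lambda>x. indicat_real (UNIV - A) x) \<in> multipliers" .
  next
    fix A :: "nat \<Rightarrow> (real ^ 'd) set"
    assume A: "disjoint_family A" "\<And>i. (\<lambda>x. indicat_real (A i) x) \<in> multipliers"
    have s: "(\<Sum>i<k. indicat_real (A i) x) = indicat_real (\<Union>i<k. A i) x" for k x
      using A(1) by (intro indicator_UN_disjoint[symmetric]) (auto intro: disjoint_family_on_mono)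
    show "(\<lambda>x. indicat_real (\<Union>i. A i) x) \<in> multipliers"
    proof (rule multipliers_limit[where F = "\<lambda>k x. \<Sum>i<k. indicat_real (A i) x" and K = 1])
      show "(\<lambda>x. \<Sum>i<k. indicat_real (A i) x) \<in> multipliers" for k
        by (rule multipliers_sum) (auto intro: A)
      show "\<bar>\<Sum>i<k. indicat_real (A i) x\<bar> \<le> 1" for k x unfolding s by (simp add: indicator_def)
      show "(\<lambda>k. \<Sum>i<k. indicat_real (A i) x) \<longlonglongrightarrow> indicat_real (\<Union>i. A i) x" for x
        unfolding s by (rule LIMSEQ_indicator_UN)
    qed
  qed
qed

lemma hermite_fun_0_pos: "0 < hermite_fun 0 x"
  unfolding hermite_fun_def by (intro prod_pos) (simp add: hermite_fun1_eq hnorm_pos)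

text \<open>The ground state is positive everywhere, so f is the ground state times a Borel
  quotient. Simple functions approximating the quotient, times the ground state, are combinations of
  indicator multipliers applied to the span, and they are dominated by 2 |f|.\<close>

lemma hclosure_UNIV:
  fixes f :: "real ^ 'd \<Rightarrow> real"
  assumes [measurable]: "f \<in> borel_measurable borel" and f: "integrable lborel (\<lambda>x. \<bar>f x\<bar> powr p)"
  shows "f \<in> hclosure p"
proof -
  let ?h = "hermite_fun 0 :: real ^ 'd \<Rightarrow> real"
  have "(\<lambda>x. f x / ?h x) \<in> borel_measurable borel" by measurable
  from borel_measurable_implies_sequence_metric[OF this, of 0]
  obtain s where s: "\<And>k. simple_function borel (s k)" "\<And>x. (\<lambda>k. s k x) \<longlonglongrightarrow> f x / ?h x"
    "\<And>k x. \<bar>s k x\<bar> \<le> 2 * \<bar>f x / ?h x\<bar>" by auto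
  show ?thesis
  proof (rule hclosure_dominated[where F = "\<lambda>k x. s k x * ?h x" and w = "\<lambda>x. 2 * \<bar>f x\<bar>"])
    fix k
    have "(\<lambda>x. indicat_real (s k -` {y}) x * ?h x) \<in> hclosure p" for y
      using multipliers_indicator[of "s k -` {y}"] simple_functionD(2)[OF s(1)[of k], of "{y}"] hermite_span_hermite[of 0]
      by (auto simp: multipliers_def)
    then have "(\<lambda>x. \<Sum>y\<in>range (s k). y * (indicat_real (s k -` {y}) x * ?h x)) \<in> hclosure p"
      using simple_functionD(1)[OF s(1)] by (intro hclosure_sum hclosure_cmult) auto
    also have "(\<lambda>x. \<Sum>y\<in>range (s k). y * (indicat_real (s k -` {y}) x * ?h x)) = (\<lambda>x. s k x * ?h x)"
    proof
      fix x
      have "(\<Sum>y\<in>range (s k). y * (indicat_real (s k -` {y}) x * ?h x))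
          = (\<Sum>y\<in>range (s k). if y = s k x then s k x * ?h x else 0)"
        by (intro sum.cong) (auto simp: indicator_def)
      also have "\<dots> = s k x * ?h x"
        using simple_functionD(1)[OF s(1)] by (subst sum.delta) auto
      finally show "(\<Sum>y\<in>range (s k). y * (indicat_real (s k -` {y}) x * ?h x)) = s k x * ?h x" .
    qed
    finally show "(\<lambda>x. s k x * ?h x) \<in> hclosure p" .
    show "\<bar>s k x * ?h x\<bar> \<le> 2 * \<bar>f x\<bar>" for x
      using mult_right_mono[OF s(3)[of k x], of "?h x"] hermite_fun_0_pos[of x]
      by (simp add: abs_mult abs_divide)
  next
    show "(\<lambda>k. s k x * ?h x) \<longlonglongrightarrow> f x" for x
      using tendsto_mult[OF s(2)[of x] tendsto_const[of "?h x"]] hermite_fun_0_pos[of x] by simp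
    show "integrable lborel (\<lambda>x. (2 * \<bar>f x\<bar>) powr p)"
      using f by (simp add: powr_mult)
  qed simp
qed

end

theorem hermite_span_dense:
  fixes f :: "real ^ 'd \<Rightarrow> real"
  assumes p: "0 < p" and f: "f \<in> Lp_space p" and e: "0 < e"
  obtains g where "g \<in> hermite_span" "(\<integral>x. \<bar>f x - g x\<bar> powr p \<partial>lebesgue) < e"
proof -
  obtain f' where f' [measurable]: "f' \<in> borel_measurable lborel" and ae: "AE x in lborel. f x = f' x"
    using completion_ex_borel_measurable_real[of f lborel] f by (auto simp: Lp_space_def)
  have ae': "AE x in lebesgue. f x = f' x" using ae by (rule AE_completion)
  have [measurable]: "f \<in> borel_measurable lebesgue" using f by (simp add: Lp_space_def)
  have [measurable]: "f' \<in> borel_measurable lebesgue" using f' by (rule measurable_completion)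
  have "integrable lebesgue (\<lambda>x. \<bar>f' x\<bar> powr p) = integrable lebesgue (\<lambda>x. \<bar>f x\<bar> powr p)"
    by (rule integrable_cong_AE) (use ae' in auto)
  then have "integrable lebesgue (\<lambda>x. \<bar>f' x\<bar> powr p)" using f by (simp add: Lp_space_def)
  then have "integrable lborel (\<lambda>x. \<bar>f' x\<bar> powr p)"
    by (subst (asm) integrable_completion) auto
  with hclosure_UNIV[OF p, of f'] obtain g where g: "g \<in> hermite_span" "(LBINT x. \<bar>f' x - g x\<bar> powr p) < e"
    using e by (auto simp: hclosure_def)
  note [measurable] = hermite_span_meas[OF g(1)]
  have [measurable]: "g \<in> borel_measurable lebesgue" using measurable_completion[of g lborel borel] by simp
  have "(\<integral>x. \<bar>f x - g x\<bar> powr p \<partial>lebesgue) = (\<integral>x. \<bar>f' x - g x\<bar> powr p \<partial>lebesgue)"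
    by (rule integral_cong_AE) (use ae' in auto)
  also have "\<dots> = (LBINT x. \<bar>f' x - g x\<bar> powr p)" by (rule integral_completion) measurable
  finally show ?thesis using that g by simp
qed

section \<open>The Bellman function along a pair of flows\<close>

text \<open>A positive slope anywhere would force linear growth by convexity, against the limit 0.
  Hence g is nonincreasing and lies above its limit.\<close>

lemma convex_vanishing_at_infinity_nonneg:
  fixes g g1 g2 :: "real \<Rightarrow> real"
  assumes g: "\<And>t. a < t \<Longrightarrow> (g has_real_derivative g1 t) (at t)"
    and g1: "\<And>t. a < t \<Longrightarrow> (g1 has_real_derivative g2 t) (at t)"
    and g2: "\<And>t. a < t \<Longrightarrow> 0 \<le> g2 t"
    and lim: "(g \<longlongrightarrow> 0) at_top" and s: "a < s"
  shows "0 \<le> g s"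
proof -
  have mono: "g1 x \<le> g1 y" if "a < x" "x \<le> y" for x y
    by (rule DERIV_nonneg_imp_nondecreasing[OF that(2)]) (metis g1 g2 that(1) order_less_le_trans)
  have neg: "g1 r \<le> 0" if r: "a < r" for r
  proof (rule ccontr)
    assume "\<not> g1 r \<le> 0"
    then have p: "0 < g1 r" by simp
    have lower: "g r + g1 r * (t - r) \<le> g t" if t: "r < t" for t
    proof -
      obtain z where z: "r < z" "z < t" "g t - g r = (t - r) * g1 z"
        using MVT2[of r t g g1] t r g by fastforce
      have "(t - r) * g1 r \<le> (t - r) * g1 z" using mono[of r z] r z t by (intro mult_left_mono) auto
      with z(3) show ?thesis by (simp add: mult.commute)
    qed
    \<comment> \<open>From here on the supporting line at r is at height at least 1.\<close>
    define t where "t = max (r + 1) (r + (1 - g r) / g1 r)"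
    have ev: "eventually (\<lambda>u. g u < 1) at_top" using lim by (intro order_tendstoD) auto
    have "eventually (\<lambda>u. 1 \<le> g u) at_top"
      using eventually_ge_at_top[of t]
    proof eventually_elim
      case (elim u)
      have "(1 - g r) / g1 r \<le> u - r" using elim by (simp add: t_def)
      then have "1 - g r \<le> (u - r) * g1 r" using p by (simp add: pos_divide_le_eq)
      moreover have "r < u" using elim by (simp add: t_def)
      ultimately show ?case using lower[of u] by (simp add: mult.commute)
    qed
    from eventually_conj[OF ev this] have "eventually (\<lambda>u::real. False) at_top"
      by (rule eventually_mono) auto
    then show False by simp
  qed
  have "eventually (\<lambda>u. g u \<le> g s) at_top"
    using eventually_ge_at_top[of s]
  proof eventually_elim
    case (elim u)
    show ?case
      by (rule DERIV_nonpos_imp_nonincreasing[OF elim]) (metis g neg s order_less_le_trans)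
  qed
  then show ?thesis using tendsto_upperbound[OF lim] by auto
qed

text \<open>\<open>U1\<close>, \<open>U2\<close> are time derivatives, \<open>UI\<close>,
  \<open>UII\<close> derivatives along the axes, and c is the constant added to the potential |x|^2.
  The bounds hold for t > -1, which makes t = 0 an interior point with two-sided derivatives; the
  rate \<nu> yields the decay as t tends to infinity.\<close>

locale hflow =
  fixes U U1 U2 :: "real \<Rightarrow> real ^ 'd \<Rightarrow> 'a::euclidean_space"
    and UI UII :: "'d \<Rightarrow> real \<Rightarrow> real ^ 'd \<Rightarrow> 'a" and c A \<nu> :: real
  assumes dU: "((\<lambda>t. U t x) has_vector_derivative U1 t x) (at t)"
    and dU1: "((\<lambda>t. U1 t x) has_vector_derivative U2 t x) (at t)"
    and dUI: "((\<lambda>s. U t (x + s *\<^sub>R axis i 1)) has_vector_derivative UI i t (x + s *\<^sub>R axis i 1)) (at s)"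
    and dUII: "((\<lambda>s. UI i t (x + s *\<^sub>R axis i 1)) has_vector_derivative UII i t (x + s *\<^sub>R axis i 1)) (at s)"
    and pde: "U2 t x + (\<Sum>i\<in>UNIV. UII i t x) = ((norm x)\<^sup>2 + c) *\<^sub>R U t x"
    and c: "0 \<le> c" and A: "0 < A" and \<nu>: "0 < \<nu>"
    and bounds: "- 1 < t \<Longrightarrow> norm (U t x) \<le> A * exp (- (3 / 8) * (norm x)\<^sup>2) * exp (- \<nu> * t)"
      "- 1 < t \<Longrightarrow> norm (U1 t x) \<le> A * exp (- (3 / 8) * (norm x)\<^sup>2) * exp (- \<nu> * t)"
      "- 1 < t \<Longrightarrow> norm (U2 t x) \<le> A * exp (- (3 / 8) * (norm x)\<^sup>2) * exp (- \<nu> * t)"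
      "- 1 < t \<Longrightarrow> norm (UI i t x) \<le> A * exp (- (3 / 8) * (norm x)\<^sup>2) * exp (- \<nu> * t)"
      "- 1 < t \<Longrightarrow> norm (UII i t x) \<le> A * exp (- (3 / 8) * (norm x)\<^sup>2) * exp (- \<nu> * t)"
    and meas [measurable]: "U t \<in> borel_measurable borel" "U1 t \<in> borel_measurable borel"
      "U2 t \<in> borel_measurable borel" "UI i t \<in> borel_measurable borel" "UII i t \<in> borel_measurable borel"
    and nonzero: "U t x \<noteq> 0"
begin

text \<open>Besides the gradient in (t, x) there is a potential term, because delta_i^* F = x_i F -
  d_i F must also be bounded by the energy.\<close>

definition energy :: "real \<Rightarrow> real ^ 'd \<Rightarrow> real" where
  "energy t x = U1 t x \<bullet> U1 t x + (\<Sum>i\<in>UNIV. UI i t x \<bullet> UI i t x) + (norm x)\<^sup>2 * (U t x \<bullet> U t x)"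

lemma energy_nonneg: "0 \<le> energy t x"
  unfolding energy_def by (intro add_nonneg_nonneg sum_nonneg mult_nonneg_nonneg) auto

definition maj :: "real \<Rightarrow> real ^ 'd \<Rightarrow> real" where
  "maj t x = A * exp (- (3 / 8) * (norm x)\<^sup>2) * exp (- \<nu> * t)"

lemma maj_pos: "0 < maj t x" using A by (simp add: maj_def)

lemma bounds_maj:
  assumes "- 1 < t"
  shows "norm (U t x) \<le> maj t x" "norm (U1 t x) \<le> maj t x" "norm (U2 t x) \<le> maj t x"
    "norm (UI i t x) \<le> maj t x" "norm (UII i t x) \<le> maj t x"
  unfolding maj_def by (intro bounds assms)+

lemma maj_powr:
  "maj t x powr r = A powr r * exp (- (3 / 8 * r) * (norm x)\<^sup>2) * exp (- (\<nu> * r) * t)"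
  using A by (simp add: maj_def powr_mult exp_powr_real ac_simps)

lemma maj_powr_le:
  assumes t: "- 1 < t" and r: "0 \<le> r"
  shows "maj t x powr r \<le> A powr r * exp (\<nu> * r) * exp (- (3 / 8 * r) * (norm x)\<^sup>2)"
proof -
  have "exp (- (\<nu> * r) * t) \<le> exp (\<nu> * r)"
    using mult_left_mono[of "- t" 1 "\<nu> * r"] t r \<nu> by simp
  then have "A powr r * exp (- (3 / 8 * r) * (norm x)\<^sup>2) * exp (- (\<nu> * r) * t)
      \<le> A powr r * exp (- (3 / 8 * r) * (norm x)\<^sup>2) * exp (\<nu> * r)"
    by (intro mult_left_mono) auto
  then show ?thesis unfolding maj_powr by (simp add: ac_simps)
qed

end

locale bellman_flow = bellman p q + u: hflow U U1 U2 UI UII cu Au \<nu>u + v: hflow V V1 V2 VI VII cv Av \<nu>v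
  for p q and U U1 U2 :: "real \<Rightarrow> real ^ 'd \<Rightarrow> 'a::euclidean_space" and UI UII cu Au \<nu>u
    and V V1 V2 :: "real \<Rightarrow> real ^ 'd \<Rightarrow> 'b::euclidean_space" and VI VII cv Av \<nu>v +
  fixes m :: real
  assumes m: "0 < m" and lower: "m * exp (- (1 / 2) * (norm x)\<^sup>2) * exp (- \<nu>v * t) \<le> norm (V t x)"
begin

definition low :: "real \<Rightarrow> real ^ 'd \<Rightarrow> real" where
  "low t x = m * exp (- (1 / 2) * (norm x)\<^sup>2) * exp (- \<nu>v * t)"

lemma low: "0 < low t x" "low t x \<le> norm (V t x)"
  using m lower by (auto simp: low_def)

lemma gauss_le: "1 / 4 \<le> r \<Longrightarrow> exp (- r * (norm x)\<^sup>2) \<le> exp (- (1 / 4) * (norm x)\<^sup>2)" for x :: "real ^ 'd"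
  unfolding exp_le_cancel_iff by (intro mult_right_mono) auto

text \<open>The critical term is the one with a negative power of the lower bound of |v|: it gains
  the Gaussian exponent 1 - q/2 and loses 2 times 3/8, so the remaining rate is q/2 - 1/4, which
  exceeds 1/4 as q > 1. In time the upper and lower bounds of v share the rate
  \<open>\<nu>v\<close>, so their quotient stays controlled.\<close>

lemma growth_bound: "\<exists>K. \<forall>t>-1. \<forall>x. growth (u.maj t x) (v.maj t x) (low t x) \<le> K * exp (- (1 / 4) * (norm x)\<^sup>2)"
proof -
  define K1 where "K1 = Au powr p * exp (\<nu>u * p)"
  define K2 where "K2 = (Av powr (2 - q) * exp (\<nu>v * (2 - q))) * (Au powr 2 * exp (\<nu>u * 2))"
  define K3 where "K3 = m powr (q - 2) * Av powr 2 * exp (\<nu>v * q)"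
  have "growth (u.maj t x) (v.maj t x) (low t x) \<le> (4 * (p\<^sup>2 + p + 9) * (K1 + K2 + K3)) * exp (- (1 / 4) * (norm x)\<^sup>2)"
    if t: "- 1 < t" for t x
  proof -
    let ?E = "exp (- (1 / 4) * (norm x)\<^sup>2)"
    have 1: "u.maj t x powr (p - 2) * (u.maj t x)\<^sup>2 \<le> K1 * ?E"
    proof -
      have "u.maj t x powr (p - 2) * (u.maj t x)\<^sup>2 = u.maj t x powr p"
        using u.maj_pos[of t x] powr_add[of "u.maj t x" "p - 2" 2] by simp
      also have "\<dots> \<le> K1 * exp (- (3 / 8 * p) * (norm x)\<^sup>2)"
        unfolding K1_def using p_ge_2 by (intro u.maj_powr_le t) auto
      also have "\<dots> \<le> K1 * ?E"
        using p_ge_2 by (intro mult_left_mono gauss_le) (auto simp: K1_def)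
      finally show ?thesis .
    qed
    have 2: "v.maj t x powr (2 - q) * (u.maj t x)\<^sup>2 \<le> K2 * ?E"
    proof -
      have "v.maj t x powr (2 - q) \<le> Av powr (2 - q) * exp (\<nu>v * (2 - q)) * exp (- (3 / 8 * (2 - q)) * (norm x)\<^sup>2)"
        using q_le_2 by (intro v.maj_powr_le t) auto
      also have "\<dots> \<le> Av powr (2 - q) * exp (\<nu>v * (2 - q)) * 1"
        using q_le_2 by (intro mult_left_mono) auto
      finally have a: "v.maj t x powr (2 - q) \<le> Av powr (2 - q) * exp (\<nu>v * (2 - q))" by simp
      have "(u.maj t x)\<^sup>2 = u.maj t x powr 2" using u.maj_pos[of t x] by simp
      also have "\<dots> \<le> Au powr 2 * exp (\<nu>u * 2) * exp (- (3 / 8 * 2) * (norm x)\<^sup>2)"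
        by (intro u.maj_powr_le t) auto
      also have "\<dots> \<le> Au powr 2 * exp (\<nu>u * 2) * ?E"
        by (intro mult_left_mono gauss_le) auto
      finally have "v.maj t x powr (2 - q) * (u.maj t x)\<^sup>2 \<le>
          (Av powr (2 - q) * exp (\<nu>v * (2 - q))) * (Au powr 2 * exp (\<nu>u * 2) * ?E)"
        using a by (intro mult_mono) auto
      then show ?thesis by (simp add: K2_def mult.assoc)
    qed
    have 3: "low t x powr (q - 2) * (v.maj t x)\<^sup>2 \<le> K3 * ?E"
    proof -
      have "low t x powr (q - 2) * (v.maj t x)\<^sup>2
        = (m powr (q - 2) * exp (- (1 / 2) * (norm x)\<^sup>2 * (q - 2)) * exp (- \<nu>v * t * (q - 2)))
          * (Av powr 2 * exp (- (3 / 8 * 2) * (norm x)\<^sup>2) * exp (- (\<nu>v * 2) * t))"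
        using v.maj_pos[of t x] v.maj_powr[of t x 2] m by (simp add: low_def powr_mult exp_powr_real)
      also have "\<dots> = m powr (q - 2) * Av powr 2 * (exp (- (q / 2 - 1 / 4) * (norm x)\<^sup>2) * exp (\<nu>v * q * (- t)))"
        by (simp add: ac_simps exp_add[symmetric]) (simp add: field_simps)
      also have "\<dots> \<le> m powr (q - 2) * Av powr 2 * (?E * exp (\<nu>v * q))"
        using q_gt_1 v.\<nu> t mult_left_mono[of "- t" 1 "\<nu>v * q"]
        by (intro mult_left_mono mult_mono gauss_le) auto
      finally show ?thesis by (simp add: K3_def ac_simps)
    qed
    have "growth (u.maj t x) (v.maj t x) (low t x) \<le> 4 * (p\<^sup>2 + p + 9) * (K1 * ?E + K2 * ?E + K3 * ?E)"
      unfolding growth_def distrib_right[of "u.maj t x powr (p - 2)"] using 1 2 3 p_ge_2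
      by (intro mult_left_mono add_mono) auto
    also have "\<dots> = (4 * (p\<^sup>2 + p + 9) * (K1 + K2 + K3)) * ?E" by (simp only: distrib_right mult.assoc)
    finally show ?thesis .
  qed
  then show ?thesis by blast
qed

definition b where "b t x = B (U t x) (V t x)"
definition b1 where "b1 t x = B1 (U t x) (V t x) (U1 t x) (V1 t x)"
definition b2 where "b2 t x = B2 (U t x) (V t x) (U1 t x) (V1 t x) (U2 t x) (V2 t x)"
definition bI where "bI i t x = B1 (U t x) (V t x) (UI i t x) (VI i t x)"
definition bII where "bII i t x = B2 (U t x) (V t x) (UI i t x) (VI i t x) (UII i t x) (VII i t x)"

lemma pw_meas [measurable]: "pw \<in> borel_measurable borel" "qw \<in> borel_measurable borel"
  unfolding pw_def[abs_def] qw_def[abs_def] by measurable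

lemma b_meas [measurable]: "b t \<in> borel_measurable borel" "b1 t \<in> borel_measurable borel"
  "b2 t \<in> borel_measurable borel" "bI i t \<in> borel_measurable borel" "bII i t \<in> borel_measurable borel"
  unfolding b_def[abs_def] b1_def[abs_def] b2_def[abs_def] bI_def[abs_def] bII_def[abs_def]
    B_def B1_def B2_def bell_def bu_def bv_def c11_def c12_def c22_def ww_def tot_def
  by measurable

lemma b_deriv: "((\<lambda>t. b t x) has_real_derivative b1 t x) (at t)"
  unfolding b_def b1_def by (intro B_deriv u.dU v.dU u.nonzero v.nonzero)

lemma b1_deriv: "((\<lambda>t. b1 t x) has_real_derivative b2 t x) (at t)"
  unfolding b1_def b2_def by (intro B1_deriv u.dU v.dU u.dU1 v.dU1 u.nonzero v.nonzero)

lemma bI_deriv: "((\<lambda>s. bI i t (x + s *\<^sub>R axis i 1)) has_real_derivative bII i t (x + s *\<^sub>R axis i 1)) (at s)"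
  unfolding bI_def bII_def by (intro B1_deriv u.dUI v.dUI u.dUII v.dUII u.nonzero v.nonzero)

lemma b_growth:
  assumes t: "- 1 < t"
  shows "\<bar>b1 t x\<bar> \<le> growth (u.maj t x) (v.maj t x) (low t x)"
    "\<bar>b2 t x\<bar> \<le> growth (u.maj t x) (v.maj t x) (low t x)"
    "\<bar>bI i t x\<bar> \<le> growth (u.maj t x) (v.maj t x) (low t x)"
    "\<bar>bII i t x\<bar> \<le> growth (u.maj t x) (v.maj t x) (low t x)"
  unfolding b1_def b2_def bI_def bII_def
  by (rule B1_growth[where ?u2.0 = 0 and ?v2.0 = 0] B2_growth;
      use u.nonzero v.nonzero u.bounds_maj[OF t] v.bounds_maj[OF t] low u.maj_pos[of t x] v.maj_pos[of t x]
      in \<open>simp add: less_imp_le\<close>)+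

lemma b_bounds: "0 \<le> b t x" "b t x \<le> 9 / 8 * norm (V t x) powr q + 1 / 8 * norm (U t x) powr p"
proof -
  have *: "0 < U t x \<bullet> U t x" "0 < V t x \<bullet> V t x" using u.nonzero v.nonzero by auto
  show "0 \<le> b t x" unfolding b_def B_def by (rule bell_nonneg[OF *])
  have "pw (U t x \<bullet> U t x) = norm (U t x) powr p" "qw (V t x \<bullet> V t x) = norm (V t x) powr q"
    using powr_powr[of "norm (U t x)" 2 "p / 2"] powr_powr[of "norm (V t x)" 2 "q / 2"]
    by (simp_all add: pw_def qw_def power2_norm_eq_inner)
  then show "b t x \<le> 9 / 8 * norm (V t x) powr q + 1 / 8 * norm (U t x) powr p"
    using bell_le[OF *] unfolding b_def B_def by simp
qed

lemma b_le_maj: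
  assumes "- 1 < t" shows "b t x \<le> 9 / 8 * v.maj t x powr q + 1 / 8 * u.maj t x powr p"
proof -
  have "norm (V t x) powr q \<le> v.maj t x powr q" "norm (U t x) powr p \<le> u.maj t x powr p"
    using u.bounds_maj[OF assms] v.bounds_maj[OF assms] q_gt_1 p_ge_2 by (auto intro!: powr_mono2)
  then show ?thesis using b_bounds(2)[of t x] by linarith
qed

lemma gauss38: "1 \<le> r \<Longrightarrow> exp (- (3 / 8 * r) * (norm x)\<^sup>2) \<le> exp (- (1 / 4) * (norm x)\<^sup>2)" for x :: "real ^ 'd"
  using gauss_le[of "3 / 8 * r" x] by simp

lemma b_integrable: 
  assumes "- 1 < t" shows "integrable lborel (b t)"
proof (rule integrable_gaussian_bound)
  fix x :: "real ^ 'd"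
  have "9 / 8 * v.maj t x powr q + 1 / 8 * u.maj t x powr p \<le>
      9 / 8 * (Av powr q * exp (\<nu>v * q) * exp (- (3 / 8 * q) * (norm x)\<^sup>2))
      + 1 / 8 * (Au powr p * exp (\<nu>u * p) * exp (- (3 / 8 * p) * (norm x)\<^sup>2))"
    using q_gt_1 p_ge_2 assms by (intro add_mono mult_left_mono u.maj_powr_le v.maj_powr_le) auto
  also have "\<dots> \<le> 9 / 8 * (Av powr q * exp (\<nu>v * q) * exp (- (1 / 4) * (norm x)\<^sup>2))
      + 1 / 8 * (Au powr p * exp (\<nu>u * p) * exp (- (1 / 4) * (norm x)\<^sup>2))"
    using q_gt_1 p_ge_2 by (intro add_mono mult_left_mono gauss38) auto
  also have "\<dots> = (9 / 8 * (Av powr q * exp (\<nu>v * q)) + 1 / 8 * (Au powr p * exp (\<nu>u * p))) * exp (- (1 / 4) * (norm x)\<^sup>2)"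
    by (simp only: distrib_right mult.assoc)
  finally show "\<bar>b t x\<bar> \<le> (9 / 8 * (Av powr q * exp (\<nu>v * q)) + 1 / 8 * (Au powr p * exp (\<nu>u * p))) * exp (- (1 / 4) * (norm x)\<^sup>2)"
    using b_le_maj[OF assms, of x] b_bounds(1)[of t x] by linarith
qed auto

definition \<Phi> where "\<Phi> t = (LBINT x. b t x)"
definition \<Phi>1 where "\<Phi>1 t = (LBINT x. b1 t x)"

text \<open>One Gaussian of rate 1/4, uniform in t > -1, dominates all derivatives of
  \<open>b\<close>. It justifies two differentiations under the integral in t and makes the
  integrals of the second space derivatives vanish.\<close>

lemma b2_integrable: "- 1 < t \<Longrightarrow> integrable lborel (b2 t)"
  and bII_integrable: "- 1 < t \<Longrightarrow> integrable lborel (bII i t)"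
  and bII_integral: "- 1 < t \<Longrightarrow> (LBINT x. bII i t x) = 0"
  and \<Phi>_deriv: "- 1 < t \<Longrightarrow> (\<Phi> has_real_derivative \<Phi>1 t) (at t)"
  and \<Phi>1_deriv: "- 1 < t \<Longrightarrow> (\<Phi>1 has_real_derivative (LBINT x. b2 t x)) (at t)"
proof -
  obtain K where K: "\<And>t x. - 1 < t \<Longrightarrow> growth (u.maj t x) (v.maj t x) (low t x) \<le> K * exp (- (1 / 4) * (norm x)\<^sup>2)"
    using growth_bound by blast
  note bd = b_growth[THEN order_trans, OF _ K]
  have i1: "integrable lborel (b1 t)" if "- 1 < t" for t
    using bd that by (intro integrable_gaussian_bound[where c = "1 / 4" and C = K]) auto
  show "integrable lborel (b2 t)" if "- 1 < t" for t
    using bd that by (intro integrable_gaussian_bound[where c = "1 / 4" and C = K]) auto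
  show "integrable lborel (bII i t)" if "- 1 < t" for t i
    using bd that by (intro integrable_gaussian_bound[where c = "1 / 4" and C = K]) auto
  show "(LBINT x. bII i t x) = 0" if "- 1 < t" for t i
    using bd that bI_deriv[of i t _ 0]
    by (intro integral_directional_derivative[where w = "bI i t" and e = "axis i 1" and c = "1 / 4" and C = K]) auto
  have g: "integrable lborel (\<lambda>x::real^'d. K * exp (- (1 / 4) * (norm x)\<^sup>2))"
    using integrable_gaussian[of "1 / 4", where 'a = "real ^ 'd"] by simp
  show "(\<Phi> has_real_derivative \<Phi>1 t) (at t)" if t: "- 1 < t" for t
    unfolding \<Phi>_def \<Phi>1_def
    by (rule leibniz_rule_lebesgue[where d = "t + 1", OF _ _ _ _ g]) (use t bd b_integrable b_deriv in auto)
  show "(\<Phi>1 has_real_derivative (LBINT x. b2 t x)) (at t)" if t: "- 1 < t" for t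
    unfolding \<Phi>1_def
    by (rule leibniz_rule_lebesgue[where d = "t + 1", OF _ _ _ _ g]) (use t bd i1 b1_deriv in auto)
qed

lemma \<Phi>_tendsto: "(\<Phi> \<longlongrightarrow> 0) at_top"
proof -
  define K where "K x = 9 / 8 * (Av powr q * exp (- (3 / 8 * q) * (norm x)\<^sup>2))
    + 1 / 8 * (Au powr p * exp (- (3 / 8 * p) * (norm x)\<^sup>2))" for x :: "real ^ 'd"
  \<comment> \<open>Since p and q exceed 1, the smaller of the two rates bounds the decay of both
    powers.\<close>
  define \<nu> where "\<nu> = min \<nu>u \<nu>v"
  have \<nu>: "0 < \<nu>" using u.\<nu> v.\<nu> by (simp add: \<nu>_def)
  have Ki: "integrable lborel K"
    unfolding K_def[abs_def] using integrable_gaussian[of "3 / 8 * q", where 'a = "real ^ 'd"]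
      integrable_gaussian[of "3 / 8 * p", where 'a = "real ^ 'd"] q_gt_1 p_ge_2 by simp
  have ub: "\<Phi> t \<le> exp (- \<nu> * t) * (LBINT x. K x)" if t: "0 \<le> t" for t
  proof -
    have "\<Phi> t \<le> (LBINT x. exp (- \<nu> * t) * K x)"
      unfolding \<Phi>_def
    proof (rule integral_mono)
      fix x
      have e: "exp (- (\<nu>v * q) * t) \<le> exp (- \<nu> * t)" "exp (- (\<nu>u * p) * t) \<le> exp (- \<nu> * t)"
      proof -
        have "\<nu> \<le> \<nu>v" "\<nu> \<le> \<nu>u" by (auto simp: \<nu>_def)
        moreover have "\<nu>v \<le> \<nu>v * q" "\<nu>u \<le> \<nu>u * p" using u.\<nu> v.\<nu> q_gt_1 p_ge_2 by simp_all
        ultimately show "exp (- (\<nu>v * q) * t) \<le> exp (- \<nu> * t)" "exp (- (\<nu>u * p) * t) \<le> exp (- \<nu> * t)"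
          using t by (auto intro!: mult_right_mono)
      qed
      have "b t x \<le> 9 / 8 * v.maj t x powr q + 1 / 8 * u.maj t x powr p" using t by (intro b_le_maj) auto
      also have "\<dots> \<le> 9 / 8 * (Av powr q * exp (- (3 / 8 * q) * (norm x)\<^sup>2) * exp (- \<nu> * t))
          + 1 / 8 * (Au powr p * exp (- (3 / 8 * p) * (norm x)\<^sup>2) * exp (- \<nu> * t))"
        unfolding u.maj_powr v.maj_powr using e by (intro add_mono mult_left_mono) auto
      also have "\<dots> = exp (- \<nu> * t) * K x" by (simp add: K_def algebra_simps)
      finally show "b t x \<le> exp (- \<nu> * t) * K x" .
    qed (use t b_integrable[of t] Ki in auto)
    then show ?thesis by simp
  qed
  have lb: "0 \<le> \<Phi> t" for t unfolding \<Phi>_def by (intro integral_nonneg_AE) (auto simp: b_bounds)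
  have "((\<lambda>t. exp (- \<nu> * t)) \<longlongrightarrow> 0) at_top" using \<nu> by real_asymp
  then have h: "((\<lambda>t. exp (- \<nu> * t) * (LBINT x. K x)) \<longlongrightarrow> 0) at_top"
    by (rule tendsto_mult_left_zero)
  have ev: "eventually (\<lambda>t. \<Phi> t \<le> exp (- \<nu> * t) * (LBINT x. K x)) at_top"
    using eventually_ge_at_top[of 0] by eventually_elim (rule ub)
  have ev0: "eventually (\<lambda>t. 0 \<le> \<Phi> t) at_top" using lb by simp
  show ?thesis by (rule tendsto_sandwich[OF ev0 ev tendsto_const h])
qed

text \<open>Summing \<open>B2_lower\<close> over time and all axes, the accelerations add up to
  (|x|^2 + c) times the flow, with good sign. This completes the weighted derivative terms to
  weighted energies, and \<alpha>\<beta> \<ge> 1 removes the weights.\<close>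

lemma laplacian_lower:
  "(q - 1) / 2 * sqrt (u.energy t x * v.energy t x) \<le> b2 t x + (\<Sum>i\<in>UNIV. bII i t x)"
proof -
  let ?u = "U t x" and ?v = "V t x"
  let ?bu = "bu (?u \<bullet> ?u) (?v \<bullet> ?v)" and ?bv = "bv (?u \<bullet> ?u) (?v \<bullet> ?v)"
  note nz = u.nonzero[of t x] v.nonzero[of t x]
  define al where "al = \<alpha> ?u ?v"
  define be where "be = \<beta> ?v"
  define r where "r = (norm x)\<^sup>2"
  have P: "0 < ?u \<bullet> ?u" "0 < ?v \<bullet> ?v" "0 < al" "0 < be" "1 \<le> al * be"
    using uv_pos[OF nz] by (auto simp: al_def be_def)
  have r: "0 \<le> r" by (simp add: r_def)
  have "(q - 1) / 2 * (al / 4 * (U1 t x \<bullet> U1 t x) + be * (V1 t x \<bullet> V1 t x))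
     + ?bu * (?u \<bullet> U2 t x) + ?bv * (?v \<bullet> V2 t x)
     + (\<Sum>i\<in>UNIV. (q - 1) / 2 * (al / 4 * (UI i t x \<bullet> UI i t x) + be * (VI i t x \<bullet> VI i t x))
        + ?bu * (?u \<bullet> UII i t x) + ?bv * (?v \<bullet> VII i t x))
    \<le> b2 t x + (\<Sum>i\<in>UNIV. bII i t x)"
    unfolding b2_def bII_def al_def be_def by (intro add_mono sum_mono B2_lower nz)
  also have "(q - 1) / 2 * (al / 4 * (U1 t x \<bullet> U1 t x) + be * (V1 t x \<bullet> V1 t x))
     + ?bu * (?u \<bullet> U2 t x) + ?bv * (?v \<bullet> V2 t x)
     + (\<Sum>i\<in>UNIV. (q - 1) / 2 * (al / 4 * (UI i t x \<bullet> UI i t x) + be * (VI i t x \<bullet> VI i t x))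
        + ?bu * (?u \<bullet> UII i t x) + ?bv * (?v \<bullet> VII i t x))
     = (q - 1) / 2 * (al / 4 * (u.energy t x - r * (?u \<bullet> ?u)) + be * (v.energy t x - r * (?v \<bullet> ?v)))
       + ?bu * (?u \<bullet> (U2 t x + (\<Sum>i\<in>UNIV. UII i t x))) + ?bv * (?v \<bullet> (V2 t x + (\<Sum>i\<in>UNIV. VII i t x)))"
    unfolding u.energy_def v.energy_def r_def[symmetric]
    by (simp add: sum.distrib sum_distrib_left sum_divide_distrib inner_add_right inner_sum_right distrib_left add_divide_distrib)
  also have "\<dots> = (q - 1) / 2 * (al / 4 * (u.energy t x - r * (?u \<bullet> ?u)) + be * (v.energy t x - r * (?v \<bullet> ?v)))
       + ?bu * ((r + cu) * (?u \<bullet> ?u)) + ?bv * ((r + cv) * (?v \<bullet> ?v))"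
    unfolding u.pde v.pde r_def by simp
  finally have *: "(q - 1) / 2 * (al / 4 * (u.energy t x - r * (?u \<bullet> ?u)) + be * (v.energy t x - r * (?v \<bullet> ?v)))
       + ?bu * ((r + cu) * (?u \<bullet> ?u)) + ?bv * ((r + cv) * (?v \<bullet> ?v)) \<le> b2 t x + (\<Sum>i\<in>UNIV. bII i t x)" .
  \<comment> \<open>So far the energies lack their |x|^2 parts. The terms from the equation supply
    them, by the lower bounds on \<open>bu\<close> and \<open>bv\<close>.\<close>
  have "(q - 1) / 4 * al * (r * (?u \<bullet> ?u)) \<le> ?bu * ((r + cu) * (?u \<bullet> ?u))"
  proof (rule mult_mono)
    show le: "(q - 1) / 4 * al \<le> ?bu" unfolding al_def \<alpha>_def by (rule bu_ge[OF P(1,2)])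
    show "0 \<le> ?bu" using le P(3) q_gt_1 order_trans[of 0 "(q - 1) / 4 * al" ?bu] by simp
    show "r * (?u \<bullet> ?u) \<le> (r + cu) * (?u \<bullet> ?u)" using u.c P by (intro mult_right_mono) auto
  qed (use r P in simp)
  moreover have "(q - 1) / 2 * (al / 4 * (r * (?u \<bullet> ?u))) \<le> (q - 1) / 4 * al * (r * (?u \<bullet> ?u))"
  proof -
    have "0 \<le> al * (r * (?u \<bullet> ?u))" using P r by simp
    then have "(q - 1) / 8 * (al * (r * (?u \<bullet> ?u))) \<le> (q - 1) / 4 * (al * (r * (?u \<bullet> ?u)))"
      using q_gt_1 by (intro mult_right_mono) auto
    then show ?thesis by (simp add: mult.assoc)
  qed
  moreover have "be * (r * (?v \<bullet> ?v)) \<le> ?bv * ((r + cv) * (?v \<bullet> ?v))"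
  proof (rule mult_mono)
    show le: "be \<le> ?bv" unfolding be_def \<beta>_def by (rule bv_ge[OF P(1,2)])
    show "0 \<le> ?bv" using le P(4) by linarith
    show "r * (?v \<bullet> ?v) \<le> (r + cv) * (?v \<bullet> ?v)" using v.c P by (intro mult_right_mono) auto
  qed (use r P in simp)
  moreover have "(q - 1) / 2 * (be * (r * (?v \<bullet> ?v))) \<le> 1 * (be * (r * (?v \<bullet> ?v)))"
    using q_gt_1 q_le_2 P r by (intro mult_right_mono) auto
  ultimately have "(q - 1) / 2 * (al / 4 * u.energy t x + be * v.energy t x) \<le> b2 t x + (\<Sum>i\<in>UNIV. bII i t x)"
    using * unfolding right_diff_distrib distrib_left by linarith
  \<comment> \<open>Arithmetic-geometric mean: the square of the right side is at least four times
    the product of its two terms, and that product carries \<alpha>\<beta> / 4 \<ge> 1/4.\<close>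
  moreover have "sqrt (u.energy t x * v.energy t x) \<le> al / 4 * u.energy t x + be * v.energy t x"
  proof (rule real_le_lsqrt)
    have "u.energy t x * v.energy t x * 1 \<le> u.energy t x * v.energy t x * (al * be)"
      using P u.energy_nonneg v.energy_nonneg by (intro mult_left_mono) auto
    also have "\<dots> \<le> (al / 4 * u.energy t x + be * v.energy t x)\<^sup>2"
      using zero_le_power2[of "al / 4 * u.energy t x - be * v.energy t x"] by (simp add: power2_eq_square algebra_simps)
    finally show "u.energy t x * v.energy t x \<le> (al / 4 * u.energy t x + be * v.energy t x)\<^sup>2" by simp
    show "0 \<le> al / 4 * u.energy t x + be * v.energy t x"
      using P u.energy_nonneg v.energy_nonneg by (intro add_nonneg_nonneg mult_nonneg_nonneg) auto
  qed
  then have "(q - 1) / 2 * sqrt (u.energy t x * v.energy t x) \<le> (q - 1) / 2 * (al / 4 * u.energy t x + be * v.energy t x)"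
    using q_gt_1 by (intro mult_left_mono) auto
  ultimately show ?thesis by linarith
qed

theorem flow_bound:
  fixes \<Psi> \<Psi>1 :: "real \<Rightarrow> real" and \<psi> :: "real \<Rightarrow> real ^ 'd \<Rightarrow> real"
  assumes \<Psi>: "\<And>t. - 1 < t \<Longrightarrow> (\<Psi> has_real_derivative \<Psi>1 t) (at t)"
    and \<Psi>1: "\<And>t. - 1 < t \<Longrightarrow> (\<Psi>1 has_real_derivative (LBINT x. \<psi> t x)) (at t)"
    and int: "\<And>t. - 1 < t \<Longrightarrow> integrable lborel (\<psi> t)"
    and \<psi>: "\<And>t x. - 1 < t \<Longrightarrow> (\<psi> t x)\<^sup>2 \<le> 36 * (u.energy t x * v.energy t x)"
    and lim: "(\<Psi> \<longlongrightarrow> 0) at_top"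
  shows "\<bar>\<Psi> 0\<bar> \<le> 12 / (q - 1) *
    (9 / 8 * (LBINT x. norm (V 0 x) powr q) + 1 / 8 * (LBINT x. norm (U 0 x) powr p))"
proof -
  \<comment> \<open>Balances the 6 in the bound on \<psi> against the factor (q - 1) / 2 of
    \<open>laplacian_lower\<close>.\<close>
  define K where "K = 12 / (q - 1)"
  have K: "0 < K" using q_gt_1 by (simp add: K_def)
  \<comment> \<open>The space derivatives have integral 0: adding them leaves the second derivative
    of \<Phi> unchanged, but it produces the full Laplacian, for which a pointwise bound
    holds.\<close>
  define l where "l t x = b2 t x + (\<Sum>i\<in>UNIV. bII i t x)" for t x
  have l: "integrable lborel (l t)" "(LBINT x. l t x) = (LBINT x. b2 t x)" if "- 1 < t" for t
    unfolding l_def[abs_def] using b2_integrable[OF that] bII_integrable[OF that] bII_integral[OF that] by auto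
  have pt: "\<bar>\<psi> t x\<bar> \<le> K * l t x" if "- 1 < t" for t x
  proof -
    have "\<bar>\<psi> t x\<bar> \<le> sqrt (36 * (u.energy t x * v.energy t x))"
      using real_sqrt_le_mono[OF \<psi>[OF that]] by simp
    also have "\<dots> = 6 * sqrt (u.energy t x * v.energy t x)"
      using real_sqrt_mult[of 36] real_sqrt_abs[of 6] by simp
    also have "\<dots> = K * ((q - 1) / 2 * sqrt (u.energy t x * v.energy t x))"
      using q_gt_1 by (simp add: K_def)
    also have "\<dots> \<le> K * l t x" unfolding l_def using K by (intro mult_left_mono laplacian_lower) auto
    finally show ?thesis .
  qed
  have "0 \<le> K * \<Phi> 0 + s * \<Psi> 0" if s: "\<bar>s\<bar> = 1" for s :: real
  proof (rule convex_vanishing_at_infinity_nonneg[where a = "- 1" and g = "\<lambda>t. K * \<Phi> t + s * \<Psi> t"])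
    fix t :: real assume t: "- 1 < t"
    show "((\<lambda>t. K * \<Phi> t + s * \<Psi> t) has_real_derivative K * \<Phi>1 t + s * \<Psi>1 t) (at t)"
      by (intro DERIV_add DERIV_cmult \<Phi>_deriv \<Psi> t)
    show "((\<lambda>t. K * \<Phi>1 t + s * \<Psi>1 t) has_real_derivative
        K * (LBINT x. b2 t x) + s * (LBINT x. \<psi> t x)) (at t)"
      by (intro DERIV_add DERIV_cmult \<Phi>1_deriv \<Psi>1 t)
    have "K * (LBINT x. b2 t x) + s * (LBINT x. \<psi> t x) = (LBINT x. K * l t x + s * \<psi> t x)"
      using l[OF t] int[OF t] by simp
    also have "\<dots> \<ge> 0"
    proof (intro integral_nonneg_AE AE_I2)
      fix x
      have "\<bar>s * \<psi> t x\<bar> \<le> K * l t x" using pt[OF t, of x] s by (simp add: abs_mult)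
      then show "0 \<le> K * l t x + s * \<psi> t x" by linarith
    qed
    finally show "0 \<le> K * (LBINT x. b2 t x) + s * (LBINT x. \<psi> t x)" .
  next
    show "((\<lambda>t. K * \<Phi> t + s * \<Psi> t) \<longlongrightarrow> 0) at_top"
      using tendsto_add[OF tendsto_mult_right_zero[OF \<Phi>_tendsto, of K] tendsto_mult_right_zero[OF lim, of s]] by simp
  qed simp
  from this[of 1] this[of "- 1"] have *: "\<bar>\<Psi> 0\<bar> \<le> K * \<Phi> 0" by simp
  have "\<Phi> 0 \<le> (LBINT x. 9 / 8 * norm (V 0 x) powr q + 1 / 8 * norm (U 0 x) powr p)"
    unfolding \<Phi>_def
  proof (rule integral_mono)
    show "integrable lborel (\<lambda>x. 9 / 8 * norm (V 0 x) powr q + 1 / 8 * norm (U 0 x) powr p)"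
    proof (intro Bochner_Integration.integrable_add integrable_mult_right gbounded_powr_integrable)
      show "gbounded (\<lambda>x. norm (V 0 x))" "gbounded (\<lambda>x. norm (U 0 x))"
        unfolding gbounded_def using u.bounds(1)[of 0] v.bounds(1)[of 0] u.A v.A by auto
    qed (use q_gt_1 p_ge_2 in auto)
  qed (rule b_integrable, simp, rule b_bounds)
  also have "\<dots> = 9 / 8 * (LBINT x. norm (V 0 x) powr q) + 1 / 8 * (LBINT x. norm (U 0 x) powr p)"
  proof (subst Bochner_Integration.integral_add)
    have "gbounded (\<lambda>x. norm (V 0 x))" "gbounded (\<lambda>x. norm (U 0 x))"
      unfolding gbounded_def using u.bounds(1)[of 0] v.bounds(1)[of 0] u.A v.A by auto
    then show "integrable lborel (\<lambda>x. 9 / 8 * norm (V 0 x) powr q)" "integrable lborel (\<lambda>x. 1 / 8 * norm (U 0 x) powr p)"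
      using q_gt_1 p_ge_2 by (auto intro!: integrable_mult_right gbounded_powr_integrable)
  qed auto
  finally have "K * \<Phi> 0 \<le> K * (9 / 8 * (LBINT x. norm (V 0 x) powr q) + 1 / 8 * (LBINT x. norm (U 0 x) powr p))"
    using K by (intro mult_left_mono) auto
  with * show ?thesis unfolding K_def by (rule order_trans)
qed

end

section \<open>Flows generated by the square roots of shifted harmonic oscillators\<close>

definition rate :: "real \<Rightarrow> nat ^ 'd \<Rightarrow> real" where
  "rate c n = sqrt (hermite_eigenvalue n + c)"

lemma hermite_eigenvalue_ge: "real CARD('d) \<le> hermite_eigenvalue (n :: nat ^ 'd)"
  by (simp add: hermite_eigenvalue_def sum_nonneg)

lemma hermite_eigenvalue_0: "hermite_eigenvalue (0 :: nat ^ 'd) = real CARD('d)"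
  by (simp add: hermite_eigenvalue_def)

lemma hermite_eigenvalue_hset: "hermite_eigenvalue (hset n i (Suc (n $ i))) = hermite_eigenvalue n + 2"
proof -
  have "(\<Sum>j\<in>UNIV. hset n i (Suc (n $ i)) $ j) = (\<Sum>j\<in>UNIV. n $ j + (if j = i then 1 else 0))"
    by (intro sum.cong) auto
  also have "\<dots> = (\<Sum>j\<in>UNIV. n $ j) + 1" by (simp add: sum.distrib)
  finally show ?thesis by (simp add: hermite_eigenvalue_def)
qed

lemma
  fixes n :: "nat ^ 'd"
  shows rate_pos: "0 \<le> c \<Longrightarrow> 0 < rate c n"
    and rate_ge: "rate c (0 :: nat ^ 'd) \<le> rate c n"
    and rate_square: "0 \<le> c \<Longrightarrow> (rate c n)\<^sup>2 = hermite_eigenvalue n + c"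
proof -
  have "0 < real CARD('d)" by simp
  then have "0 < hermite_eigenvalue n" using hermite_eigenvalue_ge[of n] by linarith
  then show "0 \<le> c \<Longrightarrow> 0 < rate c n" "0 \<le> c \<Longrightarrow> (rate c n)\<^sup>2 = hermite_eigenvalue n + c"
    by (simp_all add: rate_def)
  show "rate c (0 :: nat ^ 'd) \<le> rate c n"
    using hermite_eigenvalue_ge[of n] by (simp add: rate_def hermite_eigenvalue_0)
qed

text \<open>For j = 0 and the Hermite functions as \<phi> this is exp(- t (L + c)^(1/2)) applied to
  the expansion with vector coefficients a. The index j counts time derivatives, and \<phi> can be
  replaced by the space derivatives of the Hermite functions.\<close>

definition flow :: "nat \<Rightarrow> (nat ^ 'd \<Rightarrow> real ^ 'd \<Rightarrow> real) \<Rightarrow> real \<Rightarrow> (nat ^ 'd) set \<Rightarrow>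
    (nat ^ 'd \<Rightarrow> 'a::euclidean_space) \<Rightarrow> real \<Rightarrow> real ^ 'd \<Rightarrow> 'a" where
  "flow j \<phi> c N a t x = (\<Sum>n\<in>N. ((- rate c n) ^ j * exp (- rate c n * t) * \<phi> n x) *\<^sub>R a n)"

lemma flow_deriv: "((\<lambda>t. flow j \<phi> c N a t x) has_vector_derivative flow (Suc j) \<phi> c N a t x) (at t)"
proof -
  have "((\<lambda>t. ((- rate c n) ^ j * exp (- rate c n * t) * \<phi> n x) *\<^sub>R a n) has_vector_derivative
      (((- rate c n) ^ j * exp (- rate c n * t) * \<phi> n x) *\<^sub>R 0
        + ((- rate c n) ^ Suc j * exp (- rate c n * t) * \<phi> n x) *\<^sub>R a n)) (at t)" for n
    by (intro has_vector_derivative_scaleR has_vector_derivative_const)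
       (auto intro!: derivative_eq_intros)
  then show ?thesis unfolding flow_def by (intro has_vector_derivative_sum) simp
qed

lemma flow_axis_deriv:
  assumes "\<And>n. ((\<lambda>s. \<phi> n (x + s *\<^sub>R e)) has_real_derivative \<phi>' n (x + s *\<^sub>R e)) (at s)"
  shows "((\<lambda>s. flow j \<phi> c N a t (x + s *\<^sub>R e)) has_vector_derivative flow j \<phi>' c N a t (x + s *\<^sub>R e)) (at s)"
proof -
  have "((\<lambda>s. ((- rate c n) ^ j * exp (- rate c n * t) * \<phi> n (x + s *\<^sub>R e)) *\<^sub>R a n) has_vector_derivative
      (((- rate c n) ^ j * exp (- rate c n * t) * \<phi> n (x + s *\<^sub>R e)) *\<^sub>R 0
        + ((- rate c n) ^ j * exp (- rate c n * t) * \<phi>' n (x + s *\<^sub>R e)) *\<^sub>R a n)) (at s)" for n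
    by (intro has_vector_derivative_scaleR has_vector_derivative_const DERIV_cmult assms)
  then show ?thesis unfolding flow_def by (intro has_vector_derivative_sum) simp
qed

lemma flow_meas:
  assumes [measurable]: "\<And>n. \<phi> n \<in> borel_measurable borel"
  shows "flow j \<phi> c N a t \<in> borel_measurable borel"
  unfolding flow_def[abs_def] by measurable

text \<open>Every mode decays at least as fast as the ground state; that t may be negative down to
  -1 costs a factor exp(rate n - rate 0) per mode. Stating the bound for all large A lets one
  constant serve finitely many such bounds.\<close>

lemma flow_decay:
  fixes a :: "nat ^ 'd \<Rightarrow> 'a::euclidean_space"
  assumes N: "finite N" and c: "0 \<le> c" and \<phi>: "\<And>n. gbounded (\<phi> n)"
  shows "eventually (\<lambda>A. \<forall>t>-1. \<forall>x. norm (flow j \<phi> c N a t x) \<le>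
     A * exp (- (3 / 8) * (norm x)\<^sup>2) * exp (- rate c (0 :: nat ^ 'd) * t)) at_top"
proof -
  obtain C where C: "\<And>n. 0 < C n" "\<And>n x. \<bar>\<phi> n x\<bar> \<le> C n * exp (- (3 / 8) * (norm x)\<^sup>2)"
    using \<phi> unfolding gbounded_def by metis
  let ?\<nu> = "rate c (0 :: nat ^ 'd)"
  define A0 where "A0 = (\<Sum>n\<in>N. rate c n ^ j * exp (rate c n - ?\<nu>) * C n * norm (a n))"
  have *: "norm (flow j \<phi> c N a t x) \<le> A0 * exp (- (3 / 8) * (norm x)\<^sup>2) * exp (- ?\<nu> * t)" if t: "- 1 < t" for t x
  proof -
    let ?E = "exp (- (3 / 8) * (norm x)\<^sup>2)"
    have "norm (flow j \<phi> c N a t x) \<le> (\<Sum>n\<in>N. norm (((- rate c n) ^ j * exp (- rate c n * t) * \<phi> n x) *\<^sub>R a n))"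
      unfolding flow_def by (rule norm_sum)
    also have "\<dots> \<le> (\<Sum>n\<in>N. rate c n ^ j * (exp (rate c n - ?\<nu>) * exp (- ?\<nu> * t)) * (C n * ?E) * norm (a n))"
    proof (rule sum_mono)
      fix n :: "nat ^ 'd"
      have "0 \<le> (rate c n - ?\<nu>) * (t + 1)" using rate_ge[of c n] t by (intro mult_nonneg_nonneg) auto
      then have e: "exp (- rate c n * t) \<le> exp (rate c n - ?\<nu>) * exp (- ?\<nu> * t)"
        by (simp add: algebra_simps flip: exp_add)
      show "norm (((- rate c n) ^ j * exp (- rate c n * t) * \<phi> n x) *\<^sub>R a n)
        \<le> rate c n ^ j * (exp (rate c n - ?\<nu>) * exp (- ?\<nu> * t)) * (C n * ?E) * norm (a n)"
        unfolding norm_scaleR abs_mult power_abs using rate_pos[OF c, of n] e C[of n]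
        by (intro mult_mono mult_nonneg_nonneg) auto
    qed
    also have "\<dots> = A0 * ?E * exp (- ?\<nu> * t)"
      by (simp add: A0_def sum_distrib_left sum_distrib_right ac_simps)
    finally show ?thesis .
  qed
  show ?thesis
    using eventually_ge_at_top[of A0]
  proof eventually_elim
    case (elim A)
    have "A0 * exp (- (3 / 8) * (norm x)\<^sup>2) * exp (- ?\<nu> * t) \<le> A * exp (- (3 / 8) * (norm x)\<^sup>2) * exp (- ?\<nu> * t)"
      for t and x :: "real ^ 'd"
      using elim by (intro mult_right_mono) auto
    with * show ?case using order_trans by blast
  qed
qed

text \<open>Two time derivatives bring in the eigenvalue plus c, the Laplacian brings in |x|^2 minus
  the eigenvalue, so the eigenvalue drops out in every mode.\<close>

lemma flow_pde:
  assumes c: "0 \<le> c"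
  shows "flow 2 hermite_fun c N a t x + (\<Sum>i\<in>UNIV. flow 0 (hermite_dd i) c N a t x)
    = ((norm x)\<^sup>2 + c) *\<^sub>R flow 0 hermite_fun c N a t x"
proof -
  have "(\<Sum>i\<in>UNIV. flow 0 (hermite_dd i) c N a t x)
      = (\<Sum>n\<in>N. (exp (- rate c n * t) * (\<Sum>i\<in>UNIV. hermite_dd i n x)) *\<^sub>R a n)"
    unfolding flow_def by (subst sum.swap) (simp add: sum_distrib_left scaleR_sum_left)
  then have "flow 2 hermite_fun c N a t x + (\<Sum>i\<in>UNIV. flow 0 (hermite_dd i) c N a t x)
     = (\<Sum>n\<in>N. ((rate c n)\<^sup>2 * exp (- rate c n * t) * hermite_fun n x
          + exp (- rate c n * t) * (((norm x)\<^sup>2 - hermite_eigenvalue n) * hermite_fun n x)) *\<^sub>R a n)"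
    unfolding sum_hermite_dd by (simp add: flow_def sum.distrib scaleR_add_left)
  also have "\<dots> = (\<Sum>n\<in>N. (((norm x)\<^sup>2 + c) * (exp (- rate c n * t) * hermite_fun n x)) *\<^sub>R a n)"
    unfolding rate_square[OF c] by (intro sum.cong) (auto simp: algebra_simps)
  finally show ?thesis by (simp add: flow_def scaleR_sum_right)
qed

lemma flow_hflow:
  fixes a :: "nat ^ 'd \<Rightarrow> 'a::euclidean_space"
  assumes N: "finite N" and c: "0 \<le> c" and nz: "\<And>t x. flow 0 hermite_fun c N a t x \<noteq> 0"
  obtains A where "hflow (flow 0 hermite_fun c N a) (flow 1 hermite_fun c N a) (flow 2 hermite_fun c N a)
    (\<lambda>i. flow 0 (hermite_d i) c N a) (\<lambda>i. flow 0 (hermite_dd i) c N a) c A (rate c (0 :: nat ^ 'd))"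
proof -
  let ?P = "\<lambda>A j \<phi>. \<forall>t>-1. \<forall>x. norm (flow j \<phi> c N a t x) \<le>
     A * exp (- (3 / 8) * (norm x)\<^sup>2) * exp (- rate c (0 :: nat ^ 'd) * t)"
  have "eventually (\<lambda>A. 0 < A \<and> ?P A 0 hermite_fun \<and> ?P A 1 hermite_fun \<and> ?P A 2 hermite_fun
    \<and> (\<forall>i\<in>UNIV. ?P A 0 (hermite_d i)) \<and> (\<forall>i\<in>UNIV. ?P A 0 (hermite_dd i))) at_top"
    by (intro eventually_conj eventually_ball_finite ballI flow_decay N c eventually_gt_at_top
        gbounded_hermite gbounded_hermite_d gbounded_hermite_dd finite_class.finite_UNIV)
  then obtain A where A: "0 < A" "?P A 0 hermite_fun" "?P A 1 hermite_fun" "?P A 2 hermite_fun"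
    "\<And>i. ?P A 0 (hermite_d i)" "\<And>i. ?P A 0 (hermite_dd i)"
    by (auto dest!: eventually_happens'[OF trivial_limit_at_top_linorder])
  show thesis
  proof (rule that[of A], unfold_locales)
    show "((\<lambda>t. flow 1 hermite_fun c N a t x) has_vector_derivative flow 2 hermite_fun c N a t x) (at t)" for t x
      using flow_deriv[of 1 hermite_fun c N a x t] by (simp add: numeral_2_eq_2)
    show "((\<lambda>t. flow 0 hermite_fun c N a t x) has_vector_derivative flow 1 hermite_fun c N a t x) (at t)" for t x
      using flow_deriv[of 0 hermite_fun c N a x t] by simp
  qed (use A c nz rate_pos[OF c] flow_pde[OF c] in
      \<open>auto intro!: flow_axis_deriv hermite_fun_deriv_axis hermite_d_deriv_axis flow_meas\<close>)
qed

text \<open>A further component, a small multiple of the ground state, keeps the flow away from the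
  singular set of the Bellman function.\<close>

definition aug :: "(nat ^ 'd) set \<Rightarrow> (nat ^ 'd \<Rightarrow> 'a::real_vector) \<Rightarrow> real \<Rightarrow> nat ^ 'd \<Rightarrow> 'a \<times> real" where
  "aug N a \<epsilon> n = (if n \<in> N then a n else 0, if n = 0 then \<epsilon> else 0)"

lemma flow_aug:
  fixes \<phi> :: "nat ^ 'd \<Rightarrow> real ^ 'd \<Rightarrow> real"
  assumes N: "finite N"
  shows "flow j \<phi> c (insert 0 N) (aug N a \<epsilon>) t x =
    (flow j \<phi> c N a t x, (- rate c (0 :: nat ^ 'd)) ^ j * exp (- rate c (0 :: nat ^ 'd) * t) * \<phi> 0 x * \<epsilon>)"
proof (rule prod_eqI)
  let ?f = "\<lambda>n. (- rate c n) ^ j * exp (- rate c n * t) * \<phi> n x"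
  have "fst (flow j \<phi> c (insert 0 N) (aug N a \<epsilon>) t x) = (\<Sum>n\<in>insert 0 N. ?f n *\<^sub>R (if n \<in> N then a n else 0))"
    unfolding flow_def fst_sum by (simp add: aug_def)
  also have "\<dots> = (\<Sum>n\<in>N. ?f n *\<^sub>R a n)"
    using N by (intro sum.mono_neutral_cong_right) auto
  finally show "fst (flow j \<phi> c (insert 0 N) (aug N a \<epsilon>) t x) =
      fst (flow j \<phi> c N a t x, (- rate c (0 :: nat ^ 'd)) ^ j * exp (- rate c (0 :: nat ^ 'd) * t) * \<phi> 0 x * \<epsilon>)" by (simp add: flow_def)
  have "snd (flow j \<phi> c (insert 0 N) (aug N a \<epsilon>) t x) = (\<Sum>n\<in>insert 0 N. ?f n *\<^sub>R (if n = 0 then \<epsilon> else 0))"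
    unfolding flow_def snd_sum by (simp add: aug_def)
  also have "\<dots> = (\<Sum>n\<in>insert 0 N. if n = 0 then ?f 0 * \<epsilon> else 0)" by (intro sum.cong) auto
  also have "\<dots> = ?f 0 * \<epsilon>" using N by (subst sum.delta) auto
  finally show "snd (flow j \<phi> c (insert 0 N) (aug N a \<epsilon>) t x) =
      snd (flow j \<phi> c N a t x, (- rate c (0 :: nat ^ 'd)) ^ j * exp (- rate c (0 :: nat ^ 'd) * t) * \<phi> 0 x * \<epsilon>)" by simp
qed

lemma hermite_fun_0: "hermite_fun 0 x = hnorm 0 ^ CARD('d) * exp (- (1 / 2) * (norm x)\<^sup>2)" for x :: "real ^ 'd"
  by (simp add: hermite_fun_def hermite_fun1_eq prod.distrib exp_sum[symmetric] norm_vec_square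
      sum_negf sum_distrib_left sum_divide_distrib)

text \<open>The last component alone is a multiple of the ground state. It decays at the slowest
  rate present, so this lower bound and the upper one of \<open>flow_decay\<close> have the same
  exponential in time.\<close>

lemma flow_aug_lower:
  fixes a :: "nat ^ 'd \<Rightarrow> 'a::euclidean_space"
  assumes N: "finite N" and \<epsilon>: "0 < \<epsilon>"
  shows "hnorm 0 ^ CARD('d) * \<epsilon> * exp (- (1 / 2) * (norm x)\<^sup>2) * exp (- rate c (0 :: nat ^ 'd) * t)
      \<le> norm (flow 0 hermite_fun c (insert 0 N) (aug N a \<epsilon>) t x)" (is "?l \<le> _")
    and "flow 0 hermite_fun c (insert 0 N) (aug N a \<epsilon>) t x \<noteq> 0"
proof -
  have l: "?l = exp (- rate c (0 :: nat ^ 'd) * t) * hermite_fun 0 x * \<epsilon>"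
    by (simp add: hermite_fun_0)
  have pos: "0 < ?l" using \<epsilon> hnorm_pos by simp
  have "?l \<le> norm (snd (flow 0 hermite_fun c (insert 0 N) (aug N a \<epsilon>) t x))"
    unfolding flow_aug[OF N] l by simp
  also have "\<dots> \<le> norm (flow 0 hermite_fun c (insert 0 N) (aug N a \<epsilon>) t x)"
    using norm_snd_le[of "snd (flow 0 hermite_fun c (insert 0 N) (aug N a \<epsilon>) t x)"] by (metis prod.collapse)
  finally show "?l \<le> norm (flow 0 hermite_fun c (insert 0 N) (aug N a \<epsilon>) t x)" .
  with pos show "flow 0 hermite_fun c (insert 0 N) (aug N a \<epsilon>) t x \<noteq> 0" by auto
qed

definition energy :: "real \<Rightarrow> (nat ^ 'd) set \<Rightarrow> (nat ^ 'd \<Rightarrow> 'a::euclidean_space) \<Rightarrow> real \<Rightarrow> real ^ 'd \<Rightarrow> real" where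
  "energy c N a t x = flow 1 hermite_fun c N a t x \<bullet> flow 1 hermite_fun c N a t x
    + (\<Sum>i\<in>UNIV. flow 0 (hermite_d i) c N a t x \<bullet> flow 0 (hermite_d i) c N a t x)
    + (norm x)\<^sup>2 * (flow 0 hermite_fun c N a t x \<bullet> flow 0 hermite_fun c N a t x)"

lemma energy_nonneg: "0 \<le> energy c N a t x"
  unfolding energy_def by (intro add_nonneg_nonneg sum_nonneg mult_nonneg_nonneg) auto

lemma energy_aug: "finite N \<Longrightarrow> energy c N a t x \<le> energy c (insert 0 N) (aug N a \<epsilon>) t x"
  unfolding energy_def by (intro add_mono sum_mono mult_left_mono) (auto simp: flow_aug inner_prod_def)

text \<open>Augmenting the coefficients only increases the energies, so a bound on \<psi> by the
  original ones suffices. Both integrals receive the larger weight 9/8, and 12 times 9/8 is 27/2.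
  Shifts and value spaces are arbitrary for both flows, which allows f and g to exchange their
  places.\<close>

theorem flow_pair_bound:
  fixes a :: "nat ^ 'd \<Rightarrow> 'a::euclidean_space" and a' :: "nat ^ 'd \<Rightarrow> 'b::euclidean_space"
  assumes p: "2 \<le> p" "q = p / (p - 1)" and N: "finite N" "finite N'" and c: "0 \<le> c" "0 \<le> c'" and \<epsilon>: "0 < \<epsilon>"
    and \<Psi>: "\<And>t. - 1 < t \<Longrightarrow> (\<Psi> has_real_derivative \<Psi>1 t) (at t)"
    and \<Psi>1: "\<And>t. - 1 < t \<Longrightarrow> (\<Psi>1 has_real_derivative (LBINT x. \<psi> t x)) (at t)"
    and int: "\<And>t. - 1 < t \<Longrightarrow> integrable lborel (\<psi> t)"
    and \<psi>: "\<And>t x. - 1 < t \<Longrightarrow> (\<psi> t x)\<^sup>2 \<le> 36 * (energy c N a t x * energy c' N' a' t x)"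
    and lim: "(\<Psi> \<longlongrightarrow> 0) at_top"
  shows "\<bar>\<Psi> 0\<bar> \<le> 27 / 2 * (p - 1) *
    ((LBINT x. norm (flow 0 hermite_fun c N a 0 x, \<epsilon> * hermite_fun 0 x) powr p) +
     (LBINT x. norm (flow 0 hermite_fun c' N' a' 0 x, \<epsilon> * hermite_fun 0 x) powr q))"
proof -
  let ?N = "insert 0 N" and ?a = "aug N a \<epsilon>" and ?N' = "insert 0 N'" and ?a' = "aug N' a' \<epsilon>"
  obtain A where "hflow (flow 0 hermite_fun c ?N ?a) (flow 1 hermite_fun c ?N ?a) (flow 2 hermite_fun c ?N ?a)
    (\<lambda>i. flow 0 (hermite_d i) c ?N ?a) (\<lambda>i. flow 0 (hermite_dd i) c ?N ?a) c A (rate c (0 :: nat ^ 'd))"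
    using flow_hflow[OF finite.insertI[OF N(1)] c(1) flow_aug_lower(2)[OF N(1) \<epsilon>]] by blast
  then interpret u: hflow "flow 0 hermite_fun c ?N ?a" "flow 1 hermite_fun c ?N ?a" "flow 2 hermite_fun c ?N ?a"
    "\<lambda>i. flow 0 (hermite_d i) c ?N ?a" "\<lambda>i. flow 0 (hermite_dd i) c ?N ?a" c A "rate c (0 :: nat ^ 'd)" .
  obtain A' where "hflow (flow 0 hermite_fun c' ?N' ?a') (flow 1 hermite_fun c' ?N' ?a') (flow 2 hermite_fun c' ?N' ?a')
    (\<lambda>i. flow 0 (hermite_d i) c' ?N' ?a') (\<lambda>i. flow 0 (hermite_dd i) c' ?N' ?a') c' A' (rate c' (0 :: nat ^ 'd))"
    using flow_hflow[OF finite.insertI[OF N(2)] c(2) flow_aug_lower(2)[OF N(2) \<epsilon>]] by blast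
  then interpret v: hflow "flow 0 hermite_fun c' ?N' ?a'" "flow 1 hermite_fun c' ?N' ?a'" "flow 2 hermite_fun c' ?N' ?a'"
    "\<lambda>i. flow 0 (hermite_d i) c' ?N' ?a'" "\<lambda>i. flow 0 (hermite_dd i) c' ?N' ?a'" c' A' "rate c' (0 :: nat ^ 'd)" .
  interpret bellman p q by unfold_locales (use p in auto)
  interpret bellman_flow p q "flow 0 hermite_fun c ?N ?a" "flow 1 hermite_fun c ?N ?a" "flow 2 hermite_fun c ?N ?a"
    "\<lambda>i. flow 0 (hermite_d i) c ?N ?a" "\<lambda>i. flow 0 (hermite_dd i) c ?N ?a" c A "rate c (0 :: nat ^ 'd)"
    "flow 0 hermite_fun c' ?N' ?a'" "flow 1 hermite_fun c' ?N' ?a'" "flow 2 hermite_fun c' ?N' ?a'"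
    "\<lambda>i. flow 0 (hermite_d i) c' ?N' ?a'" "\<lambda>i. flow 0 (hermite_dd i) c' ?N' ?a'" c' A' "rate c' (0 :: nat ^ 'd)"
    "hnorm 0 ^ CARD('d) * \<epsilon>"
    by unfold_locales (use \<epsilon> hnorm_pos flow_aug_lower(1)[OF N(2) \<epsilon>] in auto)
  have "\<bar>\<Psi> 0\<bar> \<le> 12 / (q - 1) *
    (9 / 8 * (LBINT x. norm (flow 0 hermite_fun c' ?N' ?a' 0 x) powr q)
      + 1 / 8 * (LBINT x. norm (flow 0 hermite_fun c ?N ?a 0 x) powr p))"
  proof (rule flow_bound[OF \<Psi> \<Psi>1 int _ lim])
    fix t :: real and x assume t: "- 1 < t"
    have "energy c N a t x * energy c' N' a' t x \<le> energy c ?N ?a t x * energy c' ?N' ?a' t x"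
      by (intro mult_mono energy_aug N energy_nonneg)
    then show "(\<psi> t x)\<^sup>2 \<le> 36 * (u.energy t x * v.energy t x)"
      using \<psi>[OF t, of x] unfolding u.energy_def v.energy_def energy_def by linarith
  qed
  also have "12 / (q - 1) = 12 * (p - 1)"
  proof -
    have "(p - 1) * (q - 1) = 1" by (rule pq)
    then show ?thesis using q_gt_1 by (simp add: field_simps)
  qed
  also have "12 * (p - 1) * (9 / 8 * (LBINT x. norm (flow 0 hermite_fun c' ?N' ?a' 0 x) powr q)
      + 1 / 8 * (LBINT x. norm (flow 0 hermite_fun c ?N ?a 0 x) powr p))
    \<le> 12 * (p - 1) * (9 / 8 * ((LBINT x. norm (flow 0 hermite_fun c ?N ?a 0 x) powr p)
      + (LBINT x. norm (flow 0 hermite_fun c' ?N' ?a' 0 x) powr q)))"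
    using p by (intro mult_left_mono) (auto simp: integral_nonneg_AE)
  also have "12 * (p - 1) * (9 / 8 * Z) = 27 / 2 * (p - 1) * Z" for Z :: real by simp
  finally have *: "\<bar>\<Psi> 0\<bar> \<le> 27 / 2 * (p - 1) *
    ((LBINT x. norm (flow 0 hermite_fun c ?N ?a 0 x) powr p)
      + (LBINT x. norm (flow 0 hermite_fun c' ?N' ?a' 0 x) powr q))" .
  have e: "flow 0 hermite_fun c ?N ?a 0 x = (flow 0 hermite_fun c N a 0 x, \<epsilon> * hermite_fun 0 x)" for x
    by (simp add: flow_aug N mult.commute)
  have e': "flow 0 hermite_fun c' ?N' ?a' 0 x = (flow 0 hermite_fun c' N' a' 0 x, \<epsilon> * hermite_fun 0 x)" for x
    by (simp add: flow_aug N mult.commute)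
  from * show ?thesis unfolding e e' .
qed

section \<open>The bilinear estimate\<close>

definition hdelta :: "'d \<Rightarrow> nat ^ 'd \<Rightarrow> real ^ 'd \<Rightarrow> real" where
  "hdelta i n x = 2 * ha (Suc (n $ i)) * hermite_fun (hset n i (Suc (n $ i))) x"

text \<open>The raised form gives integrals through orthonormality; this form is the one that the
  energy bounds.\<close>

lemma hdelta_eq: "hdelta i n x = x $ i * hermite_fun n x - hermite_d i n x"
  by (simp add: hdelta_def hermite_fun_mult hermite_d_def)

lemma hdelta_meas [measurable]: "hdelta i n \<in> borel_measurable borel"
  unfolding hdelta_def[abs_def] by measurable

lemma gbounded_hdelta: "gbounded (hdelta i n)"
  unfolding hdelta_def[abs_def] by (intro gbounded_cmult gbounded_hermite)

lemma riesz_star_component_eq: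
  assumes "finite N"
  shows "riesz_star_component i (\<lambda>x. \<Sum>n\<in>N. c n * hermite_fun n x) x = (\<Sum>n\<in>N. 1 / rate 2 n * c n * hdelta i n x)"
proof -
  have L2: "L2_inner (\<lambda>x. \<Sum>n\<in>N. c n * hermite_fun n x) (hermite_fun m) = (if m \<in> N then c m else 0)" for m
  proof -
    have "L2_inner (\<lambda>x. \<Sum>n\<in>N. c n * hermite_fun n x) (hermite_fun m)
        = (LBINT x. (\<Sum>n\<in>N. c n * (hermite_fun n x * hermite_fun m x)))"
      by (subst L2_inner_lborel) (auto simp: sum_distrib_right mult.assoc)
    also have "\<dots> = (\<Sum>n\<in>N. c n * (LBINT x. hermite_fun n x * hermite_fun m x))"
      by (subst Bochner_Integration.integral_sum)
         (auto intro!: gbounded_mult_integrable gbounded_hermite)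
    also have "\<dots> = (\<Sum>n\<in>N. if n = m then c m else 0)"
      unfolding hermite_orthonormal by (intro sum.cong) auto
    also have "\<dots> = (if m \<in> N then c m else 0)" using assms by (subst sum.delta) auto
    finally show ?thesis .
  qed
  have r: "(hermite_eigenvalue n + 2) powr (- 1 / 2) = 1 / rate 2 n" for n :: "nat ^ 'b"
    using powr_minus_divide[of "hermite_eigenvalue n + 2" "1 / 2"] hermite_eigenvalue_ge[of n]
    by (simp add: rate_def powr_half_sqrt)
  have "riesz_star_component i (\<lambda>x. \<Sum>n\<in>N. c n * hermite_fun n x) x
      = (\<Sum>\<^sub>\<infinity>n\<in>N. 1 / rate 2 n * c n * hdelta i n x)"
    unfolding riesz_star_component_def delta_star_hermite L2 r
    by (rule infsum_cong_neutral) (auto simp: hdelta_def)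
  then show ?thesis using assms by simp
qed

context
  fixes N M :: "(nat ^ 'd) set" and c :: "nat ^ 'd \<Rightarrow> real" and d :: "nat ^ 'd \<Rightarrow> real ^ 'd"
  assumes N: "finite N" and M: "finite M"
begin

definition hf where "hf x = (\<Sum>n\<in>N. c n * hermite_fun n x)"
definition hg where "hg x = (\<Sum>m\<in>M. hermite_fun m x *\<^sub>R d m)"

definition pairing :: "nat ^ 'd \<Rightarrow> nat ^ 'd \<Rightarrow> 'd \<Rightarrow> real" where
  "pairing n m i = (LBINT x. hdelta i n x * hermite_fun m x)"

text \<open>delta_i^* raises the eigenvalue by 2, so a nonzero pairing forces the eigenvalue of m to
  be that of n plus 2. With the shift by 2 on one side only, this says that the rates are
  equal.\<close>

lemma pairing_eq_0: "rate 2 n \<noteq> rate 0 m \<Longrightarrow> pairing n m i = 0"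
proof -
  assume *: "rate 2 n \<noteq> rate 0 m"
  have "hset n i (Suc (n $ i)) \<noteq> m"
    using * hermite_eigenvalue_hset[of n i] by (auto simp: rate_def)
  moreover have "pairing n m i = 2 * ha (Suc (n $ i)) *
      (LBINT x. hermite_fun (hset n i (Suc (n $ i))) x * hermite_fun m x)"
    unfolding pairing_def hdelta_def mult.assoc by simp
  ultimately show ?thesis by (simp add: hermite_orthonormal)
qed

text \<open>\<open>psi 0 t\<close> pairs \<open>R\<^sup>* f\<close> with \<open>g\<close> after both have been carried along their flows for the time \<open>t\<close>.
  A summand survives only if its two rates agree, which turns the second derivative \<open>psi 2 t\<close> into the
  integral of \<open>- 4 \<Sum>\<^sub>i \<delta>\<^sub>i\<^sup>* F \<cdot> \<partial>\<^sub>t G\<^sub>i\<close>, the function \<open>kern t\<close>.\<close>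

definition psi where
  "psi k t = (\<Sum>i\<in>UNIV. \<Sum>n\<in>N. \<Sum>m\<in>M. (1 / rate 2 n * c n * (d m $ i) * pairing n m i) *
     ((- (rate 2 n + rate 0 m)) ^ k * exp (- (rate 2 n + rate 0 m) * t)))"

lemma psi_deriv: "(psi k has_real_derivative psi (Suc k) t) (at t)"
proof -
  have "((\<lambda>t. r ^ k * exp (r * t)) has_real_derivative r ^ Suc k * exp (r * t)) (at t)" for r :: real
    by (auto intro!: derivative_eq_intros)
  then show ?thesis unfolding psi_def[abs_def] by (intro DERIV_sum DERIV_cmult) auto
qed

lemma psi_tendsto: "(psi 0 \<longlongrightarrow> 0) at_top"
proof -
  have "((\<lambda>t. exp (- (rate 2 n + rate 0 m) * t)) \<longlongrightarrow> 0) at_top" for n m :: "nat ^ 'd"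
  proof -
    have "0 < rate 2 n + rate 0 m" using rate_pos[of 2 n] rate_pos[of 0 m] by simp
    then show ?thesis by real_asymp
  qed
  then have "((\<lambda>t. \<Sum>i\<in>UNIV. \<Sum>n\<in>N. \<Sum>m\<in>M. (1 / rate 2 n * c n * (d m $ i) * pairing n m i) *
     exp (- (rate 2 n + rate 0 m) * t)) \<longlongrightarrow> 0) at_top"
    by (intro tendsto_null_sum tendsto_mult_right_zero)
  then show ?thesis unfolding psi_def[abs_def] by simp
qed

lemma integral_pairing:
  fixes \<alpha> \<beta> :: "nat ^ 'd \<Rightarrow> real"
  shows "integrable lborel (\<lambda>x. \<Sum>i\<in>UNIV. (\<Sum>n\<in>N. \<alpha> n * hdelta i n x) * ((\<Sum>m\<in>M. (\<beta> m * hermite_fun m x) *\<^sub>R d m) $ i))"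
    and "(LBINT x. (\<Sum>i\<in>UNIV. (\<Sum>n\<in>N. \<alpha> n * hdelta i n x) * ((\<Sum>m\<in>M. (\<beta> m * hermite_fun m x) *\<^sub>R d m) $ i)))
     = (\<Sum>i\<in>UNIV. \<Sum>n\<in>N. \<Sum>m\<in>M. \<alpha> n * \<beta> m * (d m $ i) * pairing n m i)"
proof -
  have e: "(\<Sum>i\<in>UNIV. (\<Sum>n\<in>N. \<alpha> n * hdelta i n x) * ((\<Sum>m\<in>M. (\<beta> m * hermite_fun m x) *\<^sub>R d m) $ i))
    = (\<Sum>i\<in>UNIV. \<Sum>n\<in>N. \<Sum>m\<in>M. (\<alpha> n * \<beta> m * (d m $ i)) * (hdelta i n x * hermite_fun m x))" for x
    by (simp add: sum_product ac_simps)
  have i: "integrable lborel (\<lambda>x. hdelta i n x * hermite_fun m x)" for i n m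
    by (intro gbounded_mult_integrable gbounded_hdelta gbounded_hermite) auto
  show "integrable lborel (\<lambda>x. \<Sum>i\<in>UNIV. (\<Sum>n\<in>N. \<alpha> n * hdelta i n x) * ((\<Sum>m\<in>M. (\<beta> m * hermite_fun m x) *\<^sub>R d m) $ i))"
    unfolding e by (intro Bochner_Integration.integrable_sum integrable_mult_right i)
  show "(LBINT x. (\<Sum>i\<in>UNIV. (\<Sum>n\<in>N. \<alpha> n * hdelta i n x) * ((\<Sum>m\<in>M. (\<beta> m * hermite_fun m x) *\<^sub>R d m) $ i)))
     = (\<Sum>i\<in>UNIV. \<Sum>n\<in>N. \<Sum>m\<in>M. \<alpha> n * \<beta> m * (d m $ i) * pairing n m i)"
    unfolding e pairing_def
    by (intro has_bochner_integral_integral_eq has_bochner_integral_sum has_bochner_integral_mult_right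
        has_bochner_integral_integrable i)
qed

lemma psi_0: "psi 0 0 = (LBINT x. riesz_star hf x \<bullet> hg x)"
proof -
  have "riesz_star hf x \<bullet> hg x = (\<Sum>i\<in>UNIV. (\<Sum>n\<in>N. (1 / rate 2 n * c n) * hdelta i n x) *
      ((\<Sum>m\<in>M. (1 * hermite_fun m x) *\<^sub>R d m) $ i))" for x
    unfolding inner_vec_def hf_def[abs_def] hg_def riesz_star_def
    by (simp add: riesz_star_component_eq[OF N])
  then show ?thesis
    using integral_pairing(2)[of "\<lambda>n. 1 / rate 2 n * c n" "\<lambda>_. 1"] by (simp add: psi_def)
qed

abbreviation F where "F j \<phi> \<equiv> flow j \<phi> 2 N c"
abbreviation G where "G j \<phi> \<equiv> flow j \<phi> 0 M d"

definition kern where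
  "kern t x = (\<Sum>i\<in>UNIV. (\<Sum>n\<in>N. (- 4 * exp (- rate 2 n * t) * c n) * hdelta i n x) * 
    ((\<Sum>m\<in>M. ((- rate 0 m * exp (- rate 0 m * t)) * hermite_fun m x) *\<^sub>R d m) $ i))"

lemma kern_integral: "integrable lborel (kern t)" "(LBINT x. kern t x) = psi 2 t"
proof -
  show "integrable lborel (kern t)" unfolding kern_def[abs_def] by (rule integral_pairing(1))
  \<comment> \<open>For equal rates \<rho> both sides have the factor (1 / \<rho>) (2 \<rho>)^2 = 4
    \<rho> = (- 4) (- \<rho>); for different rates the pairing vanishes.\<close>
  have "(- 4 * exp (- rate 2 n * t) * c n) * (- rate 0 m * exp (- rate 0 m * t)) * (d m $ i) * pairing n m i
     = (1 / rate 2 n * c n * (d m $ i) * pairing n m i) *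
     ((- (rate 2 n + rate 0 m))\<^sup>2 * exp (- (rate 2 n + rate 0 m) * t))" for n m i
  proof (cases "rate 2 n = rate 0 m")
    case True
    have "rate 0 m \<noteq> 0" using rate_pos[of 0 m] by simp
    then show ?thesis unfolding True
      by (simp add: power2_eq_square algebra_simps flip: exp_add)
  qed (simp add: pairing_eq_0)
  then show "(LBINT x. kern t x) = psi 2 t"
    unfolding kern_def[abs_def] by (subst integral_pairing(2)) (simp only: psi_def)
qed

text \<open>Cauchy-Schwarz over i separates delta_i^* F from the time derivative of G. The square of
  the factor 4 and (a - b)^2 \<le> 2 a^2 + 2 b^2 give 32, which is rounded up to the square
  36.\<close>

lemma kern_bound: "(kern t x)\<^sup>2 \<le> 36 * (energy 2 N c t x * energy 0 M d t x)"
proof -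
  define a where "a i = x $ i * F 0 hermite_fun t x - F 0 (hermite_d i) t x" for i
  have "kern t x = (\<Sum>i\<in>UNIV. (- 4 * a i) * (G 1 hermite_fun t x $ i))"
    unfolding kern_def a_def
    by (intro sum.cong refl arg_cong2[where f = "(*)"])
       (simp_all add: flow_def hdelta_eq sum_distrib_left sum_subtractf right_diff_distrib ac_simps sum_negf)
  then have "(kern t x)\<^sup>2 \<le> (\<Sum>i\<in>UNIV. (- 4 * a i)\<^sup>2) * (\<Sum>i\<in>UNIV. (G 1 hermite_fun t x $ i)\<^sup>2)"
    by (simp only: Cauchy_Schwarz_ineq_sum)
  also have "(\<Sum>i\<in>UNIV. (G 1 hermite_fun t x $ i)\<^sup>2) = G 1 hermite_fun t x \<bullet> G 1 hermite_fun t x"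
    by (simp add: inner_vec_def power2_eq_square)
  also have "(\<Sum>i\<in>UNIV. (- 4 * a i)\<^sup>2) * (G 1 hermite_fun t x \<bullet> G 1 hermite_fun t x)
    \<le> (32 * energy 2 N c t x) * energy 0 M d t x"
  proof (rule mult_mono)
    have "(- 4 * a i)\<^sup>2 \<le> 32 * ((x $ i)\<^sup>2 * (F 0 hermite_fun t x)\<^sup>2 + (F 0 (hermite_d i) t x)\<^sup>2)" for i
      using zero_le_power2[of "x $ i * F 0 hermite_fun t x + F 0 (hermite_d i) t x"]
      by (simp add: a_def power2_eq_square algebra_simps)
    then have "(\<Sum>i\<in>UNIV. (- 4 * a i)\<^sup>2) \<le> (\<Sum>i\<in>UNIV. 32 * ((x $ i)\<^sup>2 * (F 0 hermite_fun t x)\<^sup>2 + (F 0 (hermite_d i) t x)\<^sup>2))"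
      by (intro sum_mono)
    also have "\<dots> = 32 * ((norm x)\<^sup>2 * (F 0 hermite_fun t x)\<^sup>2 + (\<Sum>i\<in>UNIV. (F 0 (hermite_d i) t x)\<^sup>2))"
      by (simp add: norm_vec_square sum.distrib sum_distrib_left sum_distrib_right)
    also have "\<dots> \<le> 32 * energy 2 N c t x"
      by (simp add: energy_def power2_eq_square)
    finally show "(\<Sum>i\<in>UNIV. (- 4 * a i)\<^sup>2) \<le> 32 * energy 2 N c t x" .
    show "G 1 hermite_fun t x \<bullet> G 1 hermite_fun t x \<le> energy 0 M d t x"
      unfolding energy_def by (simp add: sum_nonneg)
  qed (auto simp: energy_nonneg)
  also have "\<dots> \<le> 36 * (energy 2 N c t x * energy 0 M d t x)"
    using mult_nonneg_nonneg[OF energy_nonneg[of 2 N c t x] energy_nonneg[of 0 M d t x]]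
    unfolding mult.assoc by linarith
  finally show ?thesis .
qed

lemma flow_start: "F 0 hermite_fun 0 x = hf x" "G 0 hermite_fun 0 x = hg x"
  by (simp_all add: flow_def hf_def hg_def mult.commute)

lemma bilinear_eps:
  assumes p: "1 < p" and q: "q = p / (p - 1)" and \<epsilon>: "0 < \<epsilon>"
  shows "\<bar>\<integral>x. riesz_star hf x \<bullet> hg x \<partial>lborel\<bar> \<le> 27 / 2 * (conj_max p - 1) *
    ((LBINT x. norm (hf x, \<epsilon> * hermite_fun 0 x) powr p) + (LBINT x. norm (hg x, \<epsilon> * hermite_fun 0 x) powr q))"
proof (cases "2 \<le> p")
  case True
  have "p / (p - 1) \<le> p" using True by (simp add: field_simps)
  then have conj: "conj_max p = p" by (simp add: conj_max_def)
  have "\<bar>psi 0 0\<bar> \<le> 27 / 2 * (p - 1) *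
    ((LBINT x. norm (F 0 hermite_fun 0 x, \<epsilon> * hermite_fun 0 x) powr p)
      + (LBINT x. norm (G 0 hermite_fun 0 x, \<epsilon> * hermite_fun 0 x) powr q))"
  proof (rule flow_pair_bound[OF True q N M _ _ \<epsilon>, where ?\<Psi>1.0 = "psi 1" and \<psi> = kern])
    show "(psi 0 has_real_derivative psi 1 t) (at t)" for t using psi_deriv[of 0 t] by simp
    show "(psi 1 has_real_derivative (LBINT x. kern t x)) (at t)" for t
      using psi_deriv[of 1 t] unfolding kern_integral(2) by (simp only: Suc_1)
    show "integrable lborel (kern t)" for t by (rule kern_integral)
    show "(kern t x)\<^sup>2 \<le> 36 * (energy 2 N c t x * energy 0 M d t x)" for t x by (rule kern_bound)
  qed (auto intro: psi_tendsto)
  then show ?thesis by (simp only: psi_0 flow_start conj)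
next
  case False
  \<comment> \<open>For p < 2 it is g that carries the exponent q \<ge> 2, so its flow takes the
    place of u in the Bellman function.\<close>
  have pos: "0 < p - 1" using p by simp
  have "q - 1 = 1 / (p - 1)" unfolding q using pos by (simp add: field_simps)
  then have "q / (q - 1) = p" unfolding q using pos by simp
  moreover have "2 \<le> q" unfolding q using pos False by (simp add: pos_le_divide_eq)
  ultimately have q2: "2 \<le> q" "p = q / (q - 1)" "p \<le> q" using False by auto
  have conj: "conj_max p = q" unfolding conj_max_def q[symmetric] by (rule max_absorb2[OF q2(3)])
  have "\<bar>psi 0 0\<bar> \<le> 27 / 2 * (q - 1) *
    ((LBINT x. norm (G 0 hermite_fun 0 x, \<epsilon> * hermite_fun 0 x) powr q)
      + (LBINT x. norm (F 0 hermite_fun 0 x, \<epsilon> * hermite_fun 0 x) powr p))"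
  proof (rule flow_pair_bound[OF q2(1,2) M N _ _ \<epsilon>, where ?\<Psi>1.0 = "psi 1" and \<psi> = kern])
    show "(psi 0 has_real_derivative psi 1 t) (at t)" for t using psi_deriv[of 0 t] by simp
    show "(psi 1 has_real_derivative (LBINT x. kern t x)) (at t)" for t
      using psi_deriv[of 1 t] unfolding kern_integral(2) by (simp only: Suc_1)
    show "integrable lborel (kern t)" for t by (rule kern_integral)
    show "(kern t x)\<^sup>2 \<le> 36 * (energy 0 M d t x * energy 2 N c t x)" for t x using kern_bound[of t x] by (simp only: mult.commute[of "energy 2 N c t x"])
  qed (auto intro: psi_tendsto)
  then show ?thesis unfolding psi_0 flow_start conj by (simp only: add.commute)
qed

lemma eps_limit:
  fixes h :: "real ^ 'd \<Rightarrow> 'b::euclidean_space"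
  assumes p: "0 < p" and [measurable]: "h \<in> borel_measurable borel" and h: "gbounded (\<lambda>x. norm (h x))"
  shows "(\<lambda>k. \<integral>x. norm (h x, 1 / real (Suc k) * hermite_fun 0 x) powr p \<partial>lborel)
    \<longlonglongrightarrow> (LBINT x. norm (h x) powr p)"
proof (rule integral_dominated_convergence[where w = "\<lambda>x. norm (h x, hermite_fun 0 x) powr p"])
  have "gbounded (\<lambda>x. norm (norm (h x, hermite_fun 0 x)))"
  proof -
    obtain C where C: "0 < C" "\<And>x. \<bar>norm (h x)\<bar> + \<bar>hermite_fun 0 x\<bar> \<le> C * exp (- (3 / 8) * (norm x)\<^sup>2)"
    proof -
      obtain C where "0 < C" "\<And>x. \<bar>norm (h x)\<bar> \<le> C * exp (- (3 / 8) * (norm x)\<^sup>2)" using gboundedE[OF h] by blast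
      moreover obtain D where "0 < D" "\<And>x :: real ^ 'd. \<bar>hermite_fun 0 x\<bar> \<le> D * exp (- (3 / 8) * (norm x)\<^sup>2)"
        using gboundedE[OF gbounded_hermite] by blast
      ultimately show thesis by (intro that[of "C + D"]) (auto simp: distrib_right intro: add_mono)
    qed
    have "\<bar>norm (norm (h x, hermite_fun 0 x))\<bar> \<le> C * exp (- (3 / 8) * (norm x)\<^sup>2)" for x
      using norm_Pair_le[of "h x" "hermite_fun 0 x"] C(2)[of x] by simp
    then show ?thesis using C(1) unfolding gbounded_def by blast
  qed
  then show "integrable lborel (\<lambda>x. norm (h x, hermite_fun 0 x) powr p)"
    using gbounded_powr_integrable[of "\<lambda>x. norm (h x, hermite_fun 0 x)" p] p by simp
  show "AE x in lborel. (\<lambda>k. norm (h x, 1 / real (Suc k) * hermite_fun 0 x) powr p) \<longlonglongrightarrow> norm (h x) powr p"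
  proof (rule AE_I2)
    fix x :: "real ^ 'd"
    have "(\<lambda>k. norm (h x, 1 / real (Suc k) * hermite_fun 0 x)) \<longlonglongrightarrow> norm (h x, 0 * hermite_fun 0 x)"
      by (intro tendsto_intros) (use LIMSEQ_inverse_real_of_nat in \<open>simp add: inverse_eq_divide\<close>)
    then have "(\<lambda>k. norm (h x, 1 / real (Suc k) * hermite_fun 0 x)) \<longlonglongrightarrow> norm (h x)" by simp
    then show "(\<lambda>k. norm (h x, 1 / real (Suc k) * hermite_fun 0 x) powr p) \<longlonglongrightarrow> norm (h x) powr p"
      by (rule tendsto_powr') (use p in auto)
  qed
  show "AE x in lborel. norm (norm (h x, 1 / real (Suc k) * hermite_fun 0 x) powr p) \<le> norm (h x, hermite_fun 0 x) powr p" for k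
  proof (rule AE_I2)
    fix x :: "real ^ 'd"
    have "\<bar>1 / real (Suc k) * hermite_fun 0 x\<bar> \<le> 1 * \<bar>hermite_fun 0 x\<bar>"
      unfolding abs_mult by (intro mult_right_mono) auto
    then have "norm (h x, 1 / real (Suc k) * hermite_fun 0 x) \<le> norm (h x, hermite_fun 0 x)"
      unfolding norm_Pair by (intro real_sqrt_le_mono add_left_mono) (simp add: abs_le_square_iff[symmetric])
    then show "norm (norm (h x, 1 / real (Suc k) * hermite_fun 0 x) powr p) \<le> norm (h x, hermite_fun 0 x) powr p"
      using p by (auto intro!: powr_mono2)
  qed
qed (use p in auto)

lemma hf_meas [measurable]: "hf \<in> borel_measurable borel" and hg_meas [measurable]: "hg \<in> borel_measurable borel"
  unfolding hf_def[abs_def] hg_def[abs_def] by measurable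

lemma gbounded_hf: "gbounded (\<lambda>x. norm (hf x))"
proof -
  have "gbounded hf" unfolding hf_def[abs_def] by (intro gbounded_sum N gbounded_cmult gbounded_hermite)
  then show ?thesis by (simp add: gbounded_def)
qed

lemma gbounded_hg: "gbounded (\<lambda>x. norm (hg x))"
proof -
  have "gbounded (\<lambda>x. \<Sum>m\<in>M. norm (d m) * \<bar>hermite_fun m x\<bar>)"
    using gbounded_hermite by (intro gbounded_sum M gbounded_cmult) (auto simp: gbounded_def)
  moreover have "\<bar>norm (hg x)\<bar> \<le> \<bar>\<Sum>m\<in>M. norm (d m) * \<bar>hermite_fun m x\<bar>\<bar>" for x
    unfolding hg_def abs_norm_cancel
    by (rule order_trans[OF norm_sum]) (auto simp: mult.commute intro!: order_trans[OF _ abs_ge_self] sum_mono)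
  ultimately show ?thesis unfolding gbounded_def using order_trans by blast
qed

theorem bilinear:
  assumes p: "1 < p" and q: "q = p / (p - 1)"
  shows "\<bar>\<integral>x. riesz_star hf x \<bullet> hg x \<partial>lborel\<bar> \<le> 27 / 2 * (conj_max p - 1) *
    ((LBINT x. norm (hf x) powr p) + (LBINT x. norm (hg x) powr q))"
proof (rule LIMSEQ_le_const)
  have "0 < q" using p q by simp
  then show "(\<lambda>k. 27 / 2 * (conj_max p - 1) *
    ((LBINT x. norm (hf x, 1 / real (Suc k) * hermite_fun 0 x) powr p)
      + (LBINT x. norm (hg x, 1 / real (Suc k) * hermite_fun 0 x) powr q)))
    \<longlonglongrightarrow> 27 / 2 * (conj_max p - 1) * ((LBINT x. norm (hf x) powr p) + (LBINT x. norm (hg x) powr q))"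
    using p by (intro tendsto_mult tendsto_const tendsto_add eps_limit gbounded_hf gbounded_hg) auto
qed (intro exI[of _ 0] allI impI bilinear_eps p q, simp)

end

section \<open>Norms on \<open>L\<^sup>p\<close>\<close>

text \<open>For normalising by norms that may be 0: divide by slightly larger positive numbers and
  let them tend to the norms.\<close>

lemma le_mult_if_le_mult_greater:
  fixes I K x y :: real
  assumes "\<And>a b. x < a \<Longrightarrow> y < b \<Longrightarrow> I \<le> K * (a * b)"
  shows "I \<le> K * (x * y)"
proof (rule LIMSEQ_le_const)
  show "(\<lambda>n. K * ((x + 1 / real (Suc n)) * (y + 1 / real (Suc n)))) \<longlonglongrightarrow> K * (x * y)"
  proof -
    have "(\<lambda>n. 1 / real (Suc n)) \<longlonglongrightarrow> 0" using LIMSEQ_inverse_real_of_nat by (simp add: inverse_eq_divide)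
    then have "(\<lambda>n. K * ((x + 1 / real (Suc n)) * (y + 1 / real (Suc n)))) \<longlonglongrightarrow> K * ((x + 0) * (y + 0))"
      by (intro tendsto_intros)
    then show ?thesis by simp
  qed
  show "\<exists>N. \<forall>n\<ge>N. I \<le> K * ((x + 1 / real (Suc n)) * (y + 1 / real (Suc n)))"
    by (intro exI[of _ 0] allI impI assms) auto
qed

lemma Lp_norm_nonneg:
  fixes p :: real and f :: "real ^ 'd \<Rightarrow> 'b::euclidean_space"
  shows "0 \<le> Lp_norm p f"
  by (simp add: Lp_norm_def)

lemma powr_convex_combination:
  fixes u v :: real
  assumes p: "1 \<le> p" and uv: "0 \<le> u" "0 \<le> v" and ab: "0 \<le> a" "0 \<le> b" "a + b = 1"
  shows "(a * u + b * v) powr p \<le> a * u powr p + b * v powr p"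
proof -
  have z: "(t * w) powr p \<le> t * w powr p" if "0 \<le> t" "t \<le> 1" for t w :: real
  proof -
    have "t powr p \<le> t powr 1" using that p by (intro powr_mono') auto
    then have "t powr p \<le> t" using that by (cases "t = 0") auto
    then show ?thesis unfolding powr_mult by (intro mult_right_mono) auto
  qed
  consider "u = 0" | "v = 0" | "0 < u" "0 < v" using uv by linarith
  then show ?thesis
  proof cases
    case 1 then show ?thesis using z[of b v] ab p by simp
  next
    case 2 then show ?thesis using z[of a u] ab p by simp
  next
    case 3
    have a: "a = 1 - b" and b: "b \<le> 1" using ab by auto
    show ?thesis
      unfolding a using convex_onD[OF powr_convex[OF p] ab(2) b, of u v] 3 by simp
  qed
qed

context
  fixes p :: real assumes p: "1 < p"
begin

lemma Lp_meas: "f \<in> Lp_space p \<Longrightarrow> f \<in> borel_measurable lebesgue"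
  and Lp_integrable: "f \<in> Lp_space p \<Longrightarrow> integrable lebesgue (\<lambda>x. norm (f x) powr p)"
  by (auto simp: Lp_space_def)

lemma Lp_add:
  fixes f g :: "real ^ 'd \<Rightarrow> 'b::euclidean_space"
  assumes "f \<in> Lp_space p" "g \<in> Lp_space p" shows "(\<lambda>x. f x + g x) \<in> Lp_space p"
  using integrable_powr_add(1)[of p f lebesgue g] p assms by (auto simp: Lp_space_def)

lemma Lp_scale: "f \<in> Lp_space p \<Longrightarrow> (\<lambda>x. c *\<^sub>R f x) \<in> Lp_space p"
  by (auto simp: Lp_space_def powr_mult)

lemma Lp_diff:
  fixes f g :: "real ^ 'd \<Rightarrow> 'b::euclidean_space"
  assumes "f \<in> Lp_space p" "g \<in> Lp_space p" shows "(\<lambda>x. f x - g x) \<in> Lp_space p"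
  using Lp_add[OF assms(1) Lp_scale[OF assms(2), of "- 1"]] by simp

lemma Lp_norm_powr: "Lp_norm p f powr p = (\<integral>x. norm (f x) powr p \<partial>lebesgue)"
  using p by (simp add: Lp_norm_def powr_powr integral_nonneg_AE)

lemma Lp_norm_le_iff:
  assumes "0 \<le> a" shows "Lp_norm p f \<le> a \<longleftrightarrow> (\<integral>x. norm (f x) powr p \<partial>lebesgue) \<le> a powr p"
  unfolding Lp_norm_powr[symmetric]
  using powr_mono2[of p "Lp_norm p f" a] powr_less_mono2[of p a "Lp_norm p f"] p assms Lp_norm_nonneg[of p f]
  by (meson less_imp_le linorder_not_le order_less_trans zero_less_one)

lemma Lp_norm_scale: "Lp_norm p (\<lambda>x. c *\<^sub>R f x) = \<bar>c\<bar> * Lp_norm p f"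
  using p by (simp add: Lp_norm_def powr_mult powr_powr)

lemma Lp_norm_less:
  assumes "Lp_norm p f < a" shows "(\<integral>x. norm ((1 / a) *\<^sub>R f x) powr p \<partial>lebesgue) \<le> 1"
proof -
  have a: "0 < a" using assms Lp_norm_nonneg[of p f] by linarith
  have "Lp_norm p (\<lambda>x. (1 / a) *\<^sub>R f x) \<le> 1"
    unfolding Lp_norm_scale using assms a by simp
  then show ?thesis using Lp_norm_le_iff[of 1 "\<lambda>x. (1 / a) *\<^sub>R f x"] by simp
qed

text \<open>Minkowski's inequality from the convexity of the p-th power: for a and b above the two
  norms, f + g is a + b times a convex combination of f / a and g / b, both of which lie in the unit
  ball.\<close>

lemma Lp_norm_triangle:
  fixes f g :: "real ^ 'd \<Rightarrow> 'b::euclidean_space"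
  assumes f: "f \<in> Lp_space p" and g: "g \<in> Lp_space p"
  shows "Lp_norm p (\<lambda>x. f x + g x) \<le> Lp_norm p f + Lp_norm p g"
proof -
  have *: "Lp_norm p (\<lambda>x. f x + g x) \<le> a + b" if a: "Lp_norm p f < a" and b: "Lp_norm p g < b" for a b
  proof -
    have ab: "0 < a" "0 < b" using a b Lp_norm_nonneg[of p f] Lp_norm_nonneg[of p g] by linarith+
    define s where "s = a + b"
    have s: "0 < s" "a / s + b / s = 1" using ab by (auto simp: s_def add_divide_distrib[symmetric])
    have pt: "norm (f x + g x) powr p \<le> s powr p *
        (a / s * norm ((1 / a) *\<^sub>R f x) powr p + b / s * norm ((1 / b) *\<^sub>R g x) powr p)" for x
    proof -
      have "norm (f x + g x) \<le> s * (a / s * norm ((1 / a) *\<^sub>R f x) + b / s * norm ((1 / b) *\<^sub>R g x))"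
        using norm_triangle_ineq[of "f x" "g x"] ab s by (simp add: distrib_left)
      then have "norm (f x + g x) powr p \<le> (s * (a / s * norm ((1 / a) *\<^sub>R f x) + b / s * norm ((1 / b) *\<^sub>R g x))) powr p"
        using p by (intro powr_mono2) auto
      also have "\<dots> = s powr p * (a / s * norm ((1 / a) *\<^sub>R f x) + b / s * norm ((1 / b) *\<^sub>R g x)) powr p"
        by (rule powr_mult)
      also have "\<dots> \<le> s powr p * (a / s * norm ((1 / a) *\<^sub>R f x) powr p + b / s * norm ((1 / b) *\<^sub>R g x) powr p)"
        using p ab s by (intro mult_left_mono powr_convex_combination) auto
      finally show ?thesis .
    qed
    have i: "integrable lebesgue (\<lambda>x. norm ((1 / a) *\<^sub>R f x) powr p)" "integrable lebesgue (\<lambda>x. norm ((1 / b) *\<^sub>R g x) powr p)"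
      by (rule Lp_integrable[OF Lp_scale[OF f]], rule Lp_integrable[OF Lp_scale[OF g]])
    have "(\<integral>x. norm (f x + g x) powr p \<partial>lebesgue) \<le> (\<integral>x. s powr p *
        (a / s * norm ((1 / a) *\<^sub>R f x) powr p + b / s * norm ((1 / b) *\<^sub>R g x) powr p) \<partial>lebesgue)"
      using i by (intro integral_mono pt Lp_integrable Lp_add f g) auto
    also have "\<dots> = s powr p * (a / s * (\<integral>x. norm ((1 / a) *\<^sub>R f x) powr p \<partial>lebesgue)
        + b / s * (\<integral>x. norm ((1 / b) *\<^sub>R g x) powr p \<partial>lebesgue))"
      using i by (simp only: integral_mult_right_zero Bochner_Integration.integral_add integrable_mult_right)
    also have "\<dots> \<le> s powr p * (a / s * 1 + b / s * 1)"
      using ab s Lp_norm_less[OF a] Lp_norm_less[OF b] by (intro mult_left_mono add_mono) auto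
    finally have "(\<integral>x. norm (f x + g x) powr p \<partial>lebesgue) \<le> s powr p" using s by simp
    then show ?thesis using s Lp_norm_le_iff[of s "\<lambda>x. f x + g x"] by (simp add: s_def)
  qed
  show ?thesis
  proof (rule field_le_epsilon)
    fix e :: real assume "0 < e"
    then show "Lp_norm p (\<lambda>x. f x + g x) \<le> Lp_norm p f + Lp_norm p g + e"
      using *[of "Lp_norm p f + e / 2" "Lp_norm p g + e / 2"] by simp
  qed
qed

lemma Lp_norm_minus_commute: "Lp_norm p (\<lambda>x. f x - g x) = Lp_norm p (\<lambda>x. g x - f x)"
  by (simp add: Lp_norm_def norm_minus_commute)

lemma Lp_norm_triangle_diff:
  fixes f g h :: "real ^ 'd \<Rightarrow> 'b::euclidean_space"
  assumes "f \<in> Lp_space p" "g \<in> Lp_space p" "h \<in> Lp_space p"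
  shows "Lp_norm p (\<lambda>x. f x - h x) \<le> Lp_norm p (\<lambda>x. f x - g x) + Lp_norm p (\<lambda>x. g x - h x)"
  using Lp_norm_triangle[OF Lp_diff[OF assms(1,2)] Lp_diff[OF assms(2,3)]] by simp

lemma Lp_norm_le_add_diff:
  fixes f g :: "real ^ 'd \<Rightarrow> 'b::euclidean_space"
  assumes "f \<in> Lp_space p" "g \<in> Lp_space p"
  shows "Lp_norm p f \<le> Lp_norm p g + Lp_norm p (\<lambda>x. f x - g x)"
  using Lp_norm_triangle[OF assms(2) Lp_diff[OF assms]] by simp

lemma Lp_norm_cong_AE:
  assumes "f \<in> borel_measurable lebesgue" "g \<in> borel_measurable lebesgue" "AE x in lebesgue. f x = g x"
  shows "Lp_norm p f = Lp_norm p g"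
proof -
  have "(\<integral>x. norm (f x) powr p \<partial>lebesgue) = (\<integral>x. norm (g x) powr p \<partial>lebesgue)"
    using assms by (intro integral_cong_AE) auto
  then show ?thesis by (simp add: Lp_norm_def)
qed

lemma Lp_norm_zero_AE:
  assumes "f \<in> Lp_space p" "Lp_norm p f \<le> 0" shows "AE x in lebesgue. f x = 0"
proof -
  have "(\<integral>x. norm (f x) powr p \<partial>lebesgue) = 0"
    using assms(2) Lp_norm_nonneg[of p f] Lp_norm_powr[of f] p by simp
  then show ?thesis
    using integral_nonneg_eq_0_iff_AE[OF Lp_integrable[OF assms(1)]] by simp
qed

lemma gbounded_Lp:
  fixes f :: "real ^ 'd \<Rightarrow> 'b::euclidean_space"
  assumes [measurable]: "f \<in> borel_measurable borel" and f: "gbounded (\<lambda>x. norm (f x))"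
  shows "f \<in> Lp_space p" "(\<integral>x. norm (f x) powr p \<partial>lebesgue) = (LBINT x. norm (f x) powr p)"
proof -
  have m: "f \<in> borel_measurable lborel" by measurable
  have i: "integrable lborel (\<lambda>x. norm (f x) powr p)"
    using p by (intro gbounded_powr_integrable f) auto
  have "integrable lebesgue (\<lambda>x. norm (f x) powr p)"
    by (subst integrable_completion) (auto simp: i)
  then show "f \<in> Lp_space p" unfolding Lp_space_def using measurable_completion[OF m] by simp
  show "(\<integral>x. norm (f x) powr p \<partial>lebesgue) = (LBINT x. norm (f x) powr p)"
    by (rule integral_completion) measurable
qed

lemma hermite_span_Lp: "f \<in> hermite_span \<Longrightarrow> f \<in> Lp_space p"
  using hermite_span_gbounded[of f] hermite_span_meas[of f] by (intro gbounded_Lp) (auto simp: gbounded_def)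

lemma hermite_span_approx:
  assumes f: "f \<in> Lp_space p" and e: "0 < e"
  obtains g where "g \<in> hermite_span" "Lp_norm p (\<lambda>x. f x - g x) < e"
proof -
  have "0 < (e / 2) powr p" using e by simp
  then obtain g where g: "g \<in> hermite_span" "(\<integral>x. \<bar>f x - g x\<bar> powr p \<partial>lebesgue) < (e / 2) powr p"
    using hermite_span_dense[OF _ f, of "(e / 2) powr p"] p by auto
  then have "Lp_norm p (\<lambda>x. f x - g x) \<le> e / 2"
    using e Lp_norm_le_iff[of "e / 2" "\<lambda>x. f x - g x"] by simp
  with that[OF g(1)] e show ?thesis by simp
qed

text \<open>Each component is approximated on its own, and the union of the index sets carries all
  of them. Placing the component errors on the axes turns the total error into a sum to which the
  triangle inequality applies.\<close>

lemma hermite_span_approx_vector: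
  fixes f :: "real ^ 'd \<Rightarrow> real ^ 'd"
  assumes f: "f \<in> Lp_space p" and e: "0 < e"
  obtains M d where "finite M" "Lp_norm p (\<lambda>x. f x - hg M d x) < e"
proof -
  \<comment> \<open>The CARD('d) component errors then add up to at most e / 2.\<close>
  define e' where "e' = e / (2 * real CARD('d))"
  have e': "0 < e'" using e by (simp add: e'_def)
  have comp: "(\<lambda>x. f x $ i) \<in> Lp_space p" for i
  proof -
    have [measurable]: "f \<in> borel_measurable lebesgue" using f by (rule Lp_meas)
    have "(\<lambda>x. f x \<bullet> axis i 1) \<in> borel_measurable lebesgue" by measurable
    then have [measurable]: "(\<lambda>x. f x $ i) \<in> borel_measurable lebesgue" by (simp add: inner_axis)
    have "norm (f x $ i) powr p \<le> norm (f x) powr p" for x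
      using component_le_norm_cart[of "f x" i] p by (intro powr_mono2) auto
    then have "integrable lebesgue (\<lambda>x. norm (f x $ i) powr p)"
      by (intro Bochner_Integration.integrable_bound[OF Lp_integrable[OF f]]) auto
    then show ?thesis unfolding Lp_space_def by simp
  qed
  have "\<forall>i. \<exists>N c. finite N \<and> Lp_norm p (\<lambda>x. f x $ i - (\<Sum>n\<in>N. c n * hermite_fun n x)) < e'"
  proof
    fix i
    obtain g where g: "g \<in> hermite_span" "Lp_norm p (\<lambda>x. f x $ i - g x) < e'"
      using hermite_span_approx[OF comp e'] .
    from g(1) obtain N c where "finite N" "g = (\<lambda>x. \<Sum>n\<in>N. c n * hermite_fun n x)" by (rule hermite_spanE)
    with g(2) show "\<exists>N c. finite N \<and> Lp_norm p (\<lambda>x. f x $ i - (\<Sum>n\<in>N. c n * hermite_fun n x)) < e'" by blast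
  qed
  then obtain N c where N: "\<And>i. finite (N i)" "\<And>i. Lp_norm p (\<lambda>x. f x $ i - (\<Sum>n\<in>N i. c i n * hermite_fun n x)) < e'"
    unfolding choice_iff by blast
  define M where "M = (\<Union>i. N i)"
  define d where "d n = (\<chi> i. if n \<in> N i then c i n else 0)" for n
  have M: "finite M" using N by (simp add: M_def)
  have hg: "hg M d x $ i = (\<Sum>n\<in>N i. c i n * hermite_fun n x)" for x i
  proof -
    have "hg M d x $ i = (\<Sum>n\<in>M. (if n \<in> N i then c i n else 0) * hermite_fun n x)"
      by (simp add: hg_def[OF M M] d_def mult.commute)
    also have "\<dots> = (\<Sum>n\<in>N i. c i n * hermite_fun n x)"
      using M by (intro sum_extend) (auto simp: M_def)
    finally show ?thesis .
  qed
  have F: "(\<lambda>x. axis i (f x $ i - hg M d x $ i)) \<in> Lp_space p \<and>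
      Lp_norm p (\<lambda>x. axis i (f x $ i - hg M d x $ i)) < e'" for i
  proof -
    have "(\<lambda>x. \<Sum>n\<in>N i. c i n * hermite_fun n x) \<in> Lp_space p"
      by (intro hermite_span_Lp hermite_spanI N)
    then have d: "(\<lambda>x. f x $ i - hg M d x $ i) \<in> Lp_space p" unfolding hg by (intro Lp_diff comp)
    have a: "axis i r = r *\<^sub>R axis i 1" for r :: real by (auto simp: axis_def vec_eq_iff)
    have a': "(\<lambda>x. axis i (f x $ i - hg M d x $ i)) = (\<lambda>x. (f x $ i - hg M d x $ i) *\<^sub>R axis i 1)"
      by (rule ext) (rule a)
    have "(\<lambda>x. axis i (f x $ i - hg M d x $ i)) \<in> borel_measurable lebesgue"
      unfolding a' by (intro borel_measurable_scaleR Lp_meas[OF d] borel_measurable_const)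
    moreover have "norm (axis i r) = norm r" for r :: real
      by (subst a) (simp add: norm_axis_1)
    ultimately show ?thesis using N(2)[of i] d by (simp add: Lp_space_def Lp_norm_def hg)
  qed
  have "(\<lambda>x. \<Sum>i\<in>A. axis i (f x $ i - hg M d x $ i)) \<in> Lp_space p \<and>
     Lp_norm p (\<lambda>x. \<Sum>i\<in>A. axis i (f x $ i - hg M d x $ i)) \<le> real (card A) * e'" if "finite A" for A
    using that
  proof (induction A rule: finite_induct)
    case empty
    then show ?case using p by (simp add: Lp_space_def Lp_norm_def)
  next
    case (insert i A)
    have "Lp_norm p (\<lambda>x. axis i (f x $ i - hg M d x $ i) + (\<Sum>i\<in>A. axis i (f x $ i - hg M d x $ i)))
       \<le> e' + real (card A) * e'"
      using Lp_norm_triangle[of "\<lambda>x. axis i (f x $ i - hg M d x $ i)" "\<lambda>x. \<Sum>i\<in>A. axis i (f x $ i - hg M d x $ i)"]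
        F[of i] insert by linarith
    then show ?case using insert F[of i] by (auto simp: distrib_right intro!: Lp_add)
  qed
  from this[of UNIV] have "Lp_norm p (\<lambda>x. \<Sum>i\<in>UNIV. axis i (f x $ i - hg M d x $ i)) \<le> real CARD('d) * e'" by simp
  also have "(\<lambda>x. \<Sum>i\<in>UNIV. axis i (f x $ i - hg M d x $ i)) = (\<lambda>x. f x - hg M d x)"
    by (auto simp: fun_eq_iff vec_eq_iff axis_def if_distrib cong: if_cong)
  also have "real CARD('d) * e' < e" using e by (simp add: e'_def)
  finally show ?thesis using that M by blast
qed

end

text \<open>Young's inequality with the divisors p and q replaced by 1 gives the sum of two
  integrals, hence the constant 2 after normalisation. This is enough, as the inequality is applied
  to an error that tends to 0.\<close>

lemma hoelder_crude:
  fixes f g :: "real ^ 'd \<Rightarrow> 'b::euclidean_space"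
  assumes p: "1 < p" "q = p / (p - 1)" and f: "f \<in> Lp_space p" and g: "g \<in> Lp_space q"
  shows "integrable lebesgue (\<lambda>x. f x \<bullet> g x)"
    "\<bar>\<integral>x. f x \<bullet> g x \<partial>lebesgue\<bar> \<le> 2 * (Lp_norm p f * Lp_norm q g)"
proof -
  have q: "1 < q" "1 / p + 1 / q = 1" using p(1) unfolding p(2) by (auto simp: field_simps)
  have y: "\<bar>u \<bullet> v\<bar> \<le> norm u powr p + norm v powr q" for u v :: 'b
  proof -
    have "\<bar>u \<bullet> v\<bar> \<le> norm u * norm v" by (rule Cauchy_Schwarz_ineq2)
    also have "\<dots> \<le> norm u powr p / p + norm v powr q / q" using p q by (intro Youngs_inequality) auto
    also have "\<dots> \<le> norm u powr p / 1 + norm v powr q / 1" using p q by (intro add_mono divide_left_mono) auto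
    finally show ?thesis by simp
  qed
  note [measurable] = Lp_meas[OF p(1) f] Lp_meas[OF q(1) g]
  have i: "integrable lebesgue (\<lambda>x. u x \<bullet> v x)" "\<bar>\<integral>x. u x \<bullet> v x \<partial>lebesgue\<bar> \<le>
      (\<integral>x. norm (u x) powr p \<partial>lebesgue) + (\<integral>x. norm (v x) powr q \<partial>lebesgue)"
    if u: "u \<in> Lp_space p" and v: "v \<in> Lp_space q" for u v :: "real ^ 'd \<Rightarrow> 'b"
  proof -
    note [measurable] = Lp_meas[OF p(1) u] Lp_meas[OF q(1) v]
    have s: "integrable lebesgue (\<lambda>x. norm (u x) powr p + norm (v x) powr q)"
      using Lp_integrable[OF p(1) u] Lp_integrable[OF q(1) v] by simp
    show j: "integrable lebesgue (\<lambda>x. u x \<bullet> v x)"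
      by (rule Bochner_Integration.integrable_bound[OF s]) (use y in auto)
    have "\<bar>\<integral>x. u x \<bullet> v x \<partial>lebesgue\<bar> \<le> (\<integral>x. \<bar>u x \<bullet> v x\<bar> \<partial>lebesgue)" by (rule integral_abs_bound)
    also have "\<dots> \<le> (\<integral>x. norm (u x) powr p + norm (v x) powr q \<partial>lebesgue)"
      using j s by (intro integral_mono y) auto
    also have "\<dots> = (\<integral>x. norm (u x) powr p \<partial>lebesgue) + (\<integral>x. norm (v x) powr q \<partial>lebesgue)"
      using Lp_integrable[OF p(1) u] Lp_integrable[OF q(1) v] by simp
    finally show "\<bar>\<integral>x. u x \<bullet> v x \<partial>lebesgue\<bar> \<le>
      (\<integral>x. norm (u x) powr p \<partial>lebesgue) + (\<integral>x. norm (v x) powr q \<partial>lebesgue)" .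
  qed
  show "integrable lebesgue (\<lambda>x. f x \<bullet> g x)" by (rule i[OF f g])
  show "\<bar>\<integral>x. f x \<bullet> g x \<partial>lebesgue\<bar> \<le> 2 * (Lp_norm p f * Lp_norm q g)"
  proof (rule le_mult_if_le_mult_greater)
    fix a b assume a: "Lp_norm p f < a" and b: "Lp_norm q g < b"
    have ab: "0 < a" "0 < b" using a b Lp_norm_nonneg[of p f] Lp_norm_nonneg[of q g] by linarith+
    have "\<bar>\<integral>x. ((1 / a) *\<^sub>R f x) \<bullet> ((1 / b) *\<^sub>R g x) \<partial>lebesgue\<bar> \<le> 2"
      using i(2)[OF Lp_scale[OF p(1) f, of "1 / a"] Lp_scale[OF q(1) g, of "1 / b"]]
        Lp_norm_less[OF p(1) a] Lp_norm_less[OF q(1) b] by linarith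
    moreover have "(\<integral>x. ((1 / a) *\<^sub>R f x) \<bullet> ((1 / b) *\<^sub>R g x) \<partial>lebesgue) = (\<integral>x. f x \<bullet> g x \<partial>lebesgue) / (a * b)"
      by simp
    ultimately show "\<bar>\<integral>x. f x \<bullet> g x \<partial>lebesgue\<bar> \<le> 2 * (a * b)"
      using ab by (simp add: abs_divide abs_mult pos_divide_le_eq mult.commute)
  qed
qed

section \<open>The estimate on the span\<close>

lemma riesz_star_nth:
  assumes "finite N"
  shows "riesz_star (\<lambda>x. \<Sum>n\<in>N. c n * hermite_fun n x) x $ i = (\<Sum>n\<in>N. 1 / rate 2 n * c n * hdelta i n x)"
  by (simp add: riesz_star_def riesz_star_component_eq[OF assms])

lemma hermite_span_common:
  assumes "f \<in> hermite_span" "g \<in> hermite_span"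
  obtains N c d where "finite N" "f = (\<lambda>x. \<Sum>n\<in>N. c n * hermite_fun n x)" "g = (\<lambda>x. \<Sum>n\<in>N. d n * hermite_fun n x)"
proof -
  obtain N c where N: "finite N" "f = (\<lambda>x. \<Sum>n\<in>N. c n * hermite_fun n x)"
    using assms(1) by (rule hermite_spanE)
  obtain M d where M: "finite M" "g = (\<lambda>x. \<Sum>n\<in>M. d n * hermite_fun n x)"
    using assms(2) by (rule hermite_spanE)
  show thesis
    using N(1) M(1)
    by (intro that[of "N \<union> M" "\<lambda>n. if n \<in> N then c n else 0" "\<lambda>n. if n \<in> M then d n else 0"])
       (auto simp: N(2) M(2) fun_eq_iff sum_extend)
qed

lemma riesz_star_linear:
  assumes "f \<in> hermite_span" "g \<in> hermite_span"
  shows "riesz_star (\<lambda>x. a * f x + b * g x) y = a *\<^sub>R riesz_star f y + b *\<^sub>R riesz_star g y"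
proof -
  obtain N c d where N: "finite N" "f = (\<lambda>x. \<Sum>n\<in>N. c n * hermite_fun n x)" "g = (\<lambda>x. \<Sum>n\<in>N. d n * hermite_fun n x)"
    using assms by (rule hermite_span_common)
  have "(\<lambda>x. a * f x + b * g x) = (\<lambda>x. \<Sum>n\<in>N. (a * c n + b * d n) * hermite_fun n x)"
    by (simp add: N sum_distrib_left distrib_right sum.distrib mult.assoc)
  then show ?thesis
    by (simp only: vec_eq_iff riesz_star_nth[OF N(1)] N(2,3) vector_add_component vector_scaleR_component)
       (simp add: sum_distrib_left sum.distrib[symmetric] algebra_simps add_divide_distrib)
qed

lemma riesz_star_gbounded:
  assumes "f \<in> hermite_span"
  shows "riesz_star f \<in> borel_measurable borel" "gbounded (\<lambda>x. norm (riesz_star f x))"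
proof -
  obtain N c where N: "finite N" "f = (\<lambda>x. \<Sum>n\<in>N. c n * hermite_fun n x)"
    using assms by (rule hermite_spanE)
  have e: "riesz_star f = (\<lambda>x. \<chi> i. \<Sum>n\<in>N. 1 / rate 2 n * c n * hdelta i n x)"
    by (simp add: fun_eq_iff vec_eq_iff N(2) riesz_star_nth[OF N(1)])
  have m: "(\<lambda>x. riesz_star f x $ i) \<in> borel_measurable borel" for i unfolding e by simp
  show "riesz_star f \<in> borel_measurable borel"
  proof (rule borel_measurable_euclidean_space[THEN iffD2], rule ballI)
    fix b :: "real ^ 'a" assume "b \<in> Basis"
    then obtain i where "b = axis i 1" by (auto simp: Basis_vec_def)
    then show "(\<lambda>x. riesz_star f x \<bullet> b) \<in> borel_measurable borel" using m[of i] by (simp add: inner_axis)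
  qed
  have "gbounded (\<lambda>x. \<bar>\<Sum>n\<in>N. 1 / rate 2 n * c n * hdelta i n x\<bar>)" for i
  proof -
    have "gbounded (\<lambda>x. \<Sum>n\<in>N. 1 / rate 2 n * c n * hdelta i n x)"
      by (intro gbounded_sum N gbounded_cmult gbounded_hdelta)
    then show ?thesis by (simp add: gbounded_def)
  qed
  then have "gbounded (\<lambda>x. \<Sum>i\<in>UNIV. \<bar>\<Sum>n\<in>N. 1 / rate 2 n * c n * hdelta i n x\<bar>)"
    by (intro gbounded_sum) auto
  moreover have "\<bar>norm (riesz_star f x)\<bar> \<le> \<bar>\<Sum>i\<in>UNIV. \<bar>\<Sum>n\<in>N. 1 / rate 2 n * c n * hdelta i n x\<bar>\<bar>" for x
    using norm_le_l1_cart[of "riesz_star f x"] by (simp add: e)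
  ultimately show "gbounded (\<lambda>x. norm (riesz_star f x))" unfolding gbounded_def using order_trans by blast
qed

lemma riesz_star_Lp: "1 < p \<Longrightarrow> f \<in> hermite_span \<Longrightarrow> riesz_star f \<in> Lp_space p"
  by (intro gbounded_Lp riesz_star_gbounded)

lemma conj_max_gt_1: "1 < p \<Longrightarrow> 1 < conj_max p"
  by (simp add: conj_max_def less_max_iff_disj)

text \<open>Applied to f / a and g / b with a and b above the norms, both integrals of
  \<open>bilinear\<close> are at most 1, so their sum turns 27/2 into 27 and the estimate becomes
  homogeneous.\<close>

lemma bilinear_norm:
  assumes p: "1 < p" "q = p / (p - 1)" and f: "f \<in> hermite_span" and M: "finite M"
  shows "\<bar>\<integral>x. riesz_star f x \<bullet> hg M d x \<partial>lebesgue\<bar> \<le> 27 * (conj_max p - 1) * (Lp_norm p f * Lp_norm q (hg M d))"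
proof (rule le_mult_if_le_mult_greater)
  fix a b assume a: "Lp_norm p f < a" and b: "Lp_norm q (hg M d) < b"
  have ab: "0 < a" "0 < b" using a b Lp_norm_nonneg[of p f] Lp_norm_nonneg[of q "hg M d"] by linarith+
  have q: "1 < q" using p by simp
  obtain N c where N: "finite N" "f = (\<lambda>x. \<Sum>n\<in>N. c n * hermite_fun n x)"
    using f by (rule hermite_spanE)
  define c' where "c' n = (1 / a) * c n" for n
  define d' where "d' n = (1 / b) *\<^sub>R d n" for n
  have hf: "hf N c' x = (1 / a) *\<^sub>R f x" for x
    by (simp add: hf_def[OF N(1) M] c'_def N(2) sum_divide_distrib)
  have hg: "hg M d' x = (1 / b) *\<^sub>R hg M d x" for x
    by (simp add: hg_def[OF N(1) M] d'_def scaleR_sum_right mult.commute)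
  have r: "riesz_star (hf N c') x = (1 / a) *\<^sub>R riesz_star f x" for x
    unfolding hf_def[OF N(1) M, abs_def] N(2) vec_eq_iff vector_scaleR_component riesz_star_nth[OF N(1)]
    by (simp add: c'_def sum_divide_distrib)
  have mg [measurable]: "hg M d' \<in> borel_measurable borel" "riesz_star (hf N c') \<in> borel_measurable borel"
    using hg_meas[OF N(1) M] riesz_star_gbounded(1)[OF hermite_spanI[OF N(1), of c']]
    unfolding hf_def[OF N(1) M, abs_def] by auto
  have "\<bar>\<integral>x. riesz_star (hf N c') x \<bullet> hg M d' x \<partial>lborel\<bar> \<le> 27 / 2 * (conj_max p - 1) *
    ((LBINT x. norm (hf N c' x) powr p) + (LBINT x. norm (hg M d' x) powr q))"
    by (rule bilinear[OF N(1) M p])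
  also have "(LBINT x. norm (hf N c' x) powr p) = (\<integral>x. norm (hf N c' x) powr p \<partial>lebesgue)"
    by (rule gbounded_Lp(2)[OF p(1) hf_meas[OF N(1) M] gbounded_hf[OF N(1) M], symmetric])
  also have "(LBINT x. norm (hg M d' x) powr q) = (\<integral>x. norm (hg M d' x) powr q \<partial>lebesgue)"
    by (rule gbounded_Lp(2)[OF q hg_meas[OF N(1) M] gbounded_hg[OF N(1) M], symmetric])
  also have "27 / 2 * (conj_max p - 1) * ((\<integral>x. norm (hf N c' x) powr p \<partial>lebesgue) + (\<integral>x. norm (hg M d' x) powr q \<partial>lebesgue))
     \<le> 27 / 2 * (conj_max p - 1) * (1 + 1)"
    unfolding hf hg using conj_max_gt_1[OF p(1)] Lp_norm_less[OF p(1) a] Lp_norm_less[OF q b]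
    by (intro mult_left_mono add_mono) auto
  also have "(LBINT x. riesz_star (hf N c') x \<bullet> hg M d' x) = (\<integral>x. riesz_star (hf N c') x \<bullet> hg M d' x \<partial>lebesgue)"
    by (rule integral_completion[symmetric]) measurable
  also have "\<dots> = (\<integral>x. riesz_star f x \<bullet> hg M d x \<partial>lebesgue) / (a * b)"
    unfolding r hg by simp
  also have "27 / 2 * (conj_max p - 1) * (1 + 1) = 27 * (conj_max p - 1)" by simp
  finally have "\<bar>\<integral>x. riesz_star f x \<bullet> hg M d x \<partial>lebesgue\<bar> / (a * b) \<le> 27 * (conj_max p - 1)"
    using ab by (simp only: abs_divide abs_mult abs_of_pos)
  then show "\<bar>\<integral>x. riesz_star f x \<bullet> hg M d x \<partial>lebesgue\<bar> \<le> 27 * (conj_max p - 1) * (a * b)"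
    using ab by (simp only: pos_divide_le_eq mult_pos_pos)
qed

text \<open>Duality with the extremal element of the dual space. That element is no finite Hermite
  expansion, so it is approximated by one and the error is absorbed by the crude Hoelder
  inequality.\<close>

theorem riesz_star_bound:
  assumes p: "1 < p" and f: "f \<in> hermite_span"
  shows "Lp_norm p (riesz_star f) \<le> 27 * (conj_max p - 1) * Lp_norm p f"
proof -
  define q where "q = p / (p - 1)"
  have q: "1 < q" "(p - 1) * q = p" "1 / p + 1 / q = 1" using p unfolding q_def by (auto simp: field_simps)
  let ?W = "riesz_star f"
  define K where "K = 27 * (conj_max p - 1)"
  define J where "J = (\<integral>x. norm (?W x) powr p \<partial>lebesgue)"
  \<comment> \<open>With W for \<open>?W\<close>, this choice makes both |D|^q and the inner product
    of W and D equal to |W|^p.\<close>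
  define D where "D x = norm (?W x) powr (p - 2) *\<^sub>R ?W x" for x
  have W: "?W \<in> Lp_space p" by (rule riesz_star_Lp[OF p f])
  note [measurable] = Lp_meas[OF p W]
  have nD: "norm (D x) powr q = norm (?W x) powr p" for x
  proof (cases "?W x = 0")
    case False
    then have "norm (D x) = norm (?W x) powr (p - 1)"
      using powr_add[of "norm (?W x)" "p - 2" 1] by (simp add: D_def)
    then show ?thesis by (simp add: powr_powr q(2))
  qed (simp add: D_def)
  have WD: "?W x \<bullet> D x = norm (?W x) powr p" for x
  proof (cases "?W x = 0")
    case False
    then show ?thesis
      using powr_add[of "norm (?W x)" "p - 2" 2] by (simp add: D_def power2_norm_eq_inner)
  qed (simp add: D_def)
  have "D \<in> borel_measurable lebesgue" unfolding D_def[abs_def] by measurable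
  then have D: "D \<in> Lp_space q" using Lp_integrable[OF p W] by (simp add: Lp_space_def nD)
  have nDJ: "Lp_norm q D = J powr (1 / q)" by (simp add: Lp_norm_def nD J_def)
  have "J \<le> K * (Lp_norm p f * Lp_norm q D)"
  proof (rule field_le_epsilon)
    fix e :: real assume e: "0 < e"
    have K: "0 \<le> K" using conj_max_gt_1[OF p] by (simp add: K_def)
    \<comment> \<open>Collects the coefficients of the approximation error r in the two estimates
      below; the summand 1 keeps it positive.\<close>
    define L where "L = K * Lp_norm p f + 2 * Lp_norm p ?W + 1"
    have L: "0 < L" using K Lp_norm_nonneg[of p f] Lp_norm_nonneg[of p ?W] by (simp add: L_def add_nonneg_pos)
    obtain M d where M: "finite M" "Lp_norm q (\<lambda>x. D x - hg M d x) < e / L"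
      using hermite_span_approx_vector[OF q(1) D, of "e / L"] e L by auto
    have G: "hg M d \<in> Lp_space q"
      by (rule gbounded_Lp[OF q(1) hg_meas[OF M(1) M(1)] gbounded_hg[OF M(1) M(1)]])
    define r where "r = Lp_norm q (\<lambda>x. D x - hg M d x)"
    have r: "0 \<le> r" "r < e / L" using M Lp_norm_nonneg by (auto simp: r_def)
    have "J = (\<integral>x. ?W x \<bullet> hg M d x + ?W x \<bullet> (D x - hg M d x) \<partial>lebesgue)"
      by (simp add: J_def WD[symmetric] inner_diff_right)
    also have "\<dots> = (\<integral>x. ?W x \<bullet> hg M d x \<partial>lebesgue) + (\<integral>x. ?W x \<bullet> (D x - hg M d x) \<partial>lebesgue)"
      by (intro Bochner_Integration.integral_add hoelder_crude[OF p q_def W] G Lp_diff[OF q(1)] D)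
    also have "\<dots> \<le> K * (Lp_norm p f * Lp_norm q (hg M d)) + 2 * (Lp_norm p ?W * r)"
      using bilinear_norm[OF p q_def f M(1), of d] hoelder_crude(2)[OF p q_def W Lp_diff[OF q(1) D G]]
      unfolding r_def K_def by linarith
    also have "Lp_norm q (hg M d) \<le> Lp_norm q D + r"
      using Lp_norm_le_add_diff[OF q(1) G D] Lp_norm_minus_commute[OF q(1), of D "hg M d"] by (simp add: r_def)
    then have "K * (Lp_norm p f * Lp_norm q (hg M d)) + 2 * (Lp_norm p ?W * r)
       \<le> K * (Lp_norm p f * (Lp_norm q D + r)) + 2 * (Lp_norm p ?W * r)"
      using K Lp_norm_nonneg[of p f] by (intro add_right_mono mult_left_mono) auto
    also have "\<dots> \<le> K * (Lp_norm p f * Lp_norm q D) + L * r"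
      using r by (simp add: L_def algebra_simps)
    also have "L * r \<le> e" using r L by (simp add: pos_less_divide_eq mult.commute)
    finally show "J \<le> K * (Lp_norm p f * Lp_norm q D) + e" by simp
  qed
  then have *: "J \<le> (K * Lp_norm p f) * J powr (1 / q)" unfolding nDJ by simp
  have J0: "0 \<le> J" by (simp add: J_def integral_nonneg_AE)
  show ?thesis
  proof (cases "J = 0")
    case True
    have "0 \<le> K * Lp_norm p f" using conj_max_gt_1[OF p] Lp_norm_nonneg[of p f] by (simp add: K_def)
    then show ?thesis using True by (simp add: Lp_norm_def J_def K_def)
  next
    case False
    then have J: "0 < J" using J0 by simp
    have "J = J powr (1 / p) * J powr (1 / q)"
      using J q(3) by (simp add: powr_add[symmetric])
    with * have "J powr (1 / p) * J powr (1 / q) \<le> (K * Lp_norm p f) * J powr (1 / q)" by simp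
    then have "J powr (1 / p) \<le> K * Lp_norm p f" using J by simp
    then show ?thesis by (simp add: Lp_norm_def J_def K_def)
  qed
qed

section \<open>The bounded extension\<close>

text \<open>The rate 1/4 leaves room for the weight 2^k: the sum over k of 2^k |F (k+1) - F k|^p has
  a finite integral, so almost everywhere the increments are eventually below a geometric sequence.
  This gives a pointwise limit, and Fatou's lemma carries the norm bounds over to it.\<close>

lemma Lp_rapid_limit:
  fixes F :: "nat \<Rightarrow> real ^ 'd \<Rightarrow> 'b::euclidean_space"
  assumes p: "1 < p" and F: "\<And>k. F k \<in> Lp_space p"
    and rapid: "\<And>k. Lp_norm p (\<lambda>x. F (Suc k) x - F k x) \<le> (1 / 4) ^ k"
  obtains h where "h \<in> Lp_space p" "(\<lambda>k. Lp_norm p (\<lambda>x. h x - F k x)) \<longlonglongrightarrow> 0"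
proof -
  define D where "D k x = F (Suc k) x - F k x" for k x
  \<comment> \<open>Where the sequence diverges \<open>lim\<close> still has some value; that
    happens on a null set only.\<close>
  define h where "h x = lim (\<lambda>k. F k x)" for x
  have D: "D k \<in> Lp_space p" for k unfolding D_def[abs_def] by (intro Lp_diff p F)
  note [measurable] = Lp_meas[OF p F] Lp_meas[OF p D]
  have [measurable]: "h \<in> borel_measurable lebesgue" unfolding h_def[abs_def] by measurable
  have Dint: "(\<integral>x. norm (D k x) powr p \<partial>lebesgue) \<le> (1 / 4) ^ k" for k
  proof -
    have "(\<integral>x. norm (D k x) powr p \<partial>lebesgue) \<le> ((1 / 4) ^ k) powr p"
      using rapid[of k] Lp_norm_le_iff[OF p, of "(1 / 4) ^ k" "D k"] by (simp add: D_def[abs_def])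
    also have "\<dots> \<le> ((1 / 4) ^ k) powr 1" using p by (intro powr_mono') (auto simp: power_le_one)
    finally show ?thesis by simp
  qed
  have ae: "AE x in lebesgue. (\<lambda>k. F k x) \<longlonglongrightarrow> h x"
  proof -
    have "(\<integral>\<^sup>+x. (\<Sum>k. ennreal (2 ^ k * norm (D k x) powr p)) \<partial>lebesgue)
        = (\<Sum>k. \<integral>\<^sup>+x. ennreal (2 ^ k * norm (D k x) powr p) \<partial>lebesgue)"
      by (rule nn_integral_suminf) measurable
    also have "\<dots> \<le> (\<Sum>k. ennreal ((1 / 2) ^ k))"
    proof (intro suminf_le allI summableI)
      fix k
      have i: "integrable lebesgue (\<lambda>x. 2 ^ k * norm (D k x) powr p)" using Lp_integrable[OF p D] by simp
      have "(\<integral>\<^sup>+x. ennreal (2 ^ k * norm (D k x) powr p) \<partial>lebesgue) = ennreal (\<integral>x. 2 ^ k * norm (D k x) powr p \<partial>lebesgue)"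
        by (rule nn_integral_eq_integral[OF i]) simp
      also have "\<dots> \<le> ennreal ((1 / 2) ^ k)"
      proof (rule ennreal_leI)
        have "(\<integral>x. 2 ^ k * norm (D k x) powr p \<partial>lebesgue) \<le> 2 ^ k * (1 / 4) ^ k"
          using Dint[of k] by simp
        also have "\<dots> = (1 / 2) ^ k" by (simp add: power_mult_distrib[symmetric])
        finally show "(\<integral>x. 2 ^ k * norm (D k x) powr p \<partial>lebesgue) \<le> (1 / 2) ^ k" .
      qed
      finally show "(\<integral>\<^sup>+x. ennreal (2 ^ k * norm (D k x) powr p) \<partial>lebesgue) \<le> ennreal ((1 / 2) ^ k)" .
    qed
    also have "\<dots> = ennreal (\<Sum>k. (1 / 2) ^ k)" by (rule suminf_ennreal2) (auto simp: summable_geometric)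
    finally have "(\<integral>\<^sup>+x. (\<Sum>k. ennreal (2 ^ k * norm (D k x) powr p)) \<partial>lebesgue) \<noteq> \<infinity>"
      by (auto simp: top_unique)
    then have "AE x in lebesgue. (\<Sum>k. ennreal (2 ^ k * norm (D k x) powr p)) \<noteq> \<infinity>"
      by (intro nn_integral_PInf_AE) measurable
    then show ?thesis
    proof eventually_elim
      case (elim x)
      have "summable (\<lambda>k. 2 ^ k * norm (D k x) powr p)"
        by (rule summable_suminf_not_top) (use elim in auto)
      then have "(\<lambda>k. 2 ^ k * norm (D k x) powr p) \<longlonglongrightarrow> 0" by (rule summable_LIMSEQ_zero)
      then have "eventually (\<lambda>k. 2 ^ k * norm (D k x) powr p < 1) sequentially" by (rule order_tendstoD) simp
      then have ev: "eventually (\<lambda>k. norm (D k x) \<le> ((1 / 2) powr (1 / p)) ^ k) sequentially"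
      proof eventually_elim
        case (elim k)
        have "norm (D k x) powr p \<le> (1 / 2) ^ k" using elim by (simp add: power_divide field_simps)
        then have "(norm (D k x) powr p) powr (1 / p) \<le> ((1 / 2) ^ k) powr (1 / p)"
          using p by (intro powr_mono2) auto
        also have "\<dots> = ((1 / 2) powr (1 / p)) ^ k"
          by (simp add: powr_realpow[symmetric] powr_powr mult.commute)
        finally show ?case using p by (simp add: powr_powr)
      qed
      have "(1 / 2) powr (1 / p) < (1::real)"
        using p powr_less_mono2[of "1 / p" "1 / 2" 1] by simp
      then have "summable (\<lambda>k. ((1 / 2) powr (1 / p)) ^ k :: real)" by (intro summable_geometric) simp
      then have "summable (\<lambda>k. D k x)" by (rule summable_comparison_test_ev[OF ev])
      then have "convergent (\<lambda>n. \<Sum>k<n. D k x)" by (simp add: summable_iff_convergent)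
      moreover have "(\<Sum>k<n. D k x) = F n x - F 0 x" for n
        unfolding D_def by (rule sum_lessThan_telescope)
      ultimately have "convergent (\<lambda>n. F n x - F 0 x)" by simp
      then have "convergent (\<lambda>n. (F n x - F 0 x) + F 0 x)" by (intro convergent_add convergent_const)
      then show ?case unfolding h_def by (simp add: convergent_LIMSEQ_iff)
    qed
  qed
  have dist: "Lp_norm p (\<lambda>x. F (k + j) x - F k x) \<le> (\<Sum>i<j. (1 / 4) ^ (k + i))" for k j
  proof (induction j)
    case 0 then show ?case using p by (simp add: Lp_norm_def)
  next
    case (Suc j)
    then show ?case
      using Lp_norm_triangle_diff[OF p F[of "k + Suc j"] F[of "k + j"] F[of k]] rapid[of "k + j"] by simp
  qed
  have dist2: "Lp_norm p (\<lambda>x. F (k + j) x - F k x) \<le> 2 * (1 / 4) ^ k" for k j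
  proof -
    have "(\<Sum>i<j. (1 / 4) ^ (k + i)) = (1 / 4) ^ k * (\<Sum>i<j. (1 / 4) ^ i :: real)"
      by (simp add: power_add sum_distrib_left)
    also have "\<dots> \<le> (1 / 4) ^ k * (\<Sum>i. (1 / 4) ^ i)"
      by (intro mult_left_mono sum_le_suminf summable_geometric) auto
    also have "(\<Sum>i. (1 / 4) ^ i :: real) = 4 / 3" by (simp add: suminf_geometric)
    finally show ?thesis using dist[where k = k and j = j] zero_le_power[of "1 / 4 :: real" k] by linarith
  qed
  have lim: "(\<lambda>x. h x - F k x) \<in> Lp_space p \<and> Lp_norm p (\<lambda>x. h x - F k x) \<le> 2 * (1 / 4) ^ k" for k
  proof -
    have "(\<integral>\<^sup>+x. ennreal (norm (h x - F k x) powr p) \<partial>lebesgue)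
        = (\<integral>\<^sup>+x. liminf (\<lambda>j. ennreal (norm (F (k + j) x - F k x) powr p)) \<partial>lebesgue)"
    proof (rule nn_integral_cong_AE, use ae in eventually_elim)
      case (elim x)
      have "(\<lambda>j. F (k + j) x) \<longlonglongrightarrow> h x"
        using LIMSEQ_ignore_initial_segment[OF elim, of k] by (simp add: add.commute)
      then have "(\<lambda>j. norm (F (k + j) x - F k x)) \<longlonglongrightarrow> norm (h x - F k x)" by (intro tendsto_intros)
      then have "(\<lambda>j. norm (F (k + j) x - F k x) powr p) \<longlonglongrightarrow> norm (h x - F k x) powr p"
        by (rule tendsto_powr') (use p in auto)
      then have "(\<lambda>j. ennreal (norm (F (k + j) x - F k x) powr p)) \<longlonglongrightarrow> ennreal (norm (h x - F k x) powr p)"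
        by (rule tendsto_ennrealI)
      from lim_imp_Liminf[OF _ this] show ?case by simp
    qed
    also have "\<dots> \<le> liminf (\<lambda>j. \<integral>\<^sup>+x. ennreal (norm (F (k + j) x - F k x) powr p) \<partial>lebesgue)"
      by (rule nn_integral_liminf) measurable
    also have "\<dots> \<le> ennreal ((2 * (1 / 4) ^ k) powr p)"
    proof -
      have "(\<integral>\<^sup>+x. ennreal (norm (F (k + j) x - F k x) powr p) \<partial>lebesgue) \<le> ennreal ((2 * (1 / 4) ^ k) powr p)" for j
      proof -
        have "(\<integral>\<^sup>+x. ennreal (norm (F (k + j) x - F k x) powr p) \<partial>lebesgue)
            = ennreal (\<integral>x. norm (F (k + j) x - F k x) powr p \<partial>lebesgue)"
          by (intro nn_integral_eq_integral Lp_integrable[OF p] Lp_diff[OF p] F) auto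
        also have "\<dots> \<le> ennreal ((2 * (1 / 4) ^ k) powr p)"
          using dist2[of k j] Lp_norm_le_iff[OF p, of "2 * (1 / 4) ^ k" "\<lambda>x. F (k + j) x - F k x"]
          by (intro ennreal_leI) simp
        finally show ?thesis .
      qed
      then have "liminf (\<lambda>j. \<integral>\<^sup>+x. ennreal (norm (F (k + j) x - F k x) powr p) \<partial>lebesgue)
          \<le> liminf (\<lambda>j::nat. ennreal ((2 * (1 / 4) ^ k) powr p))"
        by (intro Liminf_mono always_eventually allI)
      then show ?thesis by (simp add: Liminf_const)
    qed
    finally have b: "(\<integral>\<^sup>+x. ennreal (norm (h x - F k x) powr p) \<partial>lebesgue) \<le> ennreal ((2 * (1 / 4) ^ k) powr p)" .
    then have i: "integrable lebesgue (\<lambda>x. norm (h x - F k x) powr p)"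
      by (intro integrableI_bounded) (auto simp: less_top[symmetric] top_unique)
    have "ennreal (\<integral>x. norm (h x - F k x) powr p \<partial>lebesgue) \<le> ennreal ((2 * (1 / 4) ^ k) powr p)"
      using b nn_integral_eq_integral[OF i] by simp
    then have "(\<integral>x. norm (h x - F k x) powr p \<partial>lebesgue) \<le> (2 * (1 / 4) ^ k) powr p"
      by (simp add: ennreal_le_iff)
    with i show ?thesis
      using Lp_norm_le_iff[OF p, of "2 * (1 / 4) ^ k" "\<lambda>x. h x - F k x"] by (simp add: Lp_space_def)
  qed
  show thesis
  proof (rule that[of h])
    show "h \<in> Lp_space p"
      using Lp_add[OF p conjunct1[OF lim[of 0]] F[of 0]] by simp
    have "(\<lambda>k. 2 * (1 / 4) ^ k :: real) \<longlonglongrightarrow> 2 * 0"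
      by (intro tendsto_mult tendsto_const LIMSEQ_power_zero) simp
    then have l: "(\<lambda>k. 2 * (1 / 4) ^ k :: real) \<longlonglongrightarrow> 0" by simp
    have "norm (Lp_norm p (\<lambda>x. h x - F k x)) \<le> 2 * (1 / 4) ^ k" for k
      using lim[of k] Lp_norm_nonneg[of p "\<lambda>x. h x - F k x"] by simp
    then have b: "eventually (\<lambda>k. norm (Lp_norm p (\<lambda>x. h x - F k x)) \<le> 2 * (1 / 4) ^ k) sequentially"
      by simp
    show "(\<lambda>k. Lp_norm p (\<lambda>x. h x - F k x)) \<longlonglongrightarrow> 0"
      by (rule Lim_null_comparison[OF b l])
  qed
qed

text \<open>The estimate against all g in the span is the only property of h that is kept. It yields
  boundedness with g = 0, agreement with \<open>riesz_star\<close> with g = f, and linearity by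
  approximation.\<close>

lemma riesz_star_limit:
  fixes f :: "real ^ 'd \<Rightarrow> real"
  assumes p: "1 < p" and f: "f \<in> Lp_space p"
  obtains h where "h \<in> Lp_space p"
    "\<And>g. g \<in> hermite_span \<Longrightarrow>
       Lp_norm p (\<lambda>x. h x - riesz_star g x) \<le> 27 * (conj_max p - 1) * Lp_norm p (\<lambda>x. f x - g x)"
proof -
  define K where "K = 27 * (conj_max p - 1)"
  have K: "0 \<le> K" using conj_max_gt_1[OF p] by (simp add: K_def)
  have S: "Lp_norm p (\<lambda>x. riesz_star u x - riesz_star v x) \<le> K * Lp_norm p (\<lambda>x. u x - v x)"
    if "u \<in> hermite_span" "v \<in> hermite_span" for u v :: "real ^ 'd \<Rightarrow> real"
  proof -
    have "(\<lambda>x. u x - v x) \<in> hermite_span"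
      using hermite_span_add[OF that(1) hermite_span_cmult[OF that(2), of "- 1"]] by simp
    moreover have "riesz_star (\<lambda>x. u x - v x) = (\<lambda>x. riesz_star u x - riesz_star v x)"
      using riesz_star_linear[OF that, of 1 "- 1"] by (simp add: fun_eq_iff)
    ultimately show ?thesis using riesz_star_bound[OF p, of "\<lambda>x. u x - v x"] by (simp add: K_def)
  qed
  \<comment> \<open>Chosen so that K (e (k + 1) + e k) \<le> 2 K e k \<le> 4^(-k), the speed that
    \<open>Lp_rapid_limit\<close> asks for; the summand 1 covers K = 0.\<close>
  define e where "e k = (1 / 4) ^ k / (2 * K + 1)" for k :: nat
  have e: "0 < e k" for k using K by (simp add: e_def)
  have "\<forall>k. \<exists>g. g \<in> hermite_span \<and> Lp_norm p (\<lambda>x. f x - g x) < e k"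
    using hermite_span_approx[OF p f e] by metis
  then obtain g where g: "\<And>k. g k \<in> hermite_span" "\<And>k. Lp_norm p (\<lambda>x. f x - g k x) < e k"
    unfolding choice_iff by blast
  have "Lp_norm p (\<lambda>x. riesz_star (g (Suc k)) x - riesz_star (g k) x) \<le> (1 / 4) ^ k" for k
  proof -
    have "Lp_norm p (\<lambda>x. g (Suc k) x - g k x) \<le> e (Suc k) + e k"
      using Lp_norm_triangle_diff[OF p hermite_span_Lp[OF p g(1)] f hermite_span_Lp[OF p g(1)], of "Suc k" k]
        g(2)[of "Suc k"] g(2)[of k] Lp_norm_minus_commute[OF p, of f "g (Suc k)"] by linarith
    also have "e (Suc k) = e k / 4" by (simp add: e_def)
    also have "e k / 4 + e k \<le> 2 * e k" using e[of k] by simp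
    finally have "K * Lp_norm p (\<lambda>x. g (Suc k) x - g k x) \<le> K * (2 * e k)" using K by (intro mult_left_mono)
    also have "\<dots> = (2 * K / (2 * K + 1)) * (1 / 4) ^ k" by (simp add: e_def)
    also have "\<dots> \<le> 1 * (1 / 4) ^ k" using K by (intro mult_right_mono) auto
    finally show ?thesis using S[OF g(1) g(1), of "Suc k" k] by simp
  qed
  from Lp_rapid_limit[OF p riesz_star_Lp[OF p g(1)] this]
  obtain h where h: "h \<in> Lp_space p" "(\<lambda>k. Lp_norm p (\<lambda>x. h x - riesz_star (g k) x)) \<longlonglongrightarrow> 0" by blast
  show thesis
  proof (rule that[OF h(1)])
    fix u :: "real ^ 'd \<Rightarrow> real" assume u: "u \<in> hermite_span"
    have "Lp_norm p (\<lambda>x. h x - riesz_star u x) \<le> Lp_norm p (\<lambda>x. h x - riesz_star (g k) x) + K * (e k + Lp_norm p (\<lambda>x. f x - u x))" for k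
    proof -
      have "Lp_norm p (\<lambda>x. h x - riesz_star u x) \<le>
          Lp_norm p (\<lambda>x. h x - riesz_star (g k) x) + Lp_norm p (\<lambda>x. riesz_star (g k) x - riesz_star u x)"
        by (intro Lp_norm_triangle_diff p h riesz_star_Lp g u)
      also have "Lp_norm p (\<lambda>x. riesz_star (g k) x - riesz_star u x) \<le> K * Lp_norm p (\<lambda>x. g k x - u x)"
        by (rule S[OF g(1) u])
      also have "K * Lp_norm p (\<lambda>x. g k x - u x) \<le> K * (e k + Lp_norm p (\<lambda>x. f x - u x))"
        using Lp_norm_triangle_diff[OF p hermite_span_Lp[OF p g(1)] f hermite_span_Lp[OF p u], of k]
          g(2)[of k] Lp_norm_minus_commute[OF p, of f "g k"] K by (intro mult_left_mono) auto
      finally show ?thesis by simp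
    qed
    moreover have "(\<lambda>k. Lp_norm p (\<lambda>x. h x - riesz_star (g k) x) + K * (e k + Lp_norm p (\<lambda>x. f x - u x)))
        \<longlonglongrightarrow> 0 + K * (0 + Lp_norm p (\<lambda>x. f x - u x))"
    proof -
      have "(\<lambda>k. (1 / 4) ^ k / (2 * K + 1)) \<longlonglongrightarrow> 0 / (2 * K + 1)"
        by (intro tendsto_divide tendsto_const LIMSEQ_power_zero) (use K in auto)
      then have "e \<longlonglongrightarrow> 0" by (simp add: e_def[abs_def])
      then show ?thesis by (intro tendsto_add tendsto_mult tendsto_const h)
    qed
    ultimately show "Lp_norm p (\<lambda>x. h x - riesz_star u x) \<le> 27 * (conj_max p - 1) * Lp_norm p (\<lambda>x. f x - u x)"
      using LIMSEQ_le_const[of _ "0 + K * (0 + Lp_norm p (\<lambda>x. f x - u x))"] by (auto simp: K_def)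
  qed
qed

text \<open>The images are picked independently for each f, so linearity is not built in. It holds
  almost everywhere because both sides are close to \<open>riesz_star\<close> of the same
  combination from the span.\<close>

lemma riesz_star_extension:
  assumes p: "1 < p"
  shows "\<exists>T :: (real ^ 'd \<Rightarrow> real) \<Rightarrow> real ^ 'd \<Rightarrow> real ^ 'd. bounded_Lp_extension p riesz_star T"
proof -
  define K where "K = 27 * (conj_max p - 1)"
  have K: "0 \<le> K" using conj_max_gt_1[OF p] by (simp add: K_def)
  have "\<forall>f :: real ^ 'd \<Rightarrow> real. \<exists>h. f \<in> Lp_space p \<longrightarrow> h \<in> Lp_space p \<and>
     (\<forall>g\<in>hermite_span. Lp_norm p (\<lambda>x. h x - riesz_star g x) \<le> K * Lp_norm p (\<lambda>x. f x - g x))"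
  proof
    fix f :: "real ^ 'd \<Rightarrow> real"
    show "\<exists>h. f \<in> Lp_space p \<longrightarrow> h \<in> Lp_space p \<and>
     (\<forall>g\<in>hermite_span. Lp_norm p (\<lambda>x. h x - riesz_star g x) \<le> K * Lp_norm p (\<lambda>x. f x - g x))"
    proof (cases "f \<in> Lp_space p")
      case True
      then obtain h where "h \<in> Lp_space p" "\<And>g. g \<in> hermite_span \<Longrightarrow>
          Lp_norm p (\<lambda>x. h x - riesz_star g x) \<le> K * Lp_norm p (\<lambda>x. f x - g x)"
        using riesz_star_limit[OF p True] unfolding K_def by blast
      then show ?thesis by blast
    qed simp
  qed
  from choice[OF this] obtain T :: "(real ^ 'd \<Rightarrow> real) \<Rightarrow> real ^ 'd \<Rightarrow> real ^ 'd" where T0: "\<forall>f. f \<in> Lp_space p \<longrightarrow> T f \<in> Lp_space p \<and>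
     (\<forall>g\<in>hermite_span. Lp_norm p (\<lambda>x. T f x - riesz_star g x) \<le> K * Lp_norm p (\<lambda>x. f x - g x))" ..
  have T: "\<And>f. f \<in> Lp_space p \<Longrightarrow> T f \<in> Lp_space p"
    "\<And>f g. f \<in> Lp_space p \<Longrightarrow> g \<in> hermite_span \<Longrightarrow>
      Lp_norm p (\<lambda>x. T f x - riesz_star g x) \<le> K * Lp_norm p (\<lambda>x. f x - g x)"
    using T0 by auto
  have "bounded_Lp_extension p riesz_star T"
    unfolding bounded_Lp_extension_def
  proof (intro conjI ballI allI)
    show "T f \<in> Lp_space p" if "f \<in> Lp_space p" for f by (rule T(1)[OF that])
    show "\<exists>C. \<forall>f\<in>Lp_space p. Lp_norm p (T f) \<le> C * Lp_norm p f"
    proof (intro exI[of _ K] ballI)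
      fix f :: "real ^ 'd \<Rightarrow> real" assume "f \<in> Lp_space p"
      moreover have "riesz_star (\<lambda>x :: real ^ 'd. 0) = (\<lambda>x. 0)"
      proof
        fix x :: "real ^ 'd"
        show "riesz_star (\<lambda>x :: real ^ 'd. 0) x = 0"
          using riesz_star_linear[OF hermite_span_zero hermite_span_zero, of 0 0 x] by simp
      qed
      ultimately show "Lp_norm p (T f) \<le> K * Lp_norm p f"
        using T(2)[OF _ hermite_span_zero, of f] by simp
    qed
    show "AE x in lebesgue. T f x = riesz_star f x" if f: "f \<in> hermite_span" for f
    proof -
      have "Lp_norm p (\<lambda>x. f x - f x) = 0" using p by (simp add: Lp_norm_def)
      then have "Lp_norm p (\<lambda>x. T f x - riesz_star f x) \<le> 0"
        using T(2)[OF hermite_span_Lp[OF p f] f] by simp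
      from Lp_norm_zero_AE[OF p Lp_diff[OF p T(1)[OF hermite_span_Lp[OF p f]] riesz_star_Lp[OF p f]] this]
      show ?thesis by eventually_elim simp
    qed
    fix f g :: "real ^ 'd \<Rightarrow> real" and a b :: real
    assume f: "f \<in> Lp_space p" and g: "g \<in> Lp_space p"
    have af: "(\<lambda>y. a * f y) \<in> Lp_space p" and bg: "(\<lambda>y. b * g y) \<in> Lp_space p"
      using Lp_scale[OF p f, of a] Lp_scale[OF p g, of b] by simp_all
    have s: "(\<lambda>y. a * f y + b * g y) \<in> Lp_space p" by (rule Lp_add[OF p af bg])
    have R: "(\<lambda>x. a *\<^sub>R T f x + b *\<^sub>R T g x) \<in> Lp_space p" by (intro Lp_add Lp_scale p T f g)
    have "Lp_norm p (\<lambda>x. T (\<lambda>y. a * f y + b * g y) x - (a *\<^sub>R T f x + b *\<^sub>R T g x)) \<le> 0"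
    proof (rule field_le_epsilon)
      fix e :: real assume e: "0 < e"
      \<comment> \<open>Two distances to that combination arise, each at most K (|a| + |b|)
        d.\<close>
      define d where "d = e / (2 * K * (\<bar>a\<bar> + \<bar>b\<bar>) + 1)"
      have den: "0 < 2 * K * (\<bar>a\<bar> + \<bar>b\<bar>) + 1" using K by (simp add: add_nonneg_pos)
      have d: "0 < d" using e den by (simp add: d_def)
      obtain u where u: "u \<in> hermite_span" "Lp_norm p (\<lambda>x. f x - u x) < d" using hermite_span_approx[OF p f d] .
      obtain v where v: "v \<in> hermite_span" "Lp_norm p (\<lambda>x. g x - v x) < d" using hermite_span_approx[OF p g d] .
      let ?w = "\<lambda>y. a * u y + b * v y"
      have w: "?w \<in> hermite_span" by (intro hermite_span_add hermite_span_cmult u v)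
      note L = hermite_span_Lp[OF p u(1)] hermite_span_Lp[OF p v(1)] riesz_star_Lp[OF p u(1)] riesz_star_Lp[OF p v(1)]
      have eq: "riesz_star ?w = (\<lambda>x. a *\<^sub>R riesz_star u x + b *\<^sub>R riesz_star v x)"
        by (rule ext) (rule riesz_star_linear[OF u(1) v(1)])
      have split: "Lp_norm p (\<lambda>x. a *\<^sub>R s1 x + b *\<^sub>R s2 x) \<le> \<bar>a\<bar> * Lp_norm p s1 + \<bar>b\<bar> * Lp_norm p s2"
        if "s1 \<in> Lp_space p" "s2 \<in> Lp_space p" for s1 s2 :: "real ^ 'd \<Rightarrow> 'b::euclidean_space"
        using Lp_norm_triangle[OF p Lp_scale[OF p that(1), of a] Lp_scale[OF p that(2), of b]]
        by (simp add: Lp_norm_scale[OF p])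
      have "Lp_norm p (\<lambda>x. T (\<lambda>y. a * f y + b * g y) x - (a *\<^sub>R T f x + b *\<^sub>R T g x))
        \<le> Lp_norm p (\<lambda>x. T (\<lambda>y. a * f y + b * g y) x - riesz_star ?w x)
          + Lp_norm p (\<lambda>x. riesz_star ?w x - (a *\<^sub>R T f x + b *\<^sub>R T g x))"
        by (rule Lp_norm_triangle_diff[OF p T(1)[OF s] riesz_star_Lp[OF p w] R])
      also have "Lp_norm p (\<lambda>x. T (\<lambda>y. a * f y + b * g y) x - riesz_star ?w x) \<le> K * ((\<bar>a\<bar> + \<bar>b\<bar>) * d)"
      proof -
        have "Lp_norm p (\<lambda>x. a * f x + b * g x - ?w x) \<le> \<bar>a\<bar> * Lp_norm p (\<lambda>x. f x - u x) + \<bar>b\<bar> * Lp_norm p (\<lambda>x. g x - v x)"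
          using split[OF Lp_diff[OF p f L(1)] Lp_diff[OF p g L(2)]] by (simp add: algebra_simps)
        also have "\<dots> \<le> \<bar>a\<bar> * d + \<bar>b\<bar> * d" using u v by (intro add_mono mult_left_mono) auto
        finally have "K * Lp_norm p (\<lambda>x. a * f x + b * g x - ?w x) \<le> K * ((\<bar>a\<bar> + \<bar>b\<bar>) * d)"
          using K by (intro mult_left_mono) (auto simp: distrib_right)
        then show ?thesis using T(2)[OF s w] by simp
      qed
      also have "Lp_norm p (\<lambda>x. riesz_star ?w x - (a *\<^sub>R T f x + b *\<^sub>R T g x)) \<le> K * ((\<bar>a\<bar> + \<bar>b\<bar>) * d)"
      proof -
        have "Lp_norm p (\<lambda>x. riesz_star ?w x - (a *\<^sub>R T f x + b *\<^sub>R T g x))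
          = Lp_norm p (\<lambda>x. a *\<^sub>R (T f x - riesz_star u x) + b *\<^sub>R (T g x - riesz_star v x))"
          unfolding eq by (subst Lp_norm_minus_commute[OF p]) (simp add: algebra_simps)
        also have "\<dots> \<le> \<bar>a\<bar> * Lp_norm p (\<lambda>x. T f x - riesz_star u x) + \<bar>b\<bar> * Lp_norm p (\<lambda>x. T g x - riesz_star v x)"
          by (intro split Lp_diff p T f g L)
        also have "\<dots> \<le> \<bar>a\<bar> * (K * d) + \<bar>b\<bar> * (K * d)"
        proof (intro add_mono mult_left_mono)
          have "K * Lp_norm p (\<lambda>x. f x - u x) \<le> K * d" "K * Lp_norm p (\<lambda>x. g x - v x) \<le> K * d"
            using u v K by (auto intro!: mult_left_mono)
          then show "Lp_norm p (\<lambda>x. T f x - riesz_star u x) \<le> K * d" "Lp_norm p (\<lambda>x. T g x - riesz_star v x) \<le> K * d"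
            using T(2)[OF f u(1)] T(2)[OF g v(1)] by linarith+
        qed auto
        finally show ?thesis by (simp add: algebra_simps)
      qed
      also have "K * ((\<bar>a\<bar> + \<bar>b\<bar>) * d) + K * ((\<bar>a\<bar> + \<bar>b\<bar>) * d) = (2 * K * (\<bar>a\<bar> + \<bar>b\<bar>)) * d" by simp
      also have "\<dots> \<le> (2 * K * (\<bar>a\<bar> + \<bar>b\<bar>) + 1) * d" using d by (intro mult_right_mono) auto
      also have "\<dots> = e" using den by (simp add: d_def)
      finally show "Lp_norm p (\<lambda>x. T (\<lambda>y. a * f y + b * g y) x - (a *\<^sub>R T f x + b *\<^sub>R T g x)) \<le> 0 + e" by simp
    qed
    from Lp_norm_zero_AE[OF p Lp_diff[OF p T(1)[OF s] R] this]
    show "AE x in lebesgue. T (\<lambda>y. a * f y + b * g y) x = a *\<^sub>R T f x + b *\<^sub>R T g x"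
      by eventually_elim simp
  qed
  then show ?thesis by blast
qed

text \<open>The unspecified bound C multiplies only the norm of f - g with g in the span, which is
  as small as desired. Every bounded extension therefore inherits the constant from the
  span.\<close>

lemma bounded_Lp_extension_bound:
  fixes T :: "(real ^ 'd \<Rightarrow> real) \<Rightarrow> real ^ 'd \<Rightarrow> real ^ 'd"
  assumes p: "1 < p" and T: "bounded_Lp_extension p riesz_star T" and f: "f \<in> Lp_space p"
  shows "Lp_norm p (T f) \<le> 27 * (conj_max p - 1) * Lp_norm p f"
proof -
  define K where "K = 27 * (conj_max p - 1)"
  have K: "0 \<le> K" using conj_max_gt_1[OF p] by (simp add: K_def)
  obtain C where "\<forall>f\<in>Lp_space p. Lp_norm p (T f) \<le> C * Lp_norm p f"
    using T unfolding bounded_Lp_extension_def by blast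
  then have C: "\<And>f. f \<in> Lp_space p \<Longrightarrow> Lp_norm p (T f) \<le> C * Lp_norm p f" by blast
  have TL: "\<And>f. f \<in> Lp_space p \<Longrightarrow> T f \<in> Lp_space p" using T by (auto simp: bounded_Lp_extension_def)
  have "Lp_norm p (T f) \<le> K * Lp_norm p f"
  proof (rule field_le_epsilon)
    fix e :: real assume e: "0 < e"
    define d where "d = e / (K + \<bar>C\<bar> + 1)"
    have d: "0 < d" using e K by (simp add: d_def)
    obtain g where g: "g \<in> hermite_span" "Lp_norm p (\<lambda>x. f x - g x) < d" using hermite_span_approx[OF p f d] .
    note L = hermite_span_Lp[OF p g(1)]
    define r where "r = (\<lambda>y. 1 * f y + (- 1) * g y)"
    have rd: "r = (\<lambda>x. f x - g x)" by (simp add: r_def)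
    have rL: "r \<in> Lp_space p" unfolding rd by (rule Lp_diff[OF p f L])
    have "AE x in lebesgue. T r x = 1 *\<^sub>R T f x + (- 1) *\<^sub>R T g x"
      using T f L unfolding bounded_Lp_extension_def r_def by blast
    moreover have "AE x in lebesgue. T g x = riesz_star g x"
      using T g(1) unfolding bounded_Lp_extension_def by blast
    ultimately have "AE x in lebesgue. T f x = T r x + riesz_star g x"
      by eventually_elim simp
    then have "Lp_norm p (T f) = Lp_norm p (\<lambda>x. T r x + riesz_star g x)"
      by (intro Lp_norm_cong_AE[OF p] Lp_meas[OF p] Lp_add[OF p] TL f rL riesz_star_Lp[OF p g(1)])
    also have "\<dots> \<le> Lp_norm p (T r) + Lp_norm p (riesz_star g)"
      by (intro Lp_norm_triangle p TL rL riesz_star_Lp g)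
    also have "\<dots> \<le> \<bar>C\<bar> * d + K * (Lp_norm p f + d)"
    proof (rule add_mono)
      have "Lp_norm p (T r) \<le> C * Lp_norm p r" by (rule C[OF rL])
      also have "\<dots> \<le> \<bar>C\<bar> * Lp_norm p r" using Lp_norm_nonneg[of p r] by (intro mult_right_mono) auto
      also have "\<dots> \<le> \<bar>C\<bar> * d" using g(2) by (intro mult_left_mono) (auto simp: rd)
      finally show "Lp_norm p (T r) \<le> \<bar>C\<bar> * d" .
      have "Lp_norm p g \<le> Lp_norm p f + d"
        using Lp_norm_le_add_diff[OF p L f] g(2) Lp_norm_minus_commute[OF p, of f g] by linarith
      then show "Lp_norm p (riesz_star g) \<le> K * (Lp_norm p f + d)"
        using riesz_star_bound[OF p g(1)] mult_left_mono[of "Lp_norm p g" "Lp_norm p f + d" K] K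
        unfolding K_def by linarith
    qed
    also have "\<dots> \<le> K * Lp_norm p f + (K + \<bar>C\<bar> + 1) * d" using d by (simp add: algebra_simps)
    also have "(K + \<bar>C\<bar> + 1) * d = e" using K by (simp add: d_def)
    finally show "Lp_norm p (T f) \<le> K * Lp_norm p f + e" .
  qed
  then show ?thesis by (simp add: K_def)
qed

text \<open>The extension is not a fixed term, so the estimate is claimed for every bounded
  extension; the existence claim keeps this from being vacuous.\<close>

theorem theorem13:
  fixes p :: real
  assumes "1 < p"
  shows "(\<forall>f \<in> (hermite_span :: (real ^ 'd \<Rightarrow> real) set).
            riesz_star f \<in> Lp_space p \<and>
            Lp_norm p (riesz_star f) \<le> 84 * (conj_max p - 1) * Lp_norm p f) \<and>
         (\<exists>T :: (real ^ 'd \<Rightarrow> real) \<Rightarrow> real ^ 'd \<Rightarrow> real ^ 'd.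
            bounded_Lp_extension p riesz_star T) \<and>
         (\<forall>T :: (real ^ 'd \<Rightarrow> real) \<Rightarrow> real ^ 'd \<Rightarrow> real ^ 'd.
            bounded_Lp_extension p riesz_star T \<longrightarrow>
            (\<forall>f \<in> Lp_space p.
               Lp_norm p (T f) \<le> 84 * (conj_max p - 1) * Lp_norm p f))"
proof -
  have "27 * (conj_max p - 1) * Lp_norm p f \<le> 84 * (conj_max p - 1) * Lp_norm p f" for f :: "real ^ 'd \<Rightarrow> real"
    using conj_max_gt_1[OF assms] Lp_norm_nonneg[of p f] by (intro mult_right_mono) auto
  then show ?thesis
    using riesz_star_Lp[OF assms] riesz_star_bound[OF assms] riesz_star_extension[OF assms]
      bounded_Lp_extension_bound[OF assms] by (meson order_trans)
qed

end
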